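(* Let $\mathfrak a\in\mathrm{Id}(\mathcal O_K)$. The map $$\Phi^{\mathfrak a}:\mathrm{Rep}^{f}(\mathfrak a)\to\mathbb G^n/\Lambda,\qquad ([\mathfrak b]_\sim,t)\mapsto d^{\mathfrak a}([\mathfrak b]_\sim)+t$$ is a bijection, and $([\mathfrak b]_\sim,(0,\dots,0))\in\mathrm{Rep}^{f}(\mathfrak a)$ for every $[\mathfrak b]_\sim\in\mathrm{Red}(\mathfrak a)/_\sim$.
   Context: **Fields and places.** $K$ is either a number field, or an algebraic function field in one variable with exact field of constants $k$ ($k$ not assumed finite). *Number field case:* $\mathcal O_K$ is the ring of integers, $S$ the set of archimedean places, $\mathbb G=\mathbb R$, $q=e$; for $\mathfrak p\in S$ corresponding to an embedding $\sigma:K\to\mathbb C$, $\deg\mathfrak p=1$ if $\sigma(K)\subseteq\mathbb R$ and $\deg\mathfrak p=2$ otherwise, and $\nu_{\mathfrak p}(f)=-\log|\sigma(f)|$ for $f\in K^*$. *Function field case:* $x\in K$ is a fixed element transcendental over $k$, $\mathcal O_K$ is the integral closure of $k[x]$ in $K$, $S$ is the set of places of $K$ above the infinite place of $k(x)$, $\mathbb G=\mathbb Z$, $q=|k|$ if $k$ is finite and otherwise $q>1$ is an arbitrary fixed real number; $\nu_{\mathfrak p}$ is the normalized valuation and $\deg\mathfrak p$ the usual degree over $k$. In both cases $|f|_{\mathfrak p}=q^{-\nu_{\mathfrak p}(f)\deg\mathfrak p}$ for $f\in K^*$ and $|0|_{\mathfrak p}=0$. Write $S=\{\mathfrak p_1,\dots,\mathfrak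 p_{n+1}\}$ with $n=|S|-1$ (fixed ordering). **Ideals.** "Ideal" means nonzero fractional ideal of $\mathcal O_K$; $\mathrm{Id}(\mathcal O_K)$ is the group of these. For an ideal $\mathfrak b$ and $t_1,\dots,t_{n+1}\in\mathbb G$ let $B(\mathfrak b,(t_1,\dots,t_{n+1}))=\{h\in\mathfrak b: |h|_{\mathfrak p_i}\le q^{t_i\deg\mathfrak p_i},\ 1\le i\le n+1\}$. An ideal $\mathfrak b$ is *reduced* if $1\in\mathfrak b$ and every nonzero $h\in B(\mathfrak b,(0,\dots,0))$ satisfies $|h|_{\mathfrak p}=1$ for all $\mathfrak p\in S$. $\mathrm{Red}(\mathfrak a)$ is the set of reduced ideals of the form $\frac1\mu\mathfrak a$, $\mu\in K^*$. Define $\mathfrak b\sim\mathfrak b'$ iff there is $h\in K^*$ with $\mathfrak b=h\mathfrak b'$ and $|h|_{\mathfrak p}=1$ for all $\mathfrak p\in S$; $[\mathfrak b]_\sim$ is the class. **Distance.** $\Psi:K^*\to\mathbb G^n$, $\Psi(h)=(-\nu_{\mathfrak p_1}(h),\dots,-\nu_{\mathfrak p_n}(h))$; $\Lambda=\Psi(\mathcal O_K^* )$; $d^{\mathfrak a}:\mathrm{Red}(\mathfrak a)/_\sim\to\mathbb G^n/\Lambda$ is the (well-defined) map $[\frac1\mu\mathfrak a]_\sim\mapsto\Psi(\mu)+\Lambda$. **$f$-representations.** Define a total preorder on $K^*$ by $h\le h'$ iff $(|h|_{\mathfrak p_{n+1}},|h|_{\mathfrak p_1},\dots,|h|_{\mathfrak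 p_n})\le_{lex}(|h'|_{\mathfrak p_{n+1}},|h'|_{\mathfrak p_1},\dots,|h'|_{\mathfrak p_n})$ in the lexicographic order on $\mathbb R^{n+1}$. $\mathrm{Rep}^{f}(\mathfrak a)$ is the set of $([\mathfrak b]_\sim,(t_1,\dots,t_n))\in\mathrm{Red}(\mathfrak a)/_\sim\times\mathbb G^n$ such that $1$ is an element of $B(\mathfrak b,(t_1,\dots,t_n,0))\setminus\{0\}$ and is a smallest element of this set with respect to $\le$ (this does not depend on the representative $\mathfrak b$). *)

theory Defs
  imports Complex_Main "HOL-Computational_Algebra.Polynomial"
    "HOL-Algebra.Algebraic_Closure_Type" "HOL-Algebra.Generated_Fields" "HOL-Algebra.Product_Groups"
begin

text \<open>
  The field \<open>K\<close> is the type \<^typ>\<open>'a\<close>, of class \<^class>\<open>field\<close>; as a ring with carrier it is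
  \<^const>\<open>ring_of_type_algebra\<close>. A place is represented by its function \<open>\<nu>\<close>, with the
  convention \<open>\<nu> 0 = 0\<close>, so that a place has exactly one representative. (The value at \<open>0\<close> is
  never used.) The function-field valuations, which are integer valued, are regarded as functions
  into the reals, and accordingly the value group \<open>\<int>\<close> as a subset of \<open>\<real>\<close>.
\<close>

text \<open>\<open>FunctionField k x q\<close> carries the field of constants \<open>k\<close>, the chosen
  transcendental element \<open>x\<close> and the base \<open>q\<close> of the absolute values.\<close>

datatype 'a setting = NumberField | FunctionField "'a set" 'a real

abbreviation K_ring :: "'a :: field ring"
  where "K_ring \<equiv> ring_of_type_algebra"


subsection \<open>Number fields\<close>

text \<open>\<open>generate_field K_ring {}\<close> is the prime field, which is \<open>\<rat>\<close> in characteristic \<open>0\<close>.\<close>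

definition is_number_field :: "'a :: field itself \<Rightarrow> bool"
  where "is_number_field _ \<longleftrightarrow>
    CHAR('a) = 0 \<and>
    ring.finite_dimension (K_ring :: 'a ring) (generate_field K_ring {}) UNIV"

definition embeddings :: "('a :: field \<Rightarrow> complex) set"
  where "embeddings = ring_hom K_ring (K_ring :: complex ring)"

definition arch_val :: "('a :: field \<Rightarrow> complex) \<Rightarrow> 'a \<Rightarrow> real"
  where "arch_val \<sigma> f = (if f = 0 then 0 else - ln (cmod (\<sigma> f)))"

text \<open>Conjugate embeddings give the same function and hence the same place.\<close>

definition arch_places :: "('a :: field \<Rightarrow> real) set"
  where "arch_places = arch_val ` embeddings"

definition arch_deg :: "('a :: field \<Rightarrow> real) \<Rightarrow> nat"
  where "arch_deg \<nu> = (if \<exists>\<sigma>\<in>embeddings. \<nu> = arch_val \<sigma> \<and> range \<sigma> \<subseteq> \<real> then 1 else 2)"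


subsection \<open>Function fields\<close>

text \<open>\<open>generate_field K_ring (insert y k)\<close> is \<open>k(y)\<close>.\<close>

definition is_function_field :: "'a :: field set \<Rightarrow> bool"
  where "is_function_field k \<longleftrightarrow>
    subfield k K_ring \<and>
    (\<exists>y. ring.transcendental K_ring k y \<and>
         ring.finite_dimension K_ring (generate_field K_ring (insert y k)) UNIV) \<and>
    (\<forall>z. ring.algebraic K_ring k z \<longrightarrow> z \<in> k)"

definition integral_closure :: "'a :: field set \<Rightarrow> 'a set"
  where "integral_closure A =
    {z. \<exists>p :: 'a poly. Polynomial.lead_coeff p = 1 \<and> (\<forall>i. Polynomial.coeff p i \<in> A) \<and> poly p z = 0}"

definition is_place :: "'a :: field set \<Rightarrow> ('a \<Rightarrow> real) \<Rightarrow> bool"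
  where "is_place k \<nu> \<longleftrightarrow>
    \<nu> 0 = 0 \<and>
    (\<forall>f g. f \<noteq> 0 \<and> g \<noteq> 0 \<longrightarrow> \<nu> (f * g) = \<nu> f + \<nu> g) \<and>
    (\<forall>f g. f \<noteq> 0 \<and> g \<noteq> 0 \<and> f + g \<noteq> 0 \<longrightarrow> min (\<nu> f) (\<nu> g) \<le> \<nu> (f + g)) \<and>
    \<nu> ` (- {0}) = \<int> \<and>
    (\<forall>c\<in>k - {0}. \<nu> c = 0)"

text \<open>The infinite place of \<open>k(x)\<close> maps \<open>a(x) / b(x)\<close> to \<open>deg b - deg a\<close>; the number \<open>e\<close> below
  is the ramification index.\<close>

definition above_infinity :: "'a :: field set \<Rightarrow> 'a \<Rightarrow> ('a \<Rightarrow> real) \<Rightarrow> bool"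
  where "above_infinity k x \<nu> \<longleftrightarrow>
    (\<exists>e::nat. e > 0 \<and>
      (\<forall>a b :: 'a poly. a \<noteq> 0 \<and> b \<noteq> 0 \<and> set (coeffs a) \<subseteq> k \<and> set (coeffs b) \<subseteq> k \<longrightarrow>
        \<nu> (poly a x / poly b x) =
          real e * (real (Polynomial.degree b) - real (Polynomial.degree a))))"

definition infinite_places :: "'a :: field set \<Rightarrow> 'a \<Rightarrow> ('a \<Rightarrow> real) set"
  where "infinite_places k x = {\<nu>. is_place k \<nu> \<and> above_infinity k x \<nu>}"

definition val_ring :: "('a :: field \<Rightarrow> real) \<Rightarrow> 'a ring"
  where "val_ring \<nu> = K_ring \<lparr>carrier := {f. f = 0 \<or> \<nu> f \<ge> 0}\<rparr>"

definition val_max :: "('a :: field \<Rightarrow> real) \<Rightarrow> 'a set"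
  where "val_max \<nu> = {f. f = 0 \<or> \<nu> f > 0}"

definition residue_field :: "('a :: field \<Rightarrow> real) \<Rightarrow> 'a set ring"
  where "residue_field \<nu> = val_ring \<nu> Quot val_max \<nu>"

text \<open>The dimension of the residue field over the image of \<open>k\<close> in it.\<close>

definition residue_deg :: "'a :: field set \<Rightarrow> ('a \<Rightarrow> real) \<Rightarrow> nat"
  where "residue_deg k \<nu> =
    ring.dim (residue_field \<nu>) ((\<lambda>c. val_max \<nu> +>\<^bsub>val_ring \<nu>\<^esub> c) ` k) (carrier (residue_field \<nu>))"


subsection \<open>Both cases\<close>

fun valid_setting :: "'a :: field setting \<Rightarrow> bool"
  where
    "valid_setting NumberField \<longleftrightarrow> is_number_field TYPE('a)"
  | "valid_setting (FunctionField k x q) \<longleftrightarrow>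
       is_function_field k \<and> ring.transcendental K_ring k x \<and>
       (if finite k then q = real (card k) else q > 1)"

fun int_ring :: "'a :: field setting \<Rightarrow> 'a set"
  where
    "int_ring NumberField = {z. algebraic_int z}"
  | "int_ring (FunctionField k x q) = integral_closure (ring.simple_extension K_ring k x)"

fun val_group :: "'a :: field setting \<Rightarrow> real set"
  where
    "val_group NumberField = UNIV"
  | "val_group (FunctionField k x q) = \<int>"

fun base :: "'a :: field setting \<Rightarrow> real"
  where
    "base NumberField = exp 1"
  | "base (FunctionField k x q) = q"

fun places :: "'a :: field setting \<Rightarrow> ('a \<Rightarrow> real) set"
  where
    "places NumberField = arch_places"
  | "places (FunctionField k x q) = infinite_places k x"

fun place_deg :: "'a :: field setting \<Rightarrow> ('a \<Rightarrow> real) \<Rightarrow> nat"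
  where
    "place_deg NumberField \<nu> = arch_deg \<nu>"
  | "place_deg (FunctionField k x q) \<nu> = residue_deg k \<nu>"

definition absval :: "'a :: field setting \<Rightarrow> ('a \<Rightarrow> real) \<Rightarrow> 'a \<Rightarrow> real"
  where "absval \<K> \<nu> f = (if f = 0 then 0 else base \<K> powr (- \<nu> f * real (place_deg \<K> \<nu>)))"


subsection \<open>Ideals\<close>

text \<open>Nonzero fractional ideals of the domain \<open>R\<close> with field of fractions \<^typ>\<open>'a\<close>.\<close>

definition frac_ideals :: "'a :: field set \<Rightarrow> 'a set set"
  where "frac_ideals R =
    {I. 0 \<in> I \<and> I \<noteq> {0} \<and> (\<forall>f\<in>I. \<forall>g\<in>I. f + g \<in> I) \<and> (\<forall>r\<in>R. \<forall>f\<in>I. r * f \<in> I) \<and>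
        (\<exists>d\<in>R. d \<noteq> 0 \<and> (\<forall>f\<in>I. d * f \<in> R))}"

abbreviation scale_ideal :: "'a :: field \<Rightarrow> 'a set \<Rightarrow> 'a set"
  where "scale_ideal h I \<equiv> (*) h ` I"

text \<open>From here on, \<open>p 1, \<dots>, p (n + 1)\<close> enumerate the places in \<open>S\<close>.\<close>

definition box :: "'a :: field setting \<Rightarrow> nat \<Rightarrow> (nat \<Rightarrow> 'a \<Rightarrow> real) \<Rightarrow> 'a set \<Rightarrow> (nat \<Rightarrow> real) \<Rightarrow> 'a set"
  where "box \<K> n p b t =
    {h\<in>b. \<forall>i\<in>{1..n+1}. absval \<K> (p i) h \<le> base \<K> powr (t i * real (place_deg \<K> (p i)))}"

definition reduced :: "'a :: field setting \<Rightarrow> nat \<Rightarrow> (nat \<Rightarrow> 'a \<Rightarrow> real) \<Rightarrow> 'a set \<Rightarrow> bool"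
  where "reduced \<K> n p b \<longleftrightarrow>
    1 \<in> b \<and> (\<forall>h \<in> box \<K> n p b (\<lambda>_. 0). h \<noteq> 0 \<longrightarrow> (\<forall>\<pp>\<in>places \<K>. absval \<K> \<pp> h = 1))"

definition Red :: "'a :: field setting \<Rightarrow> nat \<Rightarrow> (nat \<Rightarrow> 'a \<Rightarrow> real) \<Rightarrow> 'a set \<Rightarrow> 'a set set"
  where "Red \<K> n p a = {b. reduced \<K> n p b \<and> (\<exists>\<mu>. \<mu> \<noteq> 0 \<and> b = scale_ideal (1 / \<mu>) a)}"

definition ideal_sim :: "'a :: field setting \<Rightarrow> ('a set \<times> 'a set) set"
  where "ideal_sim \<K> =
    {(b, b'). b \<in> frac_ideals (int_ring \<K>) \<and> b' \<in> frac_ideals (int_ring \<K>) \<and>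
      (\<exists>h. h \<noteq> 0 \<and> b = scale_ideal h b' \<and> (\<forall>\<pp>\<in>places \<K>. absval \<K> \<pp> h = 1))}"

abbreviation sim_class :: "'a :: field setting \<Rightarrow> 'a set \<Rightarrow> 'a set set"
  where "sim_class \<K> b \<equiv> ideal_sim \<K> `` {b}"


subsection \<open>Distance\<close>

text \<open>The group \<open>\<G>\<^sup>n\<close>: tuples are functions on the index set \<open>{1..n}\<close>.\<close>

definition vec_group :: "'a :: field setting \<Rightarrow> nat \<Rightarrow> (nat \<Rightarrow> real) monoid"
  where "vec_group \<K> n =
    product_group {1..n} (\<lambda>_. \<lparr>carrier = val_group \<K>, monoid.mult = (+), one = 0\<rparr>)"

definition Psi :: "nat \<Rightarrow> (nat \<Rightarrow> 'a :: field \<Rightarrow> real) \<Rightarrow> 'a \<Rightarrow> nat \<Rightarrow> real"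
  where "Psi n p h = (\<lambda>i\<in>{1..n}. - p i h)"

definition unit_lattice :: "'a :: field setting \<Rightarrow> nat \<Rightarrow> (nat \<Rightarrow> 'a \<Rightarrow> real) \<Rightarrow> (nat \<Rightarrow> real) set"
  where "unit_lattice \<K> n p =
    Psi n p ` {u \<in> int_ring \<K>. u \<noteq> 0 \<and> inverse u \<in> int_ring \<K>}"

definition vec_quot :: "'a :: field setting \<Rightarrow> nat \<Rightarrow> (nat \<Rightarrow> 'a \<Rightarrow> real) \<Rightarrow> (nat \<Rightarrow> real) set monoid"
  where "vec_quot \<K> n p = vec_group \<K> n Mod unit_lattice \<K> n p"

abbreviation vec_class ::
    "'a :: field setting \<Rightarrow> nat \<Rightarrow> (nat \<Rightarrow> 'a \<Rightarrow> real) \<Rightarrow> (nat \<Rightarrow> real) \<Rightarrow> (nat \<Rightarrow> real) set"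
  where "vec_class \<K> n p t \<equiv> unit_lattice \<K> n p #>\<^bsub>vec_group \<K> n\<^esub> t"

definition dist_map ::
    "'a :: field setting \<Rightarrow> nat \<Rightarrow> (nat \<Rightarrow> 'a \<Rightarrow> real) \<Rightarrow> 'a set \<Rightarrow> 'a set set \<Rightarrow> (nat \<Rightarrow> real) set"
  where "dist_map \<K> n p a C =
    (THE c. \<exists>\<mu>. \<mu> \<noteq> 0 \<and> scale_ideal (1 / \<mu>) a \<in> Red \<K> n p a \<and>
       C = sim_class \<K> (scale_ideal (1 / \<mu>) a) \<and> c = vec_class \<K> n p (Psi n p \<mu>))"


subsection \<open>f-representations\<close>

text \<open>The last place comes first in the comparison.\<close>

definition elem_le :: "'a :: field setting \<Rightarrow> nat \<Rightarrow> (nat \<Rightarrow> 'a \<Rightarrow> real) \<Rightarrow> 'a \<Rightarrow> 'a \<Rightarrow> bool"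
  where "elem_le \<K> n p h h' \<longleftrightarrow>
    lexordp_eq (map (\<lambda>i. absval \<K> (p i) h) ((n+1) # [1..<n+1]))
               (map (\<lambda>i. absval \<K> (p i) h') ((n+1) # [1..<n+1]))"

definition Rep_f ::
    "'a :: field setting \<Rightarrow> nat \<Rightarrow> (nat \<Rightarrow> 'a \<Rightarrow> real) \<Rightarrow> 'a set \<Rightarrow> ('a set set \<times> (nat \<Rightarrow> real)) set"
  where "Rep_f \<K> n p a =
    {(sim_class \<K> b, t) | b t. b \<in> Red \<K> n p a \<and> t \<in> carrier (vec_group \<K> n) \<and>
       1 \<in> box \<K> n p b (t(n+1 := 0)) - {0} \<and>
       (\<forall>h \<in> box \<K> n p b (t(n+1 := 0)) - {0}. elem_le \<K> n p 1 h)}"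

text \<open>The sum of a class in \<open>\<G>\<^sup>n/\<Lambda>\<close> and a vector \<open>t\<close> is taken in the quotient group.\<close>

definition Phi ::
    "'a :: field setting \<Rightarrow> nat \<Rightarrow> (nat \<Rightarrow> 'a \<Rightarrow> real) \<Rightarrow> 'a set \<Rightarrow>
      'a set set \<times> (nat \<Rightarrow> real) \<Rightarrow> (nat \<Rightarrow> real) set"
  where "Phi \<K> n p a = (\<lambda>(C, t). dist_map \<K> n p a C \<otimes>\<^bsub>vec_quot \<K> n p\<^esub> vec_class \<K> n p t)"

end

theory Submission
  imports Defs "Jordan_Normal_Form.Char_Poly"
begin

text \<open>
  Write \<open>s = \<Psi>(\<mu>) + t\<close>. Then \<open>1\<close> is a smallest element of \<open>B(\<mu>\<^sup>-\<^sup>1 a, (t, 0))\<close> if and only if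
  \<open>\<mu>\<close> is a smallest nonzero element of \<open>a\<close> among those bounded by \<open>s\<close> at the first \<open>n\<close> places
  (and unrestricted at the last one). So a representation over the class of \<open>s\<close> is a choice of
  such a \<open>\<mu>\<close>, up to units, and two smallest elements have the same absolute values. What remains is that the
  distance is well defined (an element stabilizing \<open>a\<close> is integral) and that smallest elements
  exist.

  Both follow from the finiteness of the boxes \<open>{h \<in> a. |h| \<le> C}\<close> at all places in \<open>S\<close>: as
  a set if \<open>K\<close> is a number field (minimal polynomials have bounded integral coefficients, since
  every root comes from an embedding), and as a vector space over \<open>k\<close> if \<open>K\<close> is a function
  field (residue fields are finite over \<open>k\<close>, and an integral element without poles at infinity
  is constant). As the box contains representatives of \<open>a\<close> modulo a submodule spanned by a basis
  of \<open>K\<close>, the ideal \<open>a\<close> is finitely generated over \<open>\<int>\<close> or \<open>k[x]\<close>, and the determinant trick applies.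
  Elements that are small at the first \<open>n\<close> places are found by the pigeonhole principle and,
  for function fields, by counting dimensions along the powers of an element whose only pole in
  \<open>S\<close> is the last place.
\<close>

section \<open>Modules over a subring of a field\<close>

text \<open>The obstacle is that \<open>k\<close> may be infinite. A box is then an infinite set,
  and it has a minimum only because few value vectors occur in it: at one place, elements with
  different values are linearly independent over \<open>k\<close>, so a space of dimension
  \<open>d\<close> has at most \<open>d\<close> values away from \<open>0\<close>. This is why
  \<open>place_system\<close> asks for finitely many values and not for finitely many elements.

  The claim on integral elements without poles needs enough places. For a nonconstant
  \<open>h\<close> integral over \<open>k[x]\<close>, Zorn's lemma gives a valuation ring that
  contains \<open>k[1/h]\<close> but not \<open>h\<close>, and the finiteness of \<open>K\<close>
  over \<open>k(x)\<close> makes it discrete. The counterpart for number fields, that every root of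
  a minimal polynomial is the image under an embedding, extends homomorphisms into the complex
  numbers by the same principle.\<close>

locale idom_subring =
  fixes A :: "'a :: idom set"
  assumes zero_closed: "0 \<in> A" and one_closed: "1 \<in> A"
    and add_closed: "x \<in> A \<Longrightarrow> y \<in> A \<Longrightarrow> x + y \<in> A"
    and mult_closed: "x \<in> A \<Longrightarrow> y \<in> A \<Longrightarrow> x * y \<in> A"
    and minus_closed: "x \<in> A \<Longrightarrow> - x \<in> A"
begin

lemma diff_closed: "x \<in> A \<Longrightarrow> y \<in> A \<Longrightarrow> x - y \<in> A"
  using add_closed[of x "- y"] minus_closed[of y] by simp

lemma sum_closed: "(\<And>i. i \<in> I \<Longrightarrow> f i \<in> A) \<Longrightarrow> sum f I \<in> A"
  by (induction I rule: infinite_finite_induct) (auto simp: zero_closed add_closed)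

lemma prod_closed: "(\<And>i. i \<in> I \<Longrightarrow> f i \<in> A) \<Longrightarrow> prod f I \<in> A"
  by (induction I rule: infinite_finite_induct) (auto simp: one_closed mult_closed)

lemma power_closed: "x \<in> A \<Longrightarrow> x ^ m \<in> A"
  by (induction m) (auto simp: one_closed mult_closed)

lemma poly_closed: "(\<And>i. Polynomial.coeff f i \<in> A) \<Longrightarrow> x \<in> A \<Longrightarrow> poly f x \<in> A"
  unfolding poly_altdef by (intro sum_closed mult_closed power_closed)

lemma coeff_mult_closed:
  "(\<And>i. Polynomial.coeff f i \<in> A) \<Longrightarrow> (\<And>i. Polynomial.coeff g i \<in> A) \<Longrightarrow>
    Polynomial.coeff (f * g) i \<in> A"
  unfolding coeff_mult by (intro sum_closed mult_closed)

end

definition submodule_of :: "'a :: idom set \<Rightarrow> 'a set \<Rightarrow> bool"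
  where "submodule_of A M \<longleftrightarrow>
    0 \<in> M \<and> (\<forall>x\<in>M. \<forall>y\<in>M. x + y \<in> M) \<and> (\<forall>r\<in>A. \<forall>x\<in>M. r * x \<in> M)"

text \<open>The coefficients lie in \<open>A\<close> everywhere, not only on \<open>S\<close>, so
  that no restriction has to be carried along. For infinite \<open>S\<close> the sum is
  \<open>0\<close> by convention, so this is the span only for finite \<open>S\<close>.\<close>

definition lspan :: "'a :: idom set \<Rightarrow> 'a set \<Rightarrow> 'a set"
  where "lspan A S = {\<Sum>s\<in>S. c s * s | c. \<forall>s. c s \<in> A}"

lemma submodule_ofD:
  assumes "submodule_of A M"
  shows "0 \<in> M" "x \<in> M \<Longrightarrow> y \<in> M \<Longrightarrow> x + y \<in> M" "r \<in> A \<Longrightarrow> x \<in> M \<Longrightarrow> r * x \<in> M"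
  using assms by (auto simp: submodule_of_def)

lemma submodule_of_sum:
  "submodule_of A M \<Longrightarrow> (\<And>i. i \<in> I \<Longrightarrow> f i \<in> M) \<Longrightarrow> sum f I \<in> M"
  by (induction I rule: infinite_finite_induct) (auto simp: submodule_of_def)

lemma lspan_subset: "submodule_of A M \<Longrightarrow> S \<subseteq> M \<Longrightarrow> lspan A S \<subseteq> M"
  unfolding lspan_def by (auto intro!: submodule_of_sum submodule_ofD(3))

context idom_subring
begin

lemma submodule_minus: "submodule_of A M \<Longrightarrow> x \<in> M \<Longrightarrow> - x \<in> M"
  using submodule_ofD(3)[of A M "- 1" x] minus_closed[OF one_closed] by simp

lemma submodule_diff: "submodule_of A M \<Longrightarrow> x \<in> M \<Longrightarrow> y \<in> M \<Longrightarrow> x - y \<in> M"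
  using submodule_ofD(2)[of A M x "- y"] submodule_minus by simp

lemma submodule_lspan: "submodule_of A (lspan A S)"
proof -
  have "0 \<in> lspan A S"
    unfolding lspan_def by (intro CollectI exI[of _ "\<lambda>_. 0"]) (auto simp: zero_closed)
  moreover have "x + y \<in> lspan A S" if "x \<in> lspan A S" "y \<in> lspan A S" for x y
  proof -
    from that obtain c d where "\<forall>s. c s \<in> A" "x = (\<Sum>s\<in>S. c s * s)"
      "\<forall>s. d s \<in> A" "y = (\<Sum>s\<in>S. d s * s)" by (auto simp: lspan_def)
    then show ?thesis unfolding lspan_def
      by (intro CollectI exI[of _ "\<lambda>s. c s + d s"]) (auto simp: add_closed sum.distrib algebra_simps)
  qed
  moreover have "r * x \<in> lspan A S" if "r \<in> A" "x \<in> lspan A S" for r x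
  proof -
    from that obtain c where "\<forall>s. c s \<in> A" "x = (\<Sum>s\<in>S. c s * s)" by (auto simp: lspan_def)
    with \<open>r \<in> A\<close> show ?thesis unfolding lspan_def
      by (intro CollectI exI[of _ "\<lambda>s. r * c s"]) (auto simp: mult_closed sum_distrib_left mult.assoc)
  qed
  ultimately show ?thesis by (auto simp: submodule_of_def)
qed

lemma lspan_incl: assumes "finite S" shows "S \<subseteq> lspan A S"
proof
  fix s assume "s \<in> S"
  with assms have "(\<Sum>t\<in>S. (if t = s then 1 else 0) * t) = s"
    by (subst sum.cong[OF refl, of S _ "\<lambda>t. if t = s then t else 0"]) (auto simp: sum.delta)
  then show "s \<in> lspan A S" unfolding lspan_def
    by (intro CollectI exI[of _ "\<lambda>t. if t = s then 1 else 0"]) (auto simp: zero_closed one_closed)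
qed

lemma lspan_mono: "finite T \<Longrightarrow> S \<subseteq> T \<Longrightarrow> lspan A S \<subseteq> lspan A T"
  using lspan_incl[of T] by (intro lspan_subset submodule_lspan) auto

text \<open>Gaussian elimination without division: coefficients are cross-multiplied with the pivot
  \<open>M p j0\<close>, so that everything stays in \<open>A\<close>. This replaces linear algebra
  over the fraction field.\<close>

lemma homogeneous_system:
  assumes "finite J" "finite I" "card J < card I" "\<And>i j. i \<in> I \<Longrightarrow> j \<in> J \<Longrightarrow> M i j \<in> A"
  shows "\<exists>c. (\<forall>i. c i \<in> A) \<and> (\<exists>i\<in>I. c i \<noteq> 0) \<and> (\<forall>j\<in>J. (\<Sum>i\<in>I. c i * M i j) = 0)"
  using assms
proof (induction J arbitrary: I M rule: finite_induct)
  case empty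
  then obtain i where "i \<in> I" by (metis card.empty all_not_in_conv not_less_zero)
  then show ?case by (intro exI[of _ "\<lambda>_. 1"]) (auto simp: one_closed)
next
  case (insert j0 J)
  show ?case
  proof (cases "\<forall>i\<in>I. M i j0 = 0")
    case True
    have "\<exists>c. (\<forall>i. c i \<in> A) \<and> (\<exists>i\<in>I. c i \<noteq> 0) \<and> (\<forall>j\<in>J. (\<Sum>i\<in>I. c i * M i j) = 0)"
      using insert.prems insert.hyps by (intro insert.IH) auto
    moreover have "(\<Sum>i\<in>I. c i * M i j0) = 0" for c using True by simp
    ultimately show ?thesis by (metis insert_iff)
  next
    case False
    then obtain p where p: "p \<in> I" "M p j0 \<noteq> 0" by auto
    define I' where "I' = I - {p}"
    define M' where "M' = (\<lambda>i j. M p j0 * M i j - M i j0 * M p j)"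
    have I: "I = insert p I'" "p \<notin> I'" "finite I'" using p insert.prems by (auto simp: I'_def)
    have "card J < card I'" using insert.prems insert.hyps p by (simp add: I'_def)
    moreover have "M' i j \<in> A" if "i \<in> I'" "j \<in> J" for i j
      using that p insert.prems unfolding M'_def I'_def by (intro diff_closed mult_closed) auto
    ultimately obtain c where c: "\<forall>i. c i \<in> A" "\<exists>i\<in>I'. c i \<noteq> 0"
      "\<And>j. j \<in> J \<Longrightarrow> (\<Sum>i\<in>I'. c i * M' i j) = 0"
      using insert.IH[OF \<open>finite I'\<close>, of M'] by blast
    \<comment> \<open>The coefficient at the pivot is chosen to satisfy equation \<open>j0\<close>.
      The others are scaled by the pivot entry, which is nonzero, so nontriviality survives in a
      domain.\<close>
    define d where "d = (\<lambda>i. if i = p then - (\<Sum>i\<in>I'. c i * M i j0) else c i * M p j0)"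
    have dA: "d i \<in> A" for i
      using c p insert.prems unfolding d_def
      by (auto intro!: minus_closed sum_closed mult_closed simp: I'_def)
    have dn: "\<exists>i\<in>I. d i \<noteq> 0" using c(2) p I unfolding d_def by auto
    have sum: "(\<Sum>i\<in>I. d i * M i j) = (\<Sum>i\<in>I'. c i * M' i j)" for j
    proof -
      have "(\<Sum>i\<in>I. d i * M i j) = d p * M p j + (\<Sum>i\<in>I'. d i * M i j)"
        using I by simp
      also have "(\<Sum>i\<in>I'. d i * M i j) = (\<Sum>i\<in>I'. c i * M p j0 * M i j)"
        using I by (intro sum.cong) (auto simp: d_def)
      also have "d p * M p j = - (\<Sum>i\<in>I'. c i * M i j0 * M p j)"
        by (simp add: d_def sum_distrib_right)
      finally show ?thesis by (simp add: M'_def algebra_simps sum_subtractf)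
    qed
    have "(\<Sum>i\<in>I. d i * M i j) = 0" if "j \<in> insert j0 J" for j
      unfolding sum using that c(3) by (cases "j = j0") (auto simp: M'_def intro!: sum.neutral)
    with dA dn show ?thesis by (intro exI[of _ d]) auto
  qed
qed

lemma lspan_dependent:
  assumes "finite S" "finite I" "card S < card I" "\<And>i. i \<in> I \<Longrightarrow> h i \<in> lspan A S"
  shows "\<exists>c. (\<forall>i. c i \<in> A) \<and> (\<exists>i\<in>I. c i \<noteq> 0) \<and> (\<Sum>i\<in>I. c i * h i) = 0"
proof -
  have "\<forall>i\<in>I. \<exists>m. (\<forall>s. m s \<in> A) \<and> h i = (\<Sum>s\<in>S. m s * s)"
    using assms(4) unfolding lspan_def by blast
  from bchoice[OF this] obtain M where M: "\<And>i s. i \<in> I \<Longrightarrow> M i s \<in> A"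
    "\<And>i. i \<in> I \<Longrightarrow> h i = (\<Sum>s\<in>S. M i s * s)"
    by auto
  obtain c where c: "\<forall>i. c i \<in> A" "\<exists>i\<in>I. c i \<noteq> 0" "\<And>s. s \<in> S \<Longrightarrow> (\<Sum>i\<in>I. c i * M i s) = 0"
    using homogeneous_system[OF assms(1-3), of M] M(1) by blast
  have "(\<Sum>i\<in>I. c i * h i) = (\<Sum>i\<in>I. \<Sum>s\<in>S. c i * M i s * s)"
    by (intro sum.cong) (auto simp: M(2) sum_distrib_left mult.assoc)
  also have "\<dots> = (\<Sum>s\<in>S. (\<Sum>i\<in>I. c i * M i s) * s)"
    by (subst sum.swap) (simp add: sum_distrib_right)
  also have "\<dots> = 0" using c by simp
  finally show ?thesis using c by blast
qed

text \<open>Spanning over the fractions of \<open>A\<close>, with the denominator cleared, so that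
  computations stay inside \<open>A\<close>.\<close>

definition spans_fractions :: "'a set \<Rightarrow> bool"
  where "spans_fractions V \<longleftrightarrow> finite V \<and> (\<forall>h. \<exists>b\<in>A - {0}. b * h \<in> lspan A V)"

text \<open>The family \<open>h\<close> is indexed and may repeat values, as the powers of a single
  element can.\<close>

lemma spans_fractions_dependent:
  assumes "spans_fractions V" "finite I" "card V < card I"
  shows "\<exists>c. (\<forall>i. c i \<in> A) \<and> (\<exists>i\<in>I. c i \<noteq> 0) \<and> (\<Sum>i\<in>I. c i * h i) = 0"
proof -
  obtain b where b: "\<And>h. b h \<in> A - {0}" "\<And>h. b h * h \<in> lspan A V"
    using assms(1) unfolding spans_fractions_def by metis
  obtain c where c: "\<forall>i. c i \<in> A" "\<exists>i\<in>I. c i \<noteq> 0" "(\<Sum>i\<in>I. c i * (b (h i) * h i)) = 0"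
    using lspan_dependent[of V I "\<lambda>i. b (h i) * h i"] assms b(2) unfolding spans_fractions_def by auto
  show ?thesis
    using c b by (intro exI[of _ "\<lambda>i. c i * b (h i)"]) (auto simp: mult_closed mult.assoc)
qed

section \<open>Integral elements\<close>

lemma det_closed:
  assumes "M \<in> carrier_mat m m" "\<And>i j. i < m \<Longrightarrow> j < m \<Longrightarrow> M $$ (i, j) \<in> A"
  shows "det M \<in> A"
proof -
  have "signof q \<in> A" for q :: "nat \<Rightarrow> nat" by (auto simp: sign_def one_closed minus_closed)
  moreover have "q i < m" if "q permutes {0..<m}" "i < m" for q i
    using that permutes_in_image[of q "{0..<m}" i] by auto
  ultimately show ?thesis unfolding det_def'[OF assms(1)]
    using assms(2) by (intro sum_closed mult_closed prod_closed) auto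
qed

end

text \<open>This instance is why \<open>idom_subring\<close> is stated for integral domains and not
  only for fields: a characteristic polynomial is a determinant with polynomial entries.\<close>

lemma idom_subring_coeffs:
  assumes "idom_subring A"
  shows "idom_subring {f :: 'a :: idom poly. \<forall>i. Polynomial.coeff f i \<in> A}"
proof -
  interpret idom_subring A by fact
  show ?thesis
    by standard (auto simp: zero_closed one_closed add_closed minus_closed coeff_1 intro!: coeff_mult_closed)
qed

locale field_subring = idom_subring A for A :: "'a :: field set"
begin

text \<open>Moves a spanning set into an ideal: the factors \<open>d v\<close> clear denominators
  one by one, and \<open>\<alpha>\<close> is an element of the ideal. Coinciding products do no
  harm, as only spanning is claimed.\<close>

lemma spans_fractions_scale:
  assumes V: "spans_fractions V" and d: "\<And>v. v \<in> V \<Longrightarrow> d v \<in> A - {0}" and \<alpha>: "\<alpha> \<noteq> 0"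
  shows "spans_fractions ((\<lambda>v. d v * \<alpha> * v) ` V)"
proof -
  let ?W = "(\<lambda>v. d v * \<alpha> * v) ` V"
  have fin: "finite V" using V by (simp add: spans_fractions_def)
  have "\<exists>b\<in>A - {0}. b * h \<in> lspan A ?W" for h
  proof -
    obtain b where b: "b \<in> A - {0}" "b * (h / \<alpha>) \<in> lspan A V"
      using V unfolding spans_fractions_def by metis
    obtain c where c: "\<forall>s. c s \<in> A" "b * (h / \<alpha>) = (\<Sum>s\<in>V. c s * s)"
      using b(2) by (auto simp: lspan_def)
    define D where "D = prod d V"
    have D: "D \<in> A - {0}" using d fin unfolding D_def by (auto intro!: prod_closed)
    have "(D * b) * h = D * \<alpha> * (b * (h / \<alpha>))" using \<alpha> by simp
    also have "\<dots> = (\<Sum>s\<in>V. (c s * prod d (V - {s})) * (d s * \<alpha> * s))"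
      unfolding c(2) sum_distrib_left
      by (intro sum.cong) (auto simp: D_def prod.remove[OF fin] mult_ac)
    also have "\<dots> \<in> lspan A ?W"
    proof (intro submodule_of_sum[OF submodule_lspan] submodule_ofD(3)[OF submodule_lspan, of _ "d _ * \<alpha> * _"])
      fix s assume "s \<in> V"
      then show "d s * \<alpha> * s \<in> lspan A ?W" using lspan_incl[of ?W] fin by auto
      show "c s * prod d (V - {s}) \<in> A" using c d by (intro mult_closed prod_closed) auto
    qed
    finally have "(D * b) * h \<in> lspan A ?W" .
    moreover have "D * b \<in> A - {0}" using D b by (auto simp: mult_closed)
    ultimately show ?thesis by blast
  qed
  with fin show ?thesis by (simp add: spans_fractions_def)
qed


lemma char_poly_closed:
  assumes M: "M \<in> carrier_mat m m" "\<And>i j. i < m \<Longrightarrow> j < m \<Longrightarrow> M $$ (i, j) \<in> A"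
  shows "Polynomial.coeff (char_poly M) i \<in> A"
proof -
  interpret P: idom_subring "{f :: 'a poly. \<forall>i. Polynomial.coeff f i \<in> A}"
    by (rule idom_subring_coeffs) (rule idom_subring_axioms)
  have "char_poly M \<in> {f. \<forall>i. Polynomial.coeff f i \<in> A}"
    unfolding char_poly_def char_poly_matrix_def
  proof (rule P.det_closed)
    fix i j assume "i < m" "j < m"
    then show "([:0, 1:] \<cdot>\<^sub>m 1\<^sub>m (dim_row M) + map_mat (\<lambda>a. [:- a:]) M) $$ (i, j)
        \<in> {f. \<forall>i. Polynomial.coeff f i \<in> A}"
      using M by (auto simp: coeff_pCons zero_closed one_closed minus_closed split: nat.splits
          intro!: minus_closed)
  qed (use M in auto)
  then show ?thesis by auto
qed

text \<open>The elements of \<open>S\<close> form an eigenvector, with eigenvalue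
  \<open>\<epsilon>\<close>, of the matrix expressing each \<open>\<epsilon> * s\<close> through
  \<open>S\<close>; it is nonzero because of \<open>s \<noteq> 0\<close>. The characteristic
  polynomial is the required monic equation over \<open>A\<close>.\<close>

lemma integral_if_stable:
  assumes S: "finite S" "s \<in> S" "s \<noteq> 0" and stable: "\<And>s. s \<in> S \<Longrightarrow> \<epsilon> * s \<in> lspan A S"
  shows "\<epsilon> \<in> integral_closure A"
proof -
  obtain m and g :: "nat \<Rightarrow> 'a" where g: "bij_betw g {0..<m} S"
    using S(1) ex_bij_betw_nat_finite by blast
  have "\<forall>s\<in>S. \<exists>c. (\<forall>t. c t \<in> A) \<and> \<epsilon> * s = (\<Sum>t\<in>S. c t * t)"
    using stable unfolding lspan_def by blast
  from bchoice[OF this] obtain c where c: "\<And>s t. s \<in> S \<Longrightarrow> c s t \<in> A"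
    "\<And>s. s \<in> S \<Longrightarrow> \<epsilon> * s = (\<Sum>t\<in>S. c s t * t)"
    by auto
  have gS: "g i \<in> S" if "i < m" for i using g that by (auto simp: bij_betw_def)
  define M where "M = mat m m (\<lambda>(i, j). c (g i) (g j))"
  have M: "M \<in> carrier_mat m m" by (simp add: M_def)
  define w where "w = vec m g"
  have "M *\<^sub>v w = \<epsilon> \<cdot>\<^sub>v w"
  proof (rule eq_vecI)
    fix i assume "i < dim_vec (\<epsilon> \<cdot>\<^sub>v w)"
    then have i: "i < m" by (simp add: w_def)
    have "(M *\<^sub>v w) $ i = (\<Sum>j\<in>{0..<m}. c (g i) (g j) * g j)"
      using i by (simp add: M_def w_def scalar_prod_def)
    also have "\<dots> = (\<Sum>t\<in>S. c (g i) t * t)" by (rule sum.reindex_bij_betw[OF g])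
    also have "\<dots> = \<epsilon> * g i" using c(2) gS[OF i] by simp
    finally show "(M *\<^sub>v w) $ i = (\<epsilon> \<cdot>\<^sub>v w) $ i" using i by (simp add: w_def)
  qed (simp add: M_def w_def)
  moreover have "w \<noteq> 0\<^sub>v m"
  proof
    assume *: "w = 0\<^sub>v m"
    obtain i where "i < m" "g i = s" using g S(2) by (auto simp: bij_betw_def)
    with * have "s = 0" by (metis index_vec index_zero_vec(1) w_def)
    with S(3) show False by simp
  qed
  ultimately have "eigenvector M w \<epsilon>"
    unfolding eigenvector_def using M by (simp add: w_def)
  then have "poly (char_poly M) \<epsilon> = 0"
    using eigenvalue_root_char_poly[OF M] by (auto simp: eigenvalue_def)
  moreover have "Polynomial.lead_coeff (char_poly M) = 1"
    using degree_monic_char_poly[OF M] by auto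
  moreover have "Polynomial.coeff (char_poly M) i \<in> A" for i
    using c(1) gS by (intro char_poly_closed[OF M]) (auto simp: M_def)
  ultimately show ?thesis unfolding integral_closure_def by blast
qed

lemma integral_if_submodule_stable:
  assumes S: "finite S" "s \<in> S" "s \<noteq> 0" and stable: "\<And>x. x \<in> lspan A S \<Longrightarrow> \<epsilon> * x \<in> lspan A S"
  shows "\<epsilon> \<in> integral_closure A"
  using S lspan_incl[OF S(1)] by (intro integral_if_stable[OF S] stable) auto

lemma integral_closure_base: "x \<in> A \<Longrightarrow> x \<in> integral_closure A"
  unfolding integral_closure_def
  by (intro CollectI exI[of _ "[:- x, 1:]"])
     (auto simp: coeff_pCons zero_closed one_closed minus_closed split: nat.splits)

text \<open>The monomials \<open>z ^ i * w ^ j\<close> below the degrees of the two equations span a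
  module stable under \<open>z\<close> and \<open>w\<close>, hence under sums, products and
  negatives. This yields all closure properties of the integral closure.\<close>

lemma integral_two_generators:
  assumes "z \<in> integral_closure A" "w \<in> integral_closure A"
  shows "\<exists>S. finite S \<and> 1 \<in> S \<and> (\<forall>x\<in>lspan A S. z * x \<in> lspan A S \<and> w * x \<in> lspan A S)"
proof -
  have pow: "\<exists>m>0. z ^ m \<in> lspan A ((\<lambda>i. z ^ i) ` {..<m})" if "z \<in> integral_closure A" for z
  proof -
    from that obtain f where f: "Polynomial.lead_coeff f = 1" "\<And>i. Polynomial.coeff f i \<in> A" "poly f z = 0"
      by (auto simp: integral_closure_def)
    define m where "m = Polynomial.degree f"
    have "m > 0" using f by (intro Nat.gr0I) (auto simp: m_def elim!: degree_eq_zeroE)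
    have "{..m} = insert m {..<m}" by auto
    then have "0 = z ^ m + (\<Sum>i<m. Polynomial.coeff f i * z ^ i)"
      using f by (simp add: poly_altdef m_def)
    then have "z ^ m = (\<Sum>i<m. (- Polynomial.coeff f i) * z ^ i)"
      by (simp add: sum_negf eq_neg_iff_add_eq_0)
    also have "\<dots> \<in> lspan A ((\<lambda>i. z ^ i) ` {..<m})"
      using lspan_incl[of "(\<lambda>i. z ^ i) ` {..<m}"] f(2)
      by (intro submodule_of_sum[OF submodule_lspan] submodule_ofD(3)[OF submodule_lspan] minus_closed) auto
    finally show ?thesis using \<open>m > 0\<close> by blast
  qed
  obtain m k where m: "m > 0" "z ^ m \<in> lspan A ((\<lambda>i. z ^ i) ` {..<m})"
    and k: "k > 0" "w ^ k \<in> lspan A ((\<lambda>i. w ^ i) ` {..<k})"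
    using pow assms by meson
  define S where "S = (\<lambda>(i, j). z ^ i * w ^ j) ` ({..<m} \<times> {..<k})"
  have S: "finite S" by (simp add: S_def)
  have in_S: "z ^ i * w ^ j \<in> S" if "i < m" "j < k" for i j
    unfolding S_def using that by (intro image_eqI[of _ _ "(i, j)"]) auto
  note in_span = subsetD[OF lspan_incl[OF S] in_S]
  have sub: "lspan A T \<subseteq> {x. y * x \<in> lspan A S}" if "\<And>x. x \<in> T \<Longrightarrow> y * x \<in> lspan A S" for T y
  proof (rule lspan_subset)
    show "submodule_of A {x. y * x \<in> lspan A S}"
      using submodule_lspan[of S] unfolding submodule_of_def
      by (auto simp: algebra_simps mult.left_commute)
  qed (use that in auto)
  have z: "z * x \<in> lspan A S" if "x \<in> S" for x
  proof -
    from that obtain i j where ij: "i < m" "j < k" "x = z ^ i * w ^ j" by (auto simp: S_def)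
    show ?thesis
    proof (cases "Suc i < m")
      case True
      then show ?thesis using in_span[of "Suc i" j] ij by (simp add: mult.assoc)
    next
      case False
      then have "Suc i = m" using ij by simp
      \<comment> \<open>The exponent has reached \<open>m\<close>; the equation of \<open>z\<close>
        rewrites \<open>z ^ m\<close> by lower powers, and the factor \<open>w ^ j\<close> is
        carried along.\<close>
      have "lspan A ((\<lambda>i. z ^ i) ` {..<m}) \<subseteq> {x. w ^ j * x \<in> lspan A S}"
        using in_span ij by (intro sub) (auto simp: mult.commute)
      with m(2) have "w ^ j * z ^ m \<in> lspan A S" by auto
      then show ?thesis unfolding \<open>Suc i = m\<close>[symmetric] ij by (simp add: mult_ac)
    qed
  qed
  have w: "w * x \<in> lspan A S" if "x \<in> S" for x
  proof -
    from that obtain i j where ij: "i < m" "j < k" "x = z ^ i * w ^ j" by (auto simp: S_def)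
    show ?thesis
    proof (cases "Suc j < k")
      case True
      then show ?thesis using in_span[of i "Suc j"] ij by (simp add: mult_ac)
    next
      case False
      then have "Suc j = k" using ij by simp
      have "lspan A ((\<lambda>i. w ^ i) ` {..<k}) \<subseteq> {x. z ^ i * x \<in> lspan A S}"
        using in_span ij by (intro sub) auto
      with k(2) have "z ^ i * w ^ k \<in> lspan A S" by auto
      then show ?thesis unfolding \<open>Suc j = k\<close>[symmetric] ij by (simp add: mult_ac)
    qed
  qed
  have "1 \<in> S" using in_S[of 0 0] m k by simp
  moreover have "z * x \<in> lspan A S \<and> w * x \<in> lspan A S" if "x \<in> lspan A S" for x
    using subsetD[OF sub[OF z] that] subsetD[OF sub[OF w] that] by simp
  ultimately show ?thesis using S by blast
qed

lemma idom_subring_integral_closure: "idom_subring (integral_closure A)"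
proof
  show "0 \<in> integral_closure A" "1 \<in> integral_closure A"
    by (simp_all add: integral_closure_base zero_closed one_closed)
next
  fix x y assume xy: "x \<in> integral_closure A" "y \<in> integral_closure A"
  obtain S where S: "finite S" "1 \<in> S" "\<And>z. z \<in> lspan A S \<Longrightarrow> x * z \<in> lspan A S"
    "\<And>z. z \<in> lspan A S \<Longrightarrow> y * z \<in> lspan A S"
    using integral_two_generators[OF xy] by blast
  show "x + y \<in> integral_closure A" "x * y \<in> integral_closure A"
    using S submodule_ofD(2)[OF submodule_lspan]
    by (auto intro!: integral_if_submodule_stable[of S 1] simp: distrib_right mult.assoc)
next
  fix x assume x: "x \<in> integral_closure A"
  obtain S where S: "finite S" "1 \<in> S" "\<And>z. z \<in> lspan A S \<Longrightarrow> x * z \<in> lspan A S"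
    using integral_two_generators[OF x x] by blast
  show "- x \<in> integral_closure A"
    using S submodule_minus[OF submodule_lspan]
    by (auto intro!: integral_if_submodule_stable[of S 1])
qed

text \<open>The product of the denominators of all \<open>h * v\<close> makes multiplication by
  \<open>h\<close> preserve the span of \<open>V\<close>.\<close>

lemma integral_multiple:
  assumes V: "spans_fractions V"
  shows "\<exists>b\<in>A - {0}. b * h \<in> integral_closure A"
proof -
  have fin: "finite V" using V by (simp add: spans_fractions_def)
  have "\<forall>v. \<exists>b. b \<in> A - {0} \<and> b * (h * v) \<in> lspan A V"
    using V unfolding spans_fractions_def by blast
  from choice[OF this] obtain b where b: "\<And>v. b v \<in> A - {0}" "\<And>v. b v * (h * v) \<in> lspan A V"
    by blast
  \<comment> \<open>\<open>V\<close> has a nonzero element because a nonzero multiple of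
    \<open>1\<close> lies in its span.\<close>
  obtain v where v: "v \<in> V" "v \<noteq> 0"
  proof (rule ccontr)
    assume "\<not> thesis"
    then have "V \<subseteq> {0}" using that by auto
    then have "lspan A V \<subseteq> {0}" by (intro lspan_subset) (auto simp: submodule_of_def)
    moreover obtain c where "c \<in> A - {0}" "c * 1 \<in> lspan A V"
      using V unfolding spans_fractions_def by blast
    ultimately show False by auto
  qed
  have D: "prod b V \<in> A - {0}" using b(1) fin by (auto intro!: prod_closed)
  have "(prod b V * h) * s \<in> lspan A V" if "s \<in> V" for s
  proof -
    have "(prod b V * h) * s = prod b (V - {s}) * (b s * (h * s))"
      using that by (simp add: prod.remove[OF fin] mult_ac)
    also have "\<dots> \<in> lspan A V"
      using b by (intro submodule_ofD(3)[OF submodule_lspan, of _ "b s * (h * s)"] prod_closed) auto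
    finally show ?thesis .
  qed
  then have "prod b V * h \<in> integral_closure A" using fin v by (intro integral_if_stable) auto
  with D show ?thesis by blast
qed

text \<open>\<open>T\<close> collects the remainders modulo the span of \<open>V\<close>, so
  \<open>V\<close> and \<open>T\<close> together generate \<open>M\<close>, and the determinant
  argument applies to \<open>M\<close>.\<close>

lemma unit_if_stable:
  assumes V: "finite V" "V \<subseteq> M" and T: "finite T" "T \<subseteq> M" and M: "submodule_of A M" "M \<noteq> {0}"
    and red: "\<And>h. h \<in> M \<Longrightarrow> \<exists>l\<in>lspan A V. h - l \<in> lspan A T"
    and stable: "\<And>x. x \<in> M \<Longrightarrow> \<epsilon> * x \<in> M"
  shows "\<epsilon> \<in> integral_closure A"
proof -
  have "h \<in> lspan A (V \<union> T)" if "h \<in> M" for h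
  proof -
    obtain l where l: "l \<in> lspan A V" "h - l \<in> lspan A T" using red[OF \<open>h \<in> M\<close>] by auto
    have "l \<in> lspan A (V \<union> T)" "h - l \<in> lspan A (V \<union> T)"
      using l lspan_mono[of "V \<union> T" V] lspan_mono[of "V \<union> T" T] V T by auto
    from submodule_ofD(2)[OF submodule_lspan this] show ?thesis by simp
  qed
  moreover have "lspan A (V \<union> T) \<subseteq> M" using V T M by (intro lspan_subset) auto
  ultimately have eq: "lspan A (V \<union> T) = M" by auto
  obtain s where "s \<in> V \<union> T" "s \<noteq> 0"
  proof (rule ccontr)
    assume "\<not> thesis"
    then have "V \<union> T \<subseteq> {0}" using that by blast
    then have "lspan A (V \<union> T) \<subseteq> {0}" by (intro lspan_subset) (auto simp: submodule_of_def)
    with eq M show False by (auto simp: submodule_of_def)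
  qed
  with V T eq stable show ?thesis by (intro integral_if_submodule_stable[of "V \<union> T"]) auto
qed

lemma frac_ideal_basis:
  assumes V: "spans_fractions V" and a: "a \<in> frac_ideals (integral_closure A)"
  shows "\<exists>W. spans_fractions W \<and> W \<subseteq> a"
proof -
  obtain \<alpha> where \<alpha>: "\<alpha> \<in> a" "\<alpha> \<noteq> 0" using a by (auto simp: frac_ideals_def)
  obtain b where b: "\<And>v. b v \<in> A - {0}" "\<And>v. b v * v \<in> integral_closure A"
    using integral_multiple[OF V] by metis
  have "b v * v * \<alpha> \<in> a" for v using a \<alpha> b(2)[of v] by (auto simp: frac_ideals_def)
  then have "(\<lambda>v. b v * \<alpha> * v) ` V \<subseteq> a" by (auto simp: mult_ac)
  moreover have "spans_fractions ((\<lambda>v. b v * \<alpha> * v) ` V)"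
    using V b \<alpha> by (intro spans_fractions_scale) auto
  ultimately show ?thesis by blast
qed

end

section \<open>Subfields and finite extensions\<close>

lemma K_ring_simps [simp]:
  "carrier (K_ring :: 'a :: field ring) = UNIV"
  "x \<otimes>\<^bsub>K_ring\<^esub> y = x * (y :: 'a)" "x \<oplus>\<^bsub>K_ring\<^esub> y = x + (y :: 'a)"
  "\<one>\<^bsub>K_ring\<^esub> = (1 :: 'a)" "\<zero>\<^bsub>K_ring\<^esub> = (0 :: 'a)"
  by (simp_all add: ring_of_type_algebra_def)

lemmas field_K_ring = field_from_type_algebra

interpretation K_ring: cring "K_ring :: 'a :: field ring"
  by (rule cring_from_type_algebra)

lemma K_ring_a_inv [simp]: "\<ominus>\<^bsub>K_ring\<^esub> x = - (x :: 'a :: field)"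
  by (rule K_ring.minus_equality) auto

lemma K_ring_m_inv: "x \<noteq> 0 \<Longrightarrow> inv\<^bsub>K_ring\<^esub> x = inverse (x :: 'a :: field)"
  by (rule K_ring.comm_inv_char) auto

lemma subring_K_ringD:
  assumes "subring (A :: 'a :: field set) K_ring" shows "field_subring A"
  using subringE[OF assms] by unfold_locales auto

lemma subring_K_ringI:
  assumes "idom_subring (A :: 'a :: field set)" shows "subring A K_ring"
  using assms by (intro K_ring.subringI) (auto simp: idom_subring_def)

lemma subfield_K_ringD:
  assumes "subfield (F :: 'a :: field set) K_ring"
  shows "field_subring F" "x \<in> F \<Longrightarrow> inverse x \<in> F"
proof -
  show "field_subring F" by (rule subring_K_ringD[OF subfieldE(1)[OF assms]])
  then interpret field_subring F .
  show "inverse x \<in> F" if "x \<in> F"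
    using K_ring.subfield_m_inv(1)[OF assms, of x] that zero_closed
    by (cases "x = 0") (auto simp: K_ring_m_inv)
qed

lemma subfield_K_ringI:
  assumes "idom_subring (F :: 'a :: field set)" "\<And>x. x \<in> F \<Longrightarrow> x \<noteq> 0 \<Longrightarrow> inverse x \<in> F"
  shows "subfield F K_ring"
  using assms by (intro field.subfieldI'[OF field_K_ring] subring_K_ringI) (auto simp: K_ring_m_inv)

context field_subring
begin

text \<open>Serves as an upper bound: a generated field is the least subfield, hence consists of
  such fractions.\<close>

lemma subfield_fractions: "subfield {a / b | a b. a \<in> A \<and> b \<in> A \<and> b \<noteq> 0} K_ring"
proof (rule subfield_K_ringI)
  let ?F = "{a / b | a b. a \<in> A \<and> b \<in> A \<and> b \<noteq> 0}"
  have mem: "a / b \<in> ?F" if "a \<in> A" "b \<in> A" "b \<noteq> 0" for a b using that by blast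
  show "idom_subring ?F"
  proof
    show "0 \<in> ?F" "1 \<in> ?F" using mem[OF zero_closed one_closed] mem[OF one_closed one_closed] by auto
  next
    fix x y assume "x \<in> ?F" "y \<in> ?F"
    then obtain a b c d where ab: "a \<in> A" "b \<in> A" "b \<noteq> 0" "x = a / b" "c \<in> A" "d \<in> A" "d \<noteq> 0" "y = c / d"
      by auto
    have "x + y = (a * d + c * b) / (b * d)" "x * y = (a * c) / (b * d)"
      using ab by (simp_all add: add_frac_eq)
    moreover have "(a * d + c * b) / (b * d) \<in> ?F" "(a * c) / (b * d) \<in> ?F"
      using ab by (intro mem add_closed mult_closed; simp)+
    ultimately show "x + y \<in> ?F" "x * y \<in> ?F" by simp_all
  next
    fix x assume "x \<in> ?F"
    then obtain a b where "a \<in> A" "b \<in> A" "b \<noteq> 0" "x = a / b" by auto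
    then show "- x \<in> ?F" using mem[of "- a" b] minus_closed by simp
  qed
  fix x assume "x \<in> ?F" "x \<noteq> 0"
  then obtain a b where "a \<in> A" "b \<in> A" "b \<noteq> 0" "x = a / b" by auto
  with \<open>x \<noteq> 0\<close> show "inverse x \<in> ?F" using mem[of b a] by auto
qed

text \<open>A basis over \<open>F\<close> will do: the coefficients of a combination are fractions,
  and their denominators are cleared one by one along the list.\<close>

lemma spans_fractions_if_finite_dimension:
  assumes F: "subfield F K_ring" "F \<subseteq> {a / b | a b. a \<in> A \<and> b \<in> A \<and> b \<noteq> 0}"
    and dim: "ring.finite_dimension K_ring F UNIV"
  shows "\<exists>V. spans_fractions V"
proof -
  obtain n where "K_ring.dimension n F UNIV" using dim by (rule K_ring.finite_dimensionE')
  then obtain Vs where Vs: "K_ring.Span F Vs = UNIV"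
    using K_ring.exists_base[OF F(1)] by metis
  have "\<exists>b\<in>A - {0}. b * K_ring.combine Ks Us \<in> lspan A (set Vs)"
    if "set Us \<subseteq> set Vs" "set Ks \<subseteq> F" for Ks Us
    using that
  proof (induction Ks Us rule: K_ring.combine.induct)
    case (1 k Ks u Us)
    then obtain b where b: "b \<in> A" "b \<noteq> 0" "b * K_ring.combine Ks Us \<in> lspan A (set Vs)" by auto
    have "k \<in> F" using 1 by simp
    with F(2) obtain c d where cd: "c \<in> A" "d \<in> A" "d \<noteq> 0" "k = c / d" by blast
    have u: "u \<in> lspan A (set Vs)" using 1 lspan_incl[of "set Vs"] by auto
    have "(b * d) * K_ring.combine (k # Ks) (u # Us) = (b * c) * u + d * (b * K_ring.combine Ks Us)"
      using cd by (simp add: algebra_simps)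
    also have "\<dots> \<in> lspan A (set Vs)"
      using submodule_ofD(2)[OF submodule_lspan submodule_ofD(3)[OF submodule_lspan
          mult_closed[OF b(1) cd(1)] u] submodule_ofD(3)[OF submodule_lspan cd(2) b(3)]] .
    finally show ?case using b cd mult_closed by (intro bexI[of _ "b * d"]) auto
  qed (use one_closed submodule_ofD(1)[OF submodule_lspan] in \<open>auto intro!: exI[of _ "1 :: 'a"]\<close>)
  moreover have "\<exists>Ks. set Ks \<subseteq> F \<and> h = K_ring.combine Ks Vs" for h
    using K_ring.Span_mem_iff_length_version[OF F(1), of Vs h] Vs by auto
  ultimately have "\<exists>b\<in>A - {0}. b * h \<in> lspan A (set Vs)" for h by (metis order_refl)
  then show ?thesis unfolding spans_fractions_def by blast
qed

end

section \<open>Embeddings of number fields\<close>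

lemma embeddingsD:
  assumes "\<sigma> \<in> embeddings"
  shows "\<sigma> 1 = 1" "\<sigma> (x + y) = \<sigma> x + \<sigma> y" "\<sigma> (x * y) = \<sigma> x * \<sigma> y"
  using assms by (auto simp: embeddings_def Ring.ring_hom_def)

lemma embeddingsI:
  "\<sigma> 1 = 1 \<Longrightarrow> (\<And>x y. \<sigma> (x + y) = \<sigma> x + \<sigma> y) \<Longrightarrow> (\<And>x y. \<sigma> (x * y) = \<sigma> x * \<sigma> y) \<Longrightarrow> \<sigma> \<in> embeddings"
  by (auto simp: embeddings_def Ring.ring_hom_def)

lemma embedding_zero: "\<sigma> \<in> embeddings \<Longrightarrow> \<sigma> 0 = 0"
  using embeddingsD(2)[of \<sigma> 0 0] by simp

lemma embedding_minus: "\<sigma> \<in> embeddings \<Longrightarrow> \<sigma> (- x) = - \<sigma> x"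
  using embeddingsD(2)[of \<sigma> x "- x"] embedding_zero[of \<sigma>] by (simp add: eq_neg_iff_add_eq_0 add.commute)

lemma embedding_diff: "\<sigma> \<in> embeddings \<Longrightarrow> \<sigma> (x - y) = \<sigma> x - \<sigma> y"
  using embeddingsD(2)[of \<sigma> x "- y"] embedding_minus[of \<sigma> y] by simp

lemma embedding_nonzero: "\<sigma> \<in> embeddings \<Longrightarrow> x \<noteq> 0 \<Longrightarrow> \<sigma> x \<noteq> 0"
  using embeddingsD(3)[of \<sigma> x "inverse x"] embeddingsD(1)[of \<sigma>] by auto

lemma embedding_sum: "\<sigma> \<in> embeddings \<Longrightarrow> \<sigma> (sum f I) = (\<Sum>i\<in>I. \<sigma> (f i))"
  by (induction I rule: infinite_finite_induct) (auto simp: embedding_zero embeddingsD)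

lemma embedding_of_nat: "\<sigma> \<in> embeddings \<Longrightarrow> \<sigma> (of_nat k) = of_nat k"
  by (induction k) (auto simp: embedding_zero embeddingsD)

lemma embedding_of_int: "\<sigma> \<in> embeddings \<Longrightarrow> \<sigma> (of_int k) = of_int k"
  by (cases k) (auto simp: embedding_of_nat embedding_minus embedding_diff embeddingsD)

text \<open>Artin's argument: evaluating at \<open>x * y\<close> and subtracting
  \<open>\<tau> y\<close> times the relation removes \<open>\<tau>\<close> and multiplies the
  coefficient of \<open>\<rho>\<close> by \<open>\<rho> y - \<tau> y\<close>, which is nonzero for a
  suitable \<open>y\<close>.\<close>

lemma embeddings_independent:
  assumes "finite E" "E \<subseteq> embeddings" "\<And>x. (\<Sum>\<sigma>\<in>E. c \<sigma> * \<sigma> x) = 0" "\<sigma> \<in> E"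
  shows "c \<sigma> = 0"
  using assms
proof (induction E arbitrary: c \<sigma> rule: finite_induct)
  case (insert \<tau> E)
  have \<tau>: "\<tau> \<in> embeddings" using insert.prems by auto
  have *: "c \<rho> = 0" if "\<rho> \<in> E" for \<rho>
  proof -
    have "\<rho> \<noteq> \<tau>" using that insert.hyps by auto
    then obtain y where y: "\<rho> y \<noteq> \<tau> y" by auto
    have "(\<Sum>\<sigma>\<in>E. (c \<sigma> * (\<sigma> y - \<tau> y)) * \<sigma> x) = 0" for x
    proof -
      have "0 = (\<Sum>\<sigma>\<in>insert \<tau> E. c \<sigma> * \<sigma> (x * y)) - \<tau> y * (\<Sum>\<sigma>\<in>insert \<tau> E. c \<sigma> * \<sigma> x)"
        using insert.prems(2) by (auto simp del: sum.insert)
      also have "\<dots> = (\<Sum>\<sigma>\<in>insert \<tau> E. c \<sigma> * (\<sigma> (x * y) - \<tau> y * \<sigma> x))"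
        unfolding sum_distrib_left sum_subtractf[symmetric] by (simp add: algebra_simps)
      also have "\<dots> = (\<Sum>\<sigma>\<in>insert \<tau> E. (c \<sigma> * (\<sigma> y - \<tau> y)) * \<sigma> x)"
        using insert.prems(1) by (intro sum.cong) (auto simp: subset_iff embeddingsD algebra_simps)
      also have "\<dots> = (\<Sum>\<sigma>\<in>E. (c \<sigma> * (\<sigma> y - \<tau> y)) * \<sigma> x)"
        using insert.hyps by simp
      finally show ?thesis by simp
    qed
    from insert.IH[OF _ this that] insert.prems(1) y show ?thesis by auto
  qed
  have "c \<tau> * \<tau> 1 = 0" using insert.prems(2)[of 1] insert.hyps * by simp
  then have "c \<tau> = 0" using embeddingsD(1)[OF \<tau>] by simp
  with * insert.prems(3) show ?case by auto
qed simp

lemma field_subring_Ints: "field_subring (\<int> :: 'a :: field set)"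
  by unfold_locales auto

interpretation Ints: field_subring "\<int> :: 'a :: field set"
  by (rule field_subring_Ints)

lemma algebraic_int_iff: "algebraic_int z \<longleftrightarrow> z \<in> integral_closure \<int>"
  by (auto simp: algebraic_int.simps integral_closure_def)

lemma number_field_spans:
  assumes "is_number_field TYPE('a :: field)"
  shows "\<exists>V :: 'a set. Ints.spans_fractions V"
proof (rule Ints.spans_fractions_if_finite_dimension)
  show "subfield (generate_field K_ring {} :: 'a set) K_ring"
    by (rule field.generate_field_is_subfield[OF field_K_ring]) auto
  show "generate_field K_ring {} \<subseteq> {a / b | a b :: 'a. a \<in> \<int> \<and> b \<in> \<int> \<and> b \<noteq> 0}"
    by (intro field.generate_field_min_subfield1[OF field_K_ring] Ints.subfield_fractions) auto
qed (use assms in \<open>auto simp: is_number_field_def\<close>)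

text \<open>More embeddings than elements of \<open>V\<close> would satisfy a linear relation on
  \<open>V\<close>, hence on the whole field, because embeddings respect integer combinations. This
  contradicts their independence.\<close>

lemma card_embeddings_le:
  assumes V: "Ints.spans_fractions (V :: 'a :: field set)" and char: "CHAR('a) = 0"
    and E: "finite E" "E \<subseteq> (embeddings :: ('a \<Rightarrow> complex) set)"
  shows "card E \<le> card V"
proof (rule ccontr)
  assume less: "\<not> card E \<le> card V"
  have "finite V" using V by (simp add: Ints.spans_fractions_def)
  interpret C: field_subring "UNIV :: complex set" by unfold_locales auto
  obtain c where c: "\<exists>\<sigma>\<in>E. c \<sigma> \<noteq> 0" "\<And>v. v \<in> V \<Longrightarrow> (\<Sum>\<sigma>\<in>E. c \<sigma> * \<sigma> v) = 0"
    using C.homogeneous_system[OF \<open>finite V\<close> E(1), of "\<lambda>\<sigma> v. \<sigma> v"] less by auto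
  have "(\<Sum>\<sigma>\<in>E. c \<sigma> * \<sigma> x) = 0" for x
  proof -
    obtain b where b: "b \<in> \<int> - {0}" "b * x \<in> lspan \<int> V"
      using V by (auto simp: Ints.spans_fractions_def)
    obtain m where m: "\<And>v. m v \<in> \<int>" "b * x = (\<Sum>v\<in>V. m v * v)"
      using b(2) by (auto simp: lspan_def)
    then have "\<forall>v. \<exists>k. m v = of_int k" by (metis Ints_cases)
    from choice[OF this] obtain k where k: "\<And>v. m v = of_int (k v)" by auto
    obtain l where l: "b = of_int l" using b by (auto elim: Ints_cases)
    have "of_int l * (\<Sum>\<sigma>\<in>E. c \<sigma> * \<sigma> x) = (\<Sum>\<sigma>\<in>E. c \<sigma> * \<sigma> (b * x))"
      using E(2) by (auto simp: sum_distrib_left l embeddingsD embedding_of_int subset_iff intro!: sum.cong)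
    also have "\<dots> = (\<Sum>\<sigma>\<in>E. \<Sum>v\<in>V. of_int (k v) * (c \<sigma> * \<sigma> v))"
      unfolding m(2) k using E(2)
      by (auto simp: sum_distrib_left embeddingsD embedding_of_int embedding_sum subset_iff intro!: sum.cong)
    also have "\<dots> = (\<Sum>v\<in>V. of_int (k v) * (\<Sum>\<sigma>\<in>E. c \<sigma> * \<sigma> v))"
      by (subst sum.swap) (simp add: sum_distrib_left)
    also have "\<dots> = 0" using c by simp
    finally show ?thesis using b l by auto
  qed
  from embeddings_independent[OF E this] c(1) show False by blast
qed

text \<open>The graph of a ring homomorphism from a subring of \<open>K\<close> to \<open>\<complex>\<close>. Injectivity is automatic when
  \<open>K\<close> is algebraic over the prime field, so it is not part of the definition.\<close>

definition partial_embedding :: "('a :: field \<times> complex) set \<Rightarrow> bool"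
  where "partial_embedding G \<longleftrightarrow> (1, 1) \<in> G \<and> (\<forall>c. (0, c) \<in> G \<longrightarrow> c = 0) \<and>
    (\<forall>x c y d. (x, c) \<in> G \<longrightarrow> (y, d) \<in> G \<longrightarrow> (x + y, c + d) \<in> G \<and> (x * y, c * d) \<in> G \<and> (- x, - c) \<in> G)"

context
  fixes G :: "('a :: field \<times> complex) set"
  assumes G: "partial_embedding G"
begin

lemma partial_embedding_closed:
  "(1, 1) \<in> G" "(0, 0) \<in> G" "(x, c) \<in> G \<Longrightarrow> (- x, - c) \<in> G"
  "(x, c) \<in> G \<Longrightarrow> (y, d) \<in> G \<Longrightarrow> (x + y, c + d) \<in> G"
  "(x, c) \<in> G \<Longrightarrow> (y, d) \<in> G \<Longrightarrow> (x - y, c - d) \<in> G"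
  "(x, c) \<in> G \<Longrightarrow> (y, d) \<in> G \<Longrightarrow> (x * y, c * d) \<in> G"
proof -
  have *: "(1, 1) \<in> G" "\<And>x c. (x, c) \<in> G \<Longrightarrow> (- x, - c) \<in> G"
    "\<And>x c y d. (x, c) \<in> G \<Longrightarrow> (y, d) \<in> G \<Longrightarrow> (x + y, c + d) \<in> G"
    "\<And>x c y d. (x, c) \<in> G \<Longrightarrow> (y, d) \<in> G \<Longrightarrow> (x * y, c * d) \<in> G"
    using G by (auto simp: partial_embedding_def)
  then show "(1, 1) \<in> G" "(x, c) \<in> G \<Longrightarrow> (- x, - c) \<in> G"
    "(x, c) \<in> G \<Longrightarrow> (y, d) \<in> G \<Longrightarrow> (x + y, c + d) \<in> G"
    "(x, c) \<in> G \<Longrightarrow> (y, d) \<in> G \<Longrightarrow> (x * y, c * d) \<in> G" by auto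
  show "(0, 0) \<in> G" using *(3)[OF *(1) *(2)[OF *(1)]] by simp
  show "(x, c) \<in> G \<Longrightarrow> (y, d) \<in> G \<Longrightarrow> (x - y, c - d) \<in> G"
    using *(3)[of x c "- y" "- d"] *(2)[of y d] by simp
qed

lemma partial_embedding_zero: "(0, c) \<in> G \<Longrightarrow> c = 0"
  using G by (auto simp: partial_embedding_def)

lemma partial_embedding_unique: "(x, c) \<in> G \<Longrightarrow> (x, d) \<in> G \<Longrightarrow> c = d"
  using partial_embedding_closed(5)[of x c x d] partial_embedding_zero[of "c - d"] by simp

lemma partial_embedding_sum:
  "(\<And>i. i \<in> I \<Longrightarrow> (f i, g i) \<in> G) \<Longrightarrow> (sum f I, sum g I) \<in> G"
  by (induction I rule: infinite_finite_induct) (auto simp: partial_embedding_closed)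

lemma partial_embedding_of_int: "(of_int k, of_int k) \<in> G"
proof -
  have nat: "(of_nat k, of_nat k) \<in> G" for k
    by (induction k) (auto simp: partial_embedding_closed)
  show ?thesis
    by (cases k rule: int_cases2) (use nat partial_embedding_closed(3)[OF nat] in auto)
qed

text \<open>A polynomial over the domain of the partial embedding together with its image; the pair
  avoids choosing a function for the graph.\<close>

definition related_polys :: "'a poly \<Rightarrow> complex poly \<Rightarrow> bool"
  where "related_polys f g \<longleftrightarrow> (\<forall>i. (Polynomial.coeff f i, Polynomial.coeff g i) \<in> G)"

lemma related_polys_closed:
  "related_polys 0 0" "related_polys 1 1"
  "related_polys f g \<Longrightarrow> related_polys (- f) (- g)"
  "related_polys f g \<Longrightarrow> related_polys f' g' \<Longrightarrow> related_polys (f + f') (g + g')"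
  "related_polys f g \<Longrightarrow> related_polys f' g' \<Longrightarrow> related_polys (f - f') (g - g')"
  "related_polys f g \<Longrightarrow> related_polys f' g' \<Longrightarrow> related_polys (f * f') (g * g')"
  "(x, c) \<in> G \<Longrightarrow> related_polys (Polynomial.monom x k) (Polynomial.monom c k)"
  unfolding related_polys_def
  by (auto simp: partial_embedding_closed coeff_mult coeff_1 intro!: partial_embedding_sum)

lemma related_polys_eval: "related_polys f g \<Longrightarrow> (x, c) \<in> G \<Longrightarrow> (poly f x, poly g c) \<in> G"
proof (induction f arbitrary: g)
  case 0
  then have "g = 0" by (auto simp: related_polys_def poly_eq_iff dest: partial_embedding_zero)
  then show ?case by (simp add: partial_embedding_closed)
next
  case (pCons a f)
  obtain b g' where g: "g = pCons b g'" by (cases g)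
  have "(a, b) \<in> G" using pCons.prems(1) by (auto simp: related_polys_def g dest: spec[of _ 0])
  moreover have "related_polys f g'"
    using pCons.prems(1) by (auto simp: related_polys_def g dest: spec[of _ "Suc _"])
  ultimately show ?case using pCons.IH pCons.prems(2) by (auto simp: g intro!: partial_embedding_closed)
qed

text \<open>Pseudo-division by a polynomial of minimal degree vanishing at \<open>y\<close>, carried out on both sides.\<close>

lemma related_root:
  assumes m: "related_polys m m'" "m \<noteq> 0" "poly m y = 0" "poly m' w = 0"
    and inj: "\<And>x. (x, 0) \<in> G \<Longrightarrow> x = 0"
    and min: "\<And>f g. related_polys f g \<Longrightarrow> f \<noteq> 0 \<Longrightarrow> poly f y = 0 \<Longrightarrow> Polynomial.degree m \<le> Polynomial.degree f"
    and fg: "related_polys f g" "poly f y = 0"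
  shows "poly g w = 0"
  using fg
proof (induction "Polynomial.degree f" arbitrary: f g rule: less_induct)
  case less
  show ?case
  proof (cases "f = 0")
    case True
    then have "g = 0"
      using less.prems by (auto simp: related_polys_def poly_eq_iff dest: partial_embedding_zero)
    then show ?thesis by simp
  next
    case False
    define k where "k = Polynomial.degree f - Polynomial.degree m"
    have deg: "Polynomial.degree f = k + Polynomial.degree m"
      using min[OF less.prems(1) False less.prems(2)] by (simp add: k_def)
    define l where "l = (\<lambda>i. (Polynomial.coeff m i, Polynomial.coeff m' i))"
    define a where "a = Polynomial.lead_coeff m"
    define a' where "a' = Polynomial.coeff m' (Polynomial.degree m)"
    define b where "b = Polynomial.lead_coeff f"
    define b' where "b' = Polynomial.coeff g (Polynomial.degree f)"
    have aG: "(a, a') \<in> G" "(b, b') \<in> G"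
      using m(1) less.prems(1) by (auto simp: related_polys_def a_def a'_def b_def b'_def)
    have "a \<noteq> 0" using m(2) by (simp add: a_def)
    then have "a' \<noteq> 0" using inj aG by auto
    define h where "h = Polynomial.monom a 0 * f - Polynomial.monom b k * m"
    define h' where "h' = Polynomial.monom a' 0 * g - Polynomial.monom b' k * m'"
    have rel: "related_polys h h'"
      unfolding h_def h'_def using aG m(1) less.prems(1) by (intro related_polys_closed)
    have root: "poly h y = 0" unfolding h_def using m(3) less.prems(2) by (simp add: poly_monom)
    have "poly h' w = 0"
    proof (cases "h = 0")
      case True
      then have "h' = 0"
        using rel by (auto simp: related_polys_def poly_eq_iff dest: partial_embedding_zero)
      then show ?thesis by simp
    next
      case False
      have "Polynomial.degree h \<le> Polynomial.degree f"
        unfolding h_def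
      proof (rule degree_diff_le)
        show "Polynomial.degree (Polynomial.monom a 0 * f) \<le> Polynomial.degree f"
          using degree_mult_le[of "Polynomial.monom a 0" f] degree_monom_le[of a 0] by linarith
        show "Polynomial.degree (Polynomial.monom b k * m) \<le> Polynomial.degree f"
          using degree_mult_le[of "Polynomial.monom b k" m] degree_monom_le[of b k] deg by linarith
      qed
      moreover have "Polynomial.coeff h (Polynomial.degree f) = 0"
        unfolding h_def by (simp add: coeff_monom_mult deg a_def b_def)
      ultimately have "Polynomial.degree h < Polynomial.degree f"
        using False by (metis leading_coeff_0_iff order_le_imp_less_or_eq)
      from less.hyps[OF this rel root] show ?thesis .
    qed
    then show ?thesis using m(4) \<open>a' \<noteq> 0\<close> by (simp add: h'_def poly_monom)
  qed
qed

text \<open>By taking differences, \<open>poly g w\<close> depends on \<open>poly f y\<close> only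
  as soon as \<open>0\<close> goes to \<open>0\<close>, which is what \<open>root\<close> provides.
  The new graph lives on the ring generated by \<open>y\<close>.\<close>

lemma partial_embedding_adjoin:
  assumes root: "\<And>f g. related_polys f g \<Longrightarrow> poly f y = 0 \<Longrightarrow> poly g w = 0"
  shows "\<exists>H. partial_embedding H \<and> G \<subseteq> H \<and> (y, w) \<in> H"
proof (intro exI conjI)
  let ?H = "{(poly f y, poly g w) | f g. related_polys f g}"
  have mem: "(poly f y, poly g w) \<in> ?H" if "related_polys f g" for f g using that by blast
  show "partial_embedding ?H"
    unfolding partial_embedding_def
  proof (intro conjI allI impI)
    show "(1, 1) \<in> ?H" using mem[OF related_polys_closed(2)] by simp
    show "c = 0" if "(0, c) \<in> ?H" for c using that root by force
    fix x c z d assume "(x, c) \<in> ?H" "(z, d) \<in> ?H"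
    then obtain f g f' g' where *: "related_polys f g" "related_polys f' g'"
      "x = poly f y" "c = poly g w" "z = poly f' y" "d = poly g' w" by auto
    show "(x + z, c + d) \<in> ?H" using mem[OF related_polys_closed(4)[OF *(1,2)]] * by simp
    show "(x * z, c * d) \<in> ?H" using mem[OF related_polys_closed(6)[OF *(1,2)]] * by simp
    show "(- x, - c) \<in> ?H" using mem[OF related_polys_closed(3)[OF *(1)]] * by simp
  qed
  show "G \<subseteq> ?H"
  proof
    fix z assume "z \<in> G"
    then have "related_polys (Polynomial.monom (fst z) 0) (Polynomial.monom (snd z) 0)"
      by (intro related_polys_closed) auto
    from mem[OF this] show "z \<in> ?H" by (simp add: poly_monom)
  qed
  show "(y, w) \<in> ?H"
    using mem[OF related_polys_closed(7)[OF partial_embedding_closed(1), of 1]] by (simp add: poly_monom)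
qed

end

section \<open>Minimal integer polynomials and the extension of embeddings\<close>

abbreviation ipoly :: "int poly \<Rightarrow> 'a :: field \<Rightarrow> 'a"
  where "ipoly f z \<equiv> poly (map_poly of_int f) z"

lemma map_poly_of_int_add: "map_poly of_int (f + g) = map_poly of_int f + (map_poly of_int g :: 'a :: field poly)"
  by (rule poly_eqI) (simp add: coeff_map_poly)

lemma map_poly_of_int_mult: "map_poly of_int (f * g) = map_poly of_int f * (map_poly of_int g :: 'a :: field poly)"
  by (rule poly_eqI) (simp add: coeff_map_poly coeff_mult)

lemma map_poly_of_int_smult: "map_poly of_int (Polynomial.smult c f) = Polynomial.smult (of_int c) (map_poly of_int f :: 'a :: field poly)"
  by (rule poly_eqI) (simp add: coeff_map_poly)

locale algebraic_field =
  fixes V :: "'a :: field set"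
  assumes char_zero: "CHAR('a) = 0" and V: "Ints.spans_fractions V"
begin

lemma of_int_eq_0 [simp]: "of_int k = (0 :: 'a) \<longleftrightarrow> k = 0"
  by (simp add: of_int_eq_0_iff_char_dvd char_zero)

lemma ipoly_exists: "\<exists>f. f \<noteq> 0 \<and> Polynomial.degree f \<le> card V \<and> ipoly f (z :: 'a) = 0"
proof -
  obtain c where c: "\<forall>i. c i \<in> \<int>" "\<exists>i\<in>{..card V}. c i \<noteq> 0" "(\<Sum>i\<in>{..card V}. c i * z ^ i) = 0"
    using Ints.spans_fractions_dependent[OF V, of "{..card V}" "\<lambda>i. z ^ i"] by auto
  then have "\<forall>i. \<exists>k. c i = of_int k" by (metis Ints_cases)
  from choice[OF this] obtain k where k: "\<And>i. c i = of_int (k i)" by auto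
  define f where "f = (\<Sum>i\<le>card V. Polynomial.monom (k i) i)"
  have coeff: "Polynomial.coeff f i = (if i \<le> card V then k i else 0)" for i
    by (simp add: f_def coeff_sum)
  have deg: "Polynomial.degree f \<le> card V" by (rule degree_le) (simp add: coeff)
  have "f \<noteq> 0"
  proof
    assume "f = 0"
    then have "k i = 0" if "i \<le> card V" for i using coeff[of i] that by simp
    with c(2) k show False by auto
  qed
  moreover have "ipoly f z = (\<Sum>i\<le>card V. Polynomial.coeff (map_poly of_int f) i * z ^ i)"
    unfolding poly_altdef using deg degree_map_poly_le[of of_int f]
    by (intro sum.mono_neutral_left) (auto simp: coeff_map_poly intro!: le_degree elim: order.trans)
  then have "ipoly f z = 0" using c(3) by (simp add: coeff_map_poly coeff k)
  ultimately show ?thesis using deg by blast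
qed

text \<open>Gauss's lemma: an annihilating integer polynomial of least degree, made primitive,
  divides all others over the integers and not only over the rationals. Divisibility over the
  integers is what controls the leading coefficient of an algebraic integer.\<close>

lemma minimal_ipoly:
  fixes z :: 'a
  obtains h where "h \<noteq> 0" "Polynomial.degree h \<le> card V" "ipoly h z = 0"
    "\<And>f. ipoly f z = 0 \<Longrightarrow> h dvd f"
proof -
  obtain g0 where g0: "g0 \<noteq> 0 \<and> ipoly g0 z = 0"
    and deg0: "Polynomial.degree g0 \<le> card V" using ipoly_exists[of z] by blast
  from ex_has_least_nat[where P = "\<lambda>f. f \<noteq> 0 \<and> ipoly f z = 0" and m = Polynomial.degree, OF g0]
  obtain g where "(g \<noteq> 0 \<and> ipoly g z = 0) \<and>
    (\<forall>f. f \<noteq> 0 \<and> ipoly f z = 0 \<longrightarrow> Polynomial.degree g \<le> Polynomial.degree f)" ..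
  then have g: "g \<noteq> 0" "ipoly g z = 0"
    and min: "\<And>f. f \<noteq> 0 \<Longrightarrow> ipoly f z = 0 \<Longrightarrow> Polynomial.degree g \<le> Polynomial.degree f"
    by simp_all
  define h where "h = primitive_part g"
  have h: "h \<noteq> 0" "content h = 1" "Polynomial.degree h = Polynomial.degree g"
    using g by (simp_all add: h_def)
  have "g = Polynomial.smult (content g) h" by (simp add: h_def)
  then have "of_int (content g) * ipoly h z = 0"
    using g(2) map_poly_of_int_smult[of "content g" h] by (metis poly_smult)
  then have root: "ipoly h z = 0" using g by simp
  show thesis
  proof (rule that[OF h(1) _ root])
    show "Polynomial.degree h \<le> card V" using min[of g0] g0 deg0 h(3) by simp
    fix f assume f: "ipoly f z = 0"
    obtain q r where qr: "pseudo_divmod f h = (q, r)" by fastforce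
    define c where "c = Polynomial.lead_coeff h ^ (Suc (Polynomial.degree f) - Polynomial.degree h)"
    have eq: "Polynomial.smult c f = h * q + r" unfolding c_def by (rule pseudo_divmod(1)[OF h(1) qr])
    have "of_int c * ipoly f z = ipoly h z * ipoly q z + ipoly r z"
      using arg_cong[OF eq, of "\<lambda>f. ipoly f z"]
      by (simp add: map_poly_of_int_smult map_poly_of_int_add map_poly_of_int_mult)
    then have "ipoly r z = 0" using f root by simp
    then have "r = 0" using pseudo_divmod(2)[OF h(1) qr] min[of r] h(3) by fastforce
    with eq have eq: "Polynomial.smult c f = h * q" by simp
    have "c \<noteq> 0" using h(1) by (simp add: c_def)
    \<comment> \<open>As \<open>h\<close> has content \<open>1\<close>, the factor \<open>c\<close>
      introduced by pseudo-division divides the content of \<open>q\<close> and can be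
      cancelled.\<close>
    have "normalize c * content f = content q"
      using arg_cong[OF eq, of content] h(2) by (simp add: content_mult)
    then have "c dvd content q" by (metis dvd_triv_left normalize_dvd_iff)
    then have "[:c:] dvd q" by (simp add: const_poly_dvd_iff_dvd_content)
    then obtain q' where "q = Polynomial.smult c q'" by (auto elim!: dvdE)
    with eq have "Polynomial.smult c f = Polynomial.smult c (h * q')" by simp
    then have "f = h * q'" by (rule smult_cancel[OF \<open>c \<noteq> 0\<close>])
    then show "h dvd f" by simp
  qed
qed

text \<open>Evaluating the minimal equation of a nonzero \<open>x\<close> at the image
  \<open>0\<close> leaves its constant coefficient, which is nonzero because otherwise the degree
  could be lowered.\<close>

lemma partial_embedding_inj:
  assumes G: "partial_embedding G" and x: "((x :: 'a), 0) \<in> G"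
  shows "x = 0"
proof (rule ccontr)
  assume "x \<noteq> 0"
  obtain h where h: "h \<noteq> 0" "Polynomial.degree h \<le> card V" "ipoly h x = 0"
    "\<And>f. ipoly f x = 0 \<Longrightarrow> h dvd f"
    by (rule minimal_ipoly[of x]) (rule that)
  have "Polynomial.coeff h 0 \<noteq> 0"
  proof
    assume "Polynomial.coeff h 0 = 0"
    then obtain f where f: "h = pCons 0 f" by (cases h) auto
    have "map_poly of_int h = pCons 0 (map_poly of_int f :: 'a poly)"
      unfolding f by (rule poly_eqI) (auto simp: coeff_map_poly coeff_pCons split: nat.splits)
    then have "ipoly f x = 0" using h(3) \<open>x \<noteq> 0\<close> by simp
    from h(4)[OF this] have "Polynomial.degree h \<le> Polynomial.degree f"
      using h(1) f by (intro dvd_imp_degree_le) auto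
    then show False using h(1) f by auto
  qed
  moreover have "related_polys G (map_poly of_int h) (map_poly of_int h)"
    by (simp add: related_polys_def[OF G] coeff_map_poly partial_embedding_of_int[OF G])
  from related_polys_eval[OF G this x] have "(0, of_int (Polynomial.coeff h 0)) \<in> G"
    using h(3) by (simp add: poly_0_coeff_0 coeff_map_poly)
  then have "of_int (Polynomial.coeff h 0) = (0 :: complex)" by (rule partial_embedding_zero[OF G])
  ultimately show False by simp
qed

text \<open>The witness \<open>w\<close> is a root of the image of a polynomial of least degree over
  the domain of \<open>G\<close> that vanishes at \<open>y\<close>. Injectivity of \<open>G\<close>
  keeps the leading coefficient nonzero, so the image is not constant and has a complex
  root.\<close>

lemma partial_embedding_extend:
  assumes G: "partial_embedding (G :: ('a \<times> complex) set)"
  shows "\<exists>H w. partial_embedding H \<and> G \<subseteq> H \<and> (y, w) \<in> H"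
proof -
  let ?P = "\<lambda>f. f \<noteq> 0 \<and> poly f y = 0 \<and> (\<exists>g. related_polys G f g)"
  obtain h where h: "h \<noteq> 0" "ipoly h y = 0" using ipoly_exists[of y] by blast
  have "map_poly of_int h \<noteq> (0 :: 'a poly)"
    using h(1) by (auto simp: poly_eq_iff coeff_map_poly)
  then have "?P (map_poly of_int h)"
    using h(2) by (auto simp: related_polys_def[OF G] coeff_map_poly partial_embedding_of_int[OF G]
        intro!: exI[of _ "map_poly of_int h"])
  from ex_has_least_nat[where P = ?P and m = Polynomial.degree, OF this]
  obtain m where "?P m \<and> (\<forall>f. ?P f \<longrightarrow> Polynomial.degree m \<le> Polynomial.degree f)" ..
  then have m: "?P m" and min: "\<And>f. ?P f \<Longrightarrow> Polynomial.degree m \<le> Polynomial.degree f" by simp_all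
  then obtain m' where m': "related_polys G m m'" by blast
  have "Polynomial.degree m > 0" using m by (intro Nat.gr0I) (auto elim!: degree_eq_zeroE)
  moreover have "Polynomial.coeff m' (Polynomial.degree m) \<noteq> 0"
    using partial_embedding_inj[OF G, of "Polynomial.lead_coeff m"] m m'
    by (auto simp: related_polys_def[OF G] dest: spec[of _ "Polynomial.degree m"])
  ultimately have "\<not> constant (poly m')"
    by (metis constant_degree le_degree not_le)
  then obtain w where w: "poly m' w = 0" using fundamental_theorem_of_algebra by blast
  have "\<exists>H. partial_embedding H \<and> G \<subseteq> H \<and> (y, w) \<in> H"
  proof (rule partial_embedding_adjoin[OF G])
    fix f g assume "related_polys G f g" "poly f y = 0"
    then show "poly g w = 0"
      using m min by (intro related_root[OF G m' _ _ w partial_embedding_inj[OF G], of y f]) auto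
  qed
  then show ?thesis by blast
qed

text \<open>A maximal partial embedding, given by Zorn's lemma, is total since it could otherwise be
  extended by one more element.\<close>

lemma embedding_extends:
  assumes G: "partial_embedding (G :: ('a \<times> complex) set)"
  shows "\<exists>\<sigma>\<in>embeddings. \<forall>(x, c)\<in>G. \<sigma> x = c"
proof -
  define S where "S = {H. partial_embedding H \<and> G \<subseteq> H}"
  have "\<exists>M\<in>S. \<forall>Y\<in>S. M \<subseteq> Y \<longrightarrow> Y = M"
  proof (rule subset_Zorn_nonempty)
    show "S \<noteq> {}" using G by (auto simp: S_def)
    fix C assume C: "C \<noteq> {}" "subset.chain S C"
    then have CS: "C \<subseteq> S" by (auto simp: subset.chain_def)
    have pe: "\<And>H. H \<in> C \<Longrightarrow> partial_embedding H" using CS by (auto simp: S_def)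
    have lin: "H \<subseteq> H' \<or> H' \<subseteq> H" if "H \<in> C" "H' \<in> C" for H H'
      using C(2) that unfolding subset.chain_def by blast
    have "partial_embedding (\<Union>C)"
      unfolding partial_embedding_def
    proof (intro conjI allI impI)
      show "(1, 1) \<in> \<Union>C" using C(1) partial_embedding_closed(1)[OF pe] by blast
      show "c = 0" if "(0, c) \<in> \<Union>C" for c using that partial_embedding_zero[OF pe] by blast
      fix x c y d assume "(x, c) \<in> \<Union>C" "(y, d) \<in> \<Union>C"
      then obtain H where H: "H \<in> C" "(x, c) \<in> H" "(y, d) \<in> H" using lin by blast
      note pe = pe[OF H(1)]
      show "(x + y, c + d) \<in> \<Union>C" "(x * y, c * d) \<in> \<Union>C" "(- x, - c) \<in> \<Union>C"
        using partial_embedding_closed(4)[OF pe H(2,3)] partial_embedding_closed(6)[OF pe H(2,3)]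
          partial_embedding_closed(3)[OF pe H(2)] H(1) by blast+
    qed
    then show "\<Union>C \<in> S" using C CS by (auto simp: S_def)
  qed
  then obtain M where M: "partial_embedding M" "G \<subseteq> M"
    and max: "\<And>Y. partial_embedding Y \<Longrightarrow> M \<subseteq> Y \<Longrightarrow> Y = M" unfolding S_def by auto
  have "\<exists>w. (y, w) \<in> M" for y
  proof -
    obtain H w where H: "partial_embedding H" "M \<subseteq> H" "(y, w) \<in> H"
      using partial_embedding_extend[OF M(1), of y] by (elim exE conjE)
    with max[OF H(1,2)] show ?thesis by auto
  qed
  then have "\<forall>y. \<exists>w. (y, w) \<in> M" by simp
  from choice[OF this] obtain \<sigma> where \<sigma>: "\<And>y. (y, \<sigma> y) \<in> M" by auto
  have eq: "\<sigma> x = c" if "(x, c) \<in> M" for x c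
    using partial_embedding_unique[OF M(1) \<sigma> that] .
  have "\<sigma> \<in> embeddings"
    by (intro embeddingsI eq partial_embedding_closed[OF M(1)] \<sigma>)
  then show ?thesis using eq M(2) by blast
qed

text \<open>Over the integers the pair \<open>(z, w)\<close> can be adjoined because
  \<open>w\<close> is a root of a polynomial dividing all annihilators of \<open>z\<close>; the
  resulting partial embedding then extends to the whole field.\<close>

lemma embedding_root:
  assumes h: "\<And>f. ipoly f z = 0 \<Longrightarrow> h dvd f" "ipoly h w = 0"
  shows "\<exists>\<sigma>\<in>embeddings. \<sigma> (z :: 'a) = w"
proof -
  let ?G = "range (\<lambda>k. (of_int k :: 'a, of_int k :: complex))"
  have G: "partial_embedding ?G"
    unfolding partial_embedding_def
    by (auto simp: image_iff intro: exI[of _ 1] exI[of _ "_ + _"] exI[of _ "_ * _"] exI[of _ "- _"]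
        simp flip: of_int_add of_int_mult of_int_minus)
  have "\<exists>H. partial_embedding H \<and> ?G \<subseteq> H \<and> (z, w) \<in> H"
  proof (rule partial_embedding_adjoin[OF G])
    fix f g assume that: "related_polys ?G f g" "poly f z = 0"
    \<comment> \<open>Related coefficients are images of the same integer, so \<open>f\<close> and
      \<open>g\<close> both come from one integer polynomial \<open>e\<close>.\<close>
    have "\<forall>i. \<exists>k. Polynomial.coeff f i = of_int k \<and> Polynomial.coeff g i = of_int k"
      using that(1) by (auto simp: related_polys_def[OF G])
    from choice[OF this] obtain k where k: "\<And>i. Polynomial.coeff f i = of_int (k i)"
      "\<And>i. Polynomial.coeff g i = of_int (k i)" by auto
    define e where "e = Abs_poly k"
    have "k i = 0" if "i > Polynomial.degree f" for i using k(1)[of i] coeff_eq_0[OF that] by simp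
    then have e: "Polynomial.coeff e = k"
      unfolding e_def by (intro coeff_Abs_poly) blast
    have "f = map_poly of_int e" "g = map_poly of_int e"
      by (simp_all add: poly_eq_iff coeff_map_poly e k)
    moreover from this have "h dvd e" using h(1) that by simp
    ultimately show "poly g w = 0" using h(2) by (auto elim!: dvdE simp: map_poly_of_int_mult)
  qed
  then obtain H where "partial_embedding H" "(z, w) \<in> H" by blast
  with embedding_extends[of H] show ?thesis by fast
qed

text \<open>The minimal polynomial divides a monic integer polynomial, so its leading coefficient is
  a unit of the integers. It is normalised up to sign only, which suffices for bounding
  coefficients.\<close>

lemma algebraic_int_minimal_ipoly:
  assumes "algebraic_int (z :: 'a)"
  obtains h where "\<bar>Polynomial.lead_coeff h\<bar> = 1" "Polynomial.degree h \<le> card V" "ipoly h z = 0"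
    "\<And>w :: complex. ipoly h w = 0 \<Longrightarrow> \<exists>\<sigma>\<in>embeddings. \<sigma> z = w"
proof -
  obtain h where h: "h \<noteq> 0" "Polynomial.degree h \<le> card V" "ipoly h z = 0"
    "\<And>f. ipoly f z = 0 \<Longrightarrow> h dvd f"
    by (rule minimal_ipoly[of z]) (rule that)
  from assms obtain p where p: "Polynomial.lead_coeff p = 1" "\<forall>i. Polynomial.coeff p i \<in> \<int>" "poly p z = 0"
    by (auto elim: algebraic_int.cases)
  then have "\<forall>i. \<exists>k. Polynomial.coeff p i = of_int k" by (metis Ints_cases)
  from choice[OF this] obtain k where k: "\<And>i. Polynomial.coeff p i = of_int (k i)" by auto
  define e where "e = Abs_poly k"
  have k0: "k i = 0" if "i > Polynomial.degree p" for i using k[of i] coeff_eq_0[OF that] by simp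
  then have e: "Polynomial.coeff e = k"
    unfolding e_def by (intro coeff_Abs_poly) blast
  have "p = map_poly of_int e" by (simp add: poly_eq_iff coeff_map_poly e k)
  with p(3) h(4) have "h dvd e" by auto
  have lc: "k (Polynomial.degree p) = 1"
  proof -
    have "of_int (k (Polynomial.degree p) - 1) = (0 :: 'a)" using p(1) k by simp
    then show ?thesis unfolding of_int_eq_0 by simp
  qed
  have "Polynomial.degree e = Polynomial.degree p"
    using lc k0 e by (intro antisym degree_le le_degree) auto
  then have "Polynomial.lead_coeff e = 1" using lc e by simp
  moreover have "Polynomial.lead_coeff h dvd Polynomial.lead_coeff e"
    using \<open>h dvd e\<close> by (auto elim!: dvdE simp: lead_coeff_mult)
  ultimately have "\<bar>Polynomial.lead_coeff h\<bar> = 1" by simp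
  then show thesis using that[of h] h embedding_root[OF h(4)] by blast
qed

end

section \<open>Finiteness of algebraic integers with bounded conjugates\<close>

lemma coeff_prod_linear_bound:
  assumes "\<And>a. a \<in> set as \<Longrightarrow> cmod a \<le> C" "C \<ge> 0"
  shows "cmod (Polynomial.coeff (\<Prod>a\<leftarrow>as. [:- a, 1:]) i) \<le> (1 + C) ^ length as"
  using assms(1)
proof (induction as arbitrary: i)
  case Nil
  then show ?case by (simp add: coeff_1)
next
  case (Cons a as)
  let ?p = "\<Prod>a\<leftarrow>as. [:- a, 1:]"
  have *: "cmod (Polynomial.coeff (pCons 0 ?p) i) \<le> (1 + C) ^ length as"
    using Cons assms(2) by (cases i) auto
  \<comment> \<open>A linear factor shifts the coefficients and adds at most \<open>C\<close> times
    the old ones, whence the factor \<open>1 + C\<close>.\<close>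
  have "Polynomial.coeff (\<Prod>a\<leftarrow>a # as. [:- a, 1:]) i = Polynomial.coeff (pCons 0 ?p) i - a * Polynomial.coeff ?p i"
    by simp
  also have "cmod \<dots> \<le> cmod (Polynomial.coeff (pCons 0 ?p) i) + cmod a * cmod (Polynomial.coeff ?p i)"
    by (rule order.trans[OF norm_triangle_ineq4]) (simp add: norm_mult)
  also have "\<dots> \<le> (1 + C) ^ length as + C * (1 + C) ^ length as"
    using Cons assms(2) * by (intro add_mono mult_mono) auto
  finally show ?case by (simp add: algebra_simps)
qed

lemma coeff_bound_of_roots:
  assumes "\<And>w. poly p w = 0 \<Longrightarrow> cmod w \<le> C" "C \<ge> 0" "cmod (Polynomial.lead_coeff p) = 1"
  shows "cmod (Polynomial.coeff p i) \<le> (1 + C) ^ Polynomial.degree p"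
proof -
  obtain as where as: "Polynomial.smult (Polynomial.lead_coeff p) (\<Prod>a\<leftarrow>as. [:- a, 1:]) = p"
    "length as = Polynomial.degree p"
    using fundamental_theorem_algebra_factorized[of p] by blast
  have "poly p a = 0" if "a \<in> set as" for a
    using that by (subst as(1)[symmetric]) (auto simp: poly_prod_list prod_list_zero_iff)
  then have *: "cmod (Polynomial.coeff (\<Prod>a\<leftarrow>as. [:- a, 1:]) i) \<le> (1 + C) ^ Polynomial.degree p"
    unfolding as(2)[symmetric] using assms by (intro coeff_prod_linear_bound) auto
  have "Polynomial.coeff p i = Polynomial.lead_coeff p * Polynomial.coeff (\<Prod>a\<leftarrow>as. [:- a, 1:]) i"
    by (subst as(1)[symmetric]) simp
  with * assms(3) show ?thesis by (simp add: norm_mult)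
qed

lemma finite_bounded_int_polys: "finite {h :: int poly. Polynomial.degree h \<le> r \<and> (\<forall>i. \<bar>Polynomial.coeff h i\<bar> \<le> B)}"
proof (rule finite_subset)
  show "{h :: int poly. Polynomial.degree h \<le> r \<and> (\<forall>i. \<bar>Polynomial.coeff h i\<bar> \<le> B)}
    \<subseteq> Poly ` {xs. set xs \<subseteq> {-B..B} \<and> length xs \<le> Suc r}"
  proof
    fix h :: "int poly" assume h: "h \<in> {h. Polynomial.degree h \<le> r \<and> (\<forall>i. \<bar>Polynomial.coeff h i\<bar> \<le> B)}"
    have "x \<in> {-B..B}" if x: "x \<in> set (coeffs h)" for x
    proof -
      obtain i where "x = Polynomial.coeff h i"
        using x unfolding coeffs_def by (auto split: if_splits)
      then show ?thesis using h abs_le_iff[of x B] by auto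
    qed
    moreover have "length (coeffs h) \<le> Suc r" using h by (auto simp: coeffs_def)
    ultimately show "h \<in> Poly ` {xs. set xs \<subseteq> {-B..B} \<and> length xs \<le> Suc r}"
      by (intro image_eqI[of _ _ "coeffs h"]) auto
  qed
qed (intro finite_imageI finite_lists_length_le, simp)

lemma (in algebraic_field) finite_bounded_algebraic_ints:
  "finite {z :: 'a. algebraic_int z \<and> (\<forall>\<sigma>\<in>embeddings. cmod (\<sigma> z) \<le> C)}"
proof -
  \<comment> \<open>\<open>C\<close> may be negative, whereas the bound on the coefficients needs a
    nonnegative radius.\<close>
  define C' where "C' = max C 0"
  define B where "B = \<lceil>(1 + C') ^ card V\<rceil>"
  let ?H = "{h :: int poly. Polynomial.degree h \<le> card V \<and> (\<forall>i. \<bar>Polynomial.coeff h i\<bar> \<le> B)} - {0}"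
  have "finite {z :: 'a. ipoly h z = 0}" if "h \<noteq> 0" for h
  proof (rule poly_roots_finite)
    show "map_poly of_int h \<noteq> (0 :: 'a poly)" using that by (auto simp: poly_eq_iff coeff_map_poly)
  qed
  then have "finite (\<Union>h\<in>?H. {z :: 'a. ipoly h z = 0})"
    using finite_bounded_int_polys by (intro finite_UN_I finite_Diff) auto
  moreover have "{z :: 'a. algebraic_int z \<and> (\<forall>\<sigma>\<in>embeddings. cmod (\<sigma> z) \<le> C)}
      \<subseteq> (\<Union>h\<in>?H. {z. ipoly h z = 0})"
  proof
    fix z :: 'a assume z: "z \<in> {z. algebraic_int z \<and> (\<forall>\<sigma>\<in>embeddings. cmod (\<sigma> z) \<le> C)}"
    then obtain h where h: "\<bar>Polynomial.lead_coeff h\<bar> = 1" "Polynomial.degree h \<le> card V" "ipoly h z = 0"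
      "\<And>w :: complex. ipoly h w = 0 \<Longrightarrow> \<exists>\<sigma>\<in>embeddings. \<sigma> z = w"
      using algebraic_int_minimal_ipoly[of z] by blast
    have deg: "Polynomial.degree (map_poly of_int h :: complex poly) = Polynomial.degree h"
      by (rule degree_map_poly) auto
    have roots: "cmod w \<le> C'" if "ipoly h w = 0" for w
      using h(4)[OF that] z by (auto simp: C'_def)
    have "\<bar>Polynomial.coeff h i\<bar> \<le> B" for i
    proof -
      have "cmod (Polynomial.coeff (map_poly of_int h) i) \<le> (1 + C') ^ Polynomial.degree (map_poly of_int h :: complex poly)"
        using roots h(1) by (intro coeff_bound_of_roots) (auto simp: C'_def deg coeff_map_poly simp flip: of_int_abs)
      then have "real_of_int \<bar>Polynomial.coeff h i\<bar> \<le> (1 + C') ^ Polynomial.degree h"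
        by (simp add: deg coeff_map_poly)
      also have "\<dots> \<le> (1 + C') ^ card V" using h(2) by (intro power_increasing) (auto simp: C'_def)
      also have "\<dots> \<le> B" by (simp add: B_def)
      finally show ?thesis by linarith
    qed
    then show "z \<in> (\<Union>h\<in>?H. {z. ipoly h z = 0})" using h by auto
  qed
  ultimately show ?thesis by (rule rev_finite_subset)
qed

section \<open>The number field case\<close>

text \<open>Everything that the common part of the argument uses about the field and its places. In
  \<open>finite_values\<close> the elements are replaced by their value vectors because a box can be
  infinite; in \<open>small_element\<close> the last place is left free, which is the freedom that
  makes such elements exist.\<close>

locale place_system =
  fixes \<K> :: "'a :: field setting" and n :: nat and p :: "nat \<Rightarrow> 'a \<Rightarrow> real"
  assumes places: "bij_betw p {1..n+1} (places \<K>)"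
    and base_gt_1: "base \<K> > 1"
    and deg_pos: "i \<in> {1..n+1} \<Longrightarrow> place_deg \<K> (p i) > 0"
    and val_mult: "i \<in> {1..n+1} \<Longrightarrow> f \<noteq> 0 \<Longrightarrow> g \<noteq> 0 \<Longrightarrow> p i (f * g) = p i f + p i g"
    and val_in_group: "i \<in> {1..n+1} \<Longrightarrow> f \<noteq> 0 \<Longrightarrow> p i f \<in> val_group \<K>"
    and subring_int_ring: "idom_subring (int_ring \<K>)"
    and denominators: "\<exists>b\<in>int_ring \<K> - {0}. b * h \<in> int_ring \<K>"
    and stabilizer_integral:
      "a \<in> frac_ideals (int_ring \<K>) \<Longrightarrow> (\<And>x. x \<in> a \<Longrightarrow> \<epsilon> * x \<in> a) \<Longrightarrow> \<epsilon> \<in> int_ring \<K>"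
    and finite_values: "a \<in> frac_ideals (int_ring \<K>) \<Longrightarrow>
      finite ((\<lambda>h. \<lambda>i\<in>{1..n+1}. p i h) ` {h\<in>a. h \<noteq> 0 \<and> (\<forall>i\<in>{1..n+1}. - p i h \<le> C)})"
    and small_element:
      "a \<in> frac_ideals (int_ring \<K>) \<Longrightarrow> \<exists>h\<in>a. h \<noteq> 0 \<and> (\<forall>i\<in>{1..n}. - p i h \<le> s)"

lemma frac_idealsD:
  assumes "a \<in> frac_ideals R"
  shows "submodule_of R a" "a \<noteq> {0}" "\<exists>d\<in>R. d \<noteq> 0 \<and> (\<forall>f\<in>a. d * f \<in> R)"
  using assms unfolding frac_ideals_def submodule_of_def by auto

lemma submodule_of_mono: "submodule_of B M \<Longrightarrow> A \<subseteq> B \<Longrightarrow> submodule_of A M"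
  by (auto simp: submodule_of_def)

section \<open>Independent spanning sets and small integer combinations\<close>

context field_subring
begin

lemma spans_fractions_remove:
  assumes V: "spans_fractions V" and c: "\<And>v. c v \<in> A" "(\<Sum>v\<in>V. c v * v) = 0" "v0 \<in> V" "c v0 \<noteq> 0"
  shows "spans_fractions (V - {v0})"
  unfolding spans_fractions_def
proof (intro conjI allI)
  have fin: "finite V" using V by (simp add: spans_fractions_def)
  then show "finite (V - {v0})" by simp
  fix h
  obtain b where b: "b \<in> A - {0}" "b * h \<in> lspan A V"
    using V by (auto simp: spans_fractions_def)
  then obtain m where m: "\<And>v. m v \<in> A" "b * h = (\<Sum>v\<in>V. m v * v)" by (auto simp: lspan_def)
  have "(c v0 * b) * h = c v0 * (\<Sum>v\<in>V. m v * v) - m v0 * (\<Sum>v\<in>V. c v * v)"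
    by (simp add: m(2)[symmetric] c(2) mult.assoc)
  also have "\<dots> = (\<Sum>v\<in>V. (c v0 * m v - m v0 * c v) * v)"
    by (simp add: sum_distrib_left sum_subtractf algebra_simps)
  also have "\<dots> = (\<Sum>v\<in>V - {v0}. (c v0 * m v - m v0 * c v) * v)"
    by (subst sum.remove[OF fin c(3)]) simp
  also have "\<dots> \<in> lspan A (V - {v0})"
    unfolding lspan_def using c(1) m(1)
    by (intro CollectI exI[of _ "\<lambda>v. c v0 * m v - m v0 * c v"]) (auto intro!: diff_closed mult_closed)
  finally have "(c v0 * b) * h \<in> lspan A (V - {v0})" .
  moreover have "c v0 * b \<in> A - {0}" using c b by (auto intro: mult_closed)
  ultimately show "\<exists>b\<in>A - {0}. b * h \<in> lspan A (V - {v0})" by blast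
qed

text \<open>A spanning set of least size is independent, since a dependent element could be removed.
  Independence ensures that nontrivial integer combinations are nonzero.\<close>

lemma independent_spanning_set:
  assumes "spans_fractions W" "W \<subseteq> a"
  obtains V where "spans_fractions V" "V \<subseteq> a"
    "\<And>c v. (\<And>v. c v \<in> A) \<Longrightarrow> (\<Sum>v\<in>V. c v * v) = 0 \<Longrightarrow> v \<in> V \<Longrightarrow> c v = 0"
proof -
  let ?P = "\<lambda>V. spans_fractions V \<and> V \<subseteq> a"
  have "?P W" using assms by simp
  from ex_has_least_nat[where P = ?P and m = card, OF this]
  obtain V where "?P V \<and> (\<forall>U. ?P U \<longrightarrow> card V \<le> card U)" ..
  then have V: "spans_fractions V" "V \<subseteq> a" and min: "\<And>U. ?P U \<Longrightarrow> card V \<le> card U" by simp_all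
  show thesis
  proof (rule that[OF V])
    fix c v assume *: "\<And>v. c v \<in> A" "(\<Sum>v\<in>V. c v * v) = 0" "v \<in> V"
    show "c v = 0"
    proof (rule ccontr)
      assume "c v \<noteq> 0"
      have "card V \<le> card (V - {v})"
        using spans_fractions_remove[OF V(1) * \<open>c v \<noteq> 0\<close>] V(2) by (intro min) auto
      moreover have "finite V" using V(1) by (simp add: spans_fractions_def)
      ultimately show False using *(3) by (metis card_Diff1_less not_le)
    qed
  qed
qed

end

text \<open>Dirichlet's argument: coefficient vectors with entries below \<open>N\<close> are sorted
  into cells of width \<open>\<delta>\<close> by the values of the linear forms \<open>L k\<close>,
  and two vectors in the same cell have a small difference.\<close>

lemma small_integer_combination:
  fixes L :: "'k \<Rightarrow> 'v \<Rightarrow> real"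
  assumes fin: "finite I" "finite V" and card: "card I < card V" and "\<delta> > 0"
  shows "\<exists>c :: 'v \<Rightarrow> int. (\<exists>v\<in>V. c v \<noteq> 0) \<and> (\<forall>k\<in>I. \<bar>\<Sum>v\<in>V. of_int (c v) * L k v\<bar> \<le> \<delta>)"
proof -
  define T where "T = (\<Sum>k\<in>I. \<Sum>v\<in>V. \<bar>L k v\<bar>)"
  define B where "B = nat \<lceil>T / \<delta>\<rceil>"
  have "T \<ge> 0" by (simp add: T_def sum_nonneg)
  have B: "T \<le> real B * \<delta>"
  proof -
    have "T / \<delta> \<le> real B" unfolding B_def by (rule real_nat_ceiling_ge)
    then show ?thesis using \<open>\<delta> > 0\<close> by (simp add: field_simps)
  qed
  \<comment> \<open>There are \<open>N ^ card V\<close> vectors and at most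
    \<open>((2 * B + 1) * N) ^ card I\<close> cells. As \<open>card I < card V\<close>, one factor
    \<open>N\<close> is left over, and it is taken larger than
    \<open>(2 * B + 1) ^ card I\<close>.\<close>
  define N where "N = Suc ((2 * B + 1) ^ card I)"
  define D where "D = PiE V (\<lambda>_. {0..<int N})"
  define R where "R = PiE I (\<lambda>_. {- int (B * N)..int (B * N)})"
  define \<phi> where "\<phi> = (\<lambda>c :: 'v \<Rightarrow> int. \<lambda>k\<in>I. \<lfloor>(\<Sum>v\<in>V. of_int (c v) * L k v) / \<delta>\<rfloor>)"
  have "\<phi> c \<in> R" if "c \<in> D" for c
    unfolding R_def
  proof (rule PiE_I)
    fix k assume k: "k \<in> I"
    have "\<bar>\<Sum>v\<in>V. of_int (c v) * L k v\<bar> \<le> (\<Sum>v\<in>V. real N * \<bar>L k v\<bar>)"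
    proof (rule order.trans[OF sum_abs sum_mono])
      fix v assume "v \<in> V"
      then have "0 \<le> c v" "c v < int N" using \<open>c \<in> D\<close> by (auto simp: D_def PiE_iff)
      then show "\<bar>of_int (c v) * L k v\<bar> \<le> real N * \<bar>L k v\<bar>"
        unfolding abs_mult by (intro mult_right_mono) auto
    qed
    also have "\<dots> = real N * (\<Sum>v\<in>V. \<bar>L k v\<bar>)" by (simp add: sum_distrib_left)
    also have "\<dots> \<le> real N * T"
      unfolding T_def using fin(1) k by (intro mult_left_mono member_le_sum sum_nonneg) auto
    also have "\<dots> \<le> real N * (real B * \<delta>)" using B by (intro mult_left_mono) auto
    finally have "\<bar>(\<Sum>v\<in>V. of_int (c v) * L k v) / \<delta>\<bar> \<le> real (B * N)"
      using \<open>\<delta> > 0\<close> by (simp add: field_simps)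
    then have "- int (B * N) \<le> \<lfloor>(\<Sum>v\<in>V. of_int (c v) * L k v) / \<delta>\<rfloor>"
      "\<lfloor>(\<Sum>v\<in>V. of_int (c v) * L k v) / \<delta>\<rfloor> \<le> int (B * N)"
      by linarith+
    then show "\<phi> c k \<in> {- int (B * N)..int (B * N)}"
      using k by (simp only: \<phi>_def restrict_apply' atLeastAtMost_iff)
  qed (simp add: \<phi>_def)
  then have "card (\<phi> ` D) \<le> card R"
    using fin by (intro card_mono) (auto simp: R_def intro!: finite_PiE)
  also have "card R = (2 * (B * N) + 1) ^ card I"
    using fin by (simp add: R_def card_PiE nat_add_distrib nat_mult_distrib del: of_nat_mult)
  also have "\<dots> \<le> ((2 * B + 1) * N) ^ card I"
    by (intro power_mono) (auto simp: N_def)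
  also have "\<dots> = (2 * B + 1) ^ card I * N ^ card I" by (rule power_mult_distrib)
  also have "\<dots> < N * N ^ card I" by (intro mult_strict_right_mono) (auto simp: N_def)
  also have "\<dots> = N ^ Suc (card I)" by simp
  also have "\<dots> \<le> N ^ card V" using card by (intro power_increasing) (auto simp: N_def)
  also have "\<dots> = card D" using fin by (simp add: D_def card_PiE)
  finally have "\<not> inj_on \<phi> D" by (rule pigeonhole)
  then obtain c d where cd: "c \<in> D" "d \<in> D" "\<phi> c = \<phi> d" "c \<noteq> d" by (auto simp: inj_on_def)
  show ?thesis
  proof (intro exI[of _ "\<lambda>v. c v - d v"] conjI ballI)
    show "\<exists>v\<in>V. c v - d v \<noteq> 0"
      using cd PiE_ext[of c V _ d] unfolding D_def by fastforce
    fix k assume k: "k \<in> I"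
    let ?x = "\<lambda>c :: 'v \<Rightarrow> int. (\<Sum>v\<in>V. of_int (c v) * L k v) / \<delta>"
    have "\<lfloor>?x c\<rfloor> = \<lfloor>?x d\<rfloor>" using fun_cong[OF cd(3), of k] k by (simp add: \<phi>_def)
    then have "\<bar>?x c - ?x d\<bar> \<le> 1" by linarith
    moreover have "?x c - ?x d = (\<Sum>v\<in>V. of_int (c v - d v) * L k v) / \<delta>"
      by (simp add: sum_subtractf algebra_simps diff_divide_distrib)
    ultimately show "\<bar>\<Sum>v\<in>V. of_int (c v - d v) * L k v\<bar> \<le> \<delta>"
      using \<open>\<delta> > 0\<close> by (simp add: abs_divide field_simps)
  qed
qed

lemma arch_val_le_iff:
  assumes "\<sigma> \<in> embeddings" "h \<noteq> 0"
  shows "- arch_val \<sigma> h \<le> C \<longleftrightarrow> cmod (\<sigma> h) \<le> exp C"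
proof -
  have "cmod (\<sigma> h) > 0" using embedding_nonzero[OF assms] by simp
  then show ?thesis using assms by (simp add: arch_val_def ln_le_cancel_iff[of _ "exp C", symmetric])
qed

lemma cnj_embedding: "\<sigma> \<in> embeddings \<Longrightarrow> cnj \<circ> \<sigma> \<in> embeddings"
  by (intro embeddingsI) (auto simp: embeddingsD)

context algebraic_field
begin

lemma finite_embeddings: "finite (embeddings :: ('a \<Rightarrow> complex) set)"
  by (rule finite_if_finite_subsets_card_bdd[of _ "card V", THEN conjunct1])
     (auto intro: card_embeddings_le[OF V char_zero])

lemma place_system_number_field:
  assumes bij: "bij_betw p {1..n+1} (places (NumberField :: 'a setting))"
  shows "place_system (NumberField :: 'a setting) n p"
proof -
  let ?K = "NumberField :: 'a setting"
  have int_ring: "int_ring ?K = integral_closure \<int>" by (auto simp: algebraic_int_iff)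
  have "\<forall>i\<in>{1..n+1}. \<exists>\<sigma>\<in>embeddings. p i = arch_val \<sigma>"
    using bij_betw_imp_surj_on[OF bij] by (auto simp: arch_places_def)
  from bchoice[OF this[unfolded Bex_def]]
  obtain \<sigma> where "\<forall>i\<in>{1..n+1}. \<sigma> i \<in> embeddings \<and> p i = arch_val (\<sigma> i)" ..
  then have \<sigma>: "\<And>i. i \<in> {1..n+1} \<Longrightarrow> \<sigma> i \<in> embeddings"
    "\<And>i. i \<in> {1..n+1} \<Longrightarrow> p i = arch_val (\<sigma> i)" by simp_all
  have ex_place: "\<exists>i\<in>{1..n+1}. arch_val \<tau> = p i" if "\<tau> \<in> embeddings" for \<tau> :: "'a \<Rightarrow> complex"
    using bij_betw_imp_surj_on[OF bij] that by (auto simp: arch_places_def image_iff set_eq_iff)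
  have bound: "cmod (\<tau> h) \<le> exp C"
    if \<tau>: "\<tau> \<in> embeddings" and h: "h \<noteq> 0" "\<forall>i\<in>{1..n+1}. - p i h \<le> C" for \<tau> h C
  proof -
    obtain i where "i \<in> {1..n+1}" "arch_val \<tau> = p i" using ex_place[OF \<tau>] by blast
    then show ?thesis using h arch_val_le_iff[OF \<tau> h(1), of C] by auto
  qed
  have max_bound: "cmod (\<tau> h) \<le> (\<Sum>\<tau>\<in>embeddings. cmod (\<tau> h))" if "\<tau> \<in> embeddings" for \<tau> and h :: 'a
    using that finite_embeddings by (intro member_le_sum) auto
  have fin: "finite {h\<in>a. \<forall>\<tau>\<in>embeddings. cmod (\<tau> h) \<le> C}"
    if a: "a \<in> frac_ideals (integral_closure \<int>)" for a :: "'a set" and C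
  proof -
    obtain d where d: "d \<noteq> 0" "\<forall>f\<in>a. d * f \<in> integral_closure \<int>"
      using frac_idealsD(3)[OF a] by blast
    \<comment> \<open>Multiplication by \<open>d\<close> carries the ideal into the integers and
      enlarges absolute values by at most the sum over all embeddings; \<open>max C 0\<close> covers
      a negative bound.\<close>
    define C' where "C' = (\<Sum>\<tau>\<in>embeddings. cmod (\<tau> d)) * max C 0"
    have "(\<lambda>h. d * h) ` {h\<in>a. \<forall>\<tau>\<in>embeddings. cmod (\<tau> h) \<le> C}
      \<subseteq> {z. algebraic_int z \<and> (\<forall>\<tau>\<in>embeddings. cmod (\<tau> z) \<le> C')}"
    proof (clarify, intro conjI ballI)
      fix h assume h: "h \<in> a" "\<forall>\<tau>\<in>embeddings. cmod (\<tau> h) \<le> C"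
      show "algebraic_int (d * h)" using h d by (simp add: algebraic_int_iff)
      fix \<tau> :: "'a \<Rightarrow> complex" assume \<tau>: "\<tau> \<in> embeddings"
      have "cmod (\<tau> d) * cmod (\<tau> h) \<le> (\<Sum>\<tau>\<in>embeddings. cmod (\<tau> d)) * max C 0"
        using h(2) \<tau> max_bound[OF \<tau>] by (intro mult_mono sum_nonneg) (auto simp: le_max_iff_disj)
      then show "cmod (\<tau> (d * h)) \<le> C'" using \<tau> by (simp add: embeddingsD norm_mult C'_def)
    qed
    from finite_subset[OF this finite_bounded_algebraic_ints]
    show ?thesis by (rule finite_imageD) (use d in \<open>auto simp: inj_on_def\<close>)
  qed
  show ?thesis
  proof (rule place_system.intro)
    show "bij_betw p {1..n+1} (places ?K)" by fact
    show "base ?K > 1" by simp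
    show "place_deg ?K (p i) > 0" for i by (simp add: arch_deg_def)
    show "p i (f * g) = p i f + p i g" if "i \<in> {1..n+1}" "f \<noteq> 0" "g \<noteq> 0" for i f g
      using that \<sigma> embedding_nonzero[OF \<sigma>(1)] 
      by (simp add: arch_val_def embeddingsD norm_mult ln_mult)
    show "p i f \<in> val_group ?K" for i f by simp
    show "idom_subring (int_ring ?K)" unfolding int_ring by (rule Ints.idom_subring_integral_closure)
    show "\<exists>b\<in>int_ring ?K - {0}. b * h \<in> int_ring ?K" for h
      using Ints.integral_multiple[OF V, of h] Ints.integral_closure_base unfolding int_ring by blast
  next
    fix a :: "'a set" and \<epsilon> assume a: "a \<in> frac_ideals (int_ring ?K)" and stable: "\<And>x. x \<in> a \<Longrightarrow> \<epsilon> * x \<in> a"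
    note a = a[unfolded int_ring]
    have sub: "submodule_of \<int> a"
      by (rule submodule_of_mono[OF frac_idealsD(1)[OF a]]) (auto intro: Ints.integral_closure_base)
    obtain W where W: "Ints.spans_fractions W" "W \<subseteq> a" using Ints.frac_ideal_basis[OF V a] by blast
    \<comment> \<open>This radius bounds, in every embedding, each combination of \<open>W\<close>
      with rational coefficients of absolute value at most \<open>1\<close>.\<close>
    define C where "C = (\<Sum>v\<in>W. \<Sum>\<tau>\<in>embeddings. cmod (\<tau> v))"
    define T where "T = {h\<in>a. \<forall>\<tau>\<in>embeddings. cmod (\<tau> h) \<le> C}"
    have T: "finite T" "T \<subseteq> a" using fin[OF a] by (auto simp: T_def)
    have "\<exists>l\<in>lspan \<int> W. h - l \<in> lspan \<int> T" if "h \<in> a" for h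
    proof -
      obtain b where b: "b \<in> \<int> - {0}" "b * h \<in> lspan \<int> W"
        using W(1) by (auto simp: Ints.spans_fractions_def)
      obtain m where m: "\<And>v. m v \<in> \<int>" "b * h = (\<Sum>v\<in>W. m v * v)"
        using b(2) by (auto simp: lspan_def)
      then have "\<forall>v. \<exists>k. m v = of_int k" by (metis Ints_cases)
      from choice[OF this] obtain k where k: "\<And>v. m v = of_int (k v)" by auto
      obtain B where B: "b = of_int B" "B \<noteq> 0" using b by (auto elim: Ints_cases)
      \<comment> \<open>The coordinates of \<open>h\<close> are rounded to integers:
        \<open>h - l\<close> has the coordinates \<open>(k v mod B) / B\<close>, of absolute value
        less than \<open>1\<close>.\<close>
      define l where "l = (\<Sum>v\<in>W. of_int (k v div B) * v)"
      have l: "l \<in> lspan \<int> W" by (auto simp: l_def lspan_def)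
      have "l \<in> a" using lspan_subset[OF sub W(2)] l by blast
      have "b * (h - l) = (\<Sum>v\<in>W. m v * v - b * (of_int (k v div B) * v))"
        by (simp add: right_diff_distrib m(2) l_def sum_distrib_left sum_subtractf)
      then have eq: "b * (h - l) = (\<Sum>v\<in>W. of_int (k v mod B) * v)"
        unfolding k B(1) by (simp add: minus_div_mult_eq_mod[symmetric] algebra_simps)
      have "cmod (\<tau> (h - l)) \<le> C" if \<tau>: "\<tau> \<in> embeddings" for \<tau>
      proof -
        have "\<bar>real_of_int B\<bar> * cmod (\<tau> (h - l)) = cmod (\<tau> (b * (h - l)))"
          using \<tau> by (simp add: B embeddingsD embedding_of_int norm_mult)
        also have "\<dots> \<le> (\<Sum>v\<in>W. \<bar>real_of_int (k v mod B)\<bar> * cmod (\<tau> v))"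
          unfolding eq embedding_sum[OF \<tau>]
          by (rule order.trans[OF norm_sum]) (simp add: \<tau> embeddingsD embedding_of_int norm_mult)
        also have "\<dots> \<le> (\<Sum>v\<in>W. \<bar>real_of_int B\<bar> * (\<Sum>\<tau>\<in>embeddings. cmod (\<tau> v)))"
        proof (intro sum_mono mult_mono max_bound[OF \<tau>])
          show "\<bar>real_of_int (k v mod B)\<bar> \<le> \<bar>real_of_int B\<bar>" for v
            using abs_mod_less[OF B(2), of "k v"] by linarith
        qed auto
        also have "\<dots> = \<bar>real_of_int B\<bar> * C" by (simp add: C_def sum_distrib_left)
        finally show ?thesis using B(2) by simp
      qed
      then have "h - l \<in> T"
        using Ints.submodule_diff[OF sub \<open>h \<in> a\<close> \<open>l \<in> a\<close>] by (simp add: T_def)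
      then show ?thesis using l Ints.lspan_incl[OF T(1)] by blast
    qed
    then have "\<epsilon> \<in> integral_closure \<int>"
      using W(1) W(2) T sub frac_idealsD(2)[OF a] stable
      by (intro Ints.unit_if_stable[of W a T]) (auto simp: Ints.spans_fractions_def)
    then show "\<epsilon> \<in> int_ring ?K" unfolding int_ring .
  next
    fix a :: "'a set" and C assume a: "a \<in> frac_ideals (int_ring ?K)"
    show "finite ((\<lambda>h. \<lambda>i\<in>{1..n+1}. p i h) ` {h\<in>a. h \<noteq> 0 \<and> (\<forall>i\<in>{1..n+1}. - p i h \<le> C)})"
      by (rule finite_imageI, rule finite_subset[OF _ fin[OF a[unfolded int_ring], of "exp C"]])
         (use bound in blast)
  next
    fix a :: "'a set" and s :: real assume "a \<in> frac_ideals (int_ring ?K)"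
    note a = this[unfolded int_ring]
    obtain W where W: "Ints.spans_fractions W" "W \<subseteq> a" using Ints.frac_ideal_basis[OF V a] by blast
    obtain U where U: "Ints.spans_fractions U" "U \<subseteq> a"
      "\<And>c v. (\<And>v. c v \<in> \<int>) \<Longrightarrow> (\<Sum>v\<in>U. c v * v) = 0 \<Longrightarrow> v \<in> U \<Longrightarrow> c v = 0"
      using Ints.independent_spanning_set[OF W] by blast
    have finU: "finite U" using U by (simp add: Ints.spans_fractions_def)
    \<comment> \<open>Conjugate embeddings define the same place, so \<open>E\<close> is closed
      under conjugation. At least one embedding is missing from it, which leaves fewer linear forms
      than elements of \<open>U\<close>.\<close>
    define E where "E = {\<tau> \<in> embeddings. arch_val \<tau> \<noteq> p (n + 1)}"
    have "E \<subset> embeddings" using \<sigma>[of "n + 1"] by (auto simp: E_def)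
    then have "card E < card (embeddings :: ('a \<Rightarrow> complex) set)"
      by (rule psubset_card_mono[OF finite_embeddings])
    also have "\<dots> \<le> card U"
      using card_embeddings_le[OF U(1) char_zero finite_embeddings] by simp
    finally have card: "card E < card U" .
    have finE: "finite E" using finite_embeddings by (simp add: E_def)
    define \<delta> where "\<delta> = exp s / 2"
    have "\<delta> > 0" by (simp add: \<delta>_def)
    \<comment> \<open>taken at \<open>\<tau>\<close> and at its conjugate, \<open>L\<close> bounds both the real and the imaginary part\<close>
    define L where "L = (\<lambda>(\<tau> :: 'a \<Rightarrow> complex) v. Re (\<tau> v) + Im (\<tau> v))"
    obtain c where c: "\<exists>v\<in>U. c v \<noteq> 0" "\<And>\<tau>. \<tau> \<in> E \<Longrightarrow> \<bar>\<Sum>v\<in>U. of_int (c v) * L \<tau> v\<bar> \<le> \<delta>"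
      using small_integer_combination[OF finE finU card \<open>\<delta> > 0\<close>, of L] by blast
    define h where "h = (\<Sum>v\<in>U. of_int (c v) * v)"
    have "h \<noteq> 0"
    proof
      assume "h = 0"
      obtain v where v: "v \<in> U" "c v \<noteq> 0" using c(1) by blast
      from U(3)[of "\<lambda>v. of_int (c v)" v] \<open>h = 0\<close> v show False by (simp add: h_def)
    qed
    have "h \<in> a"
      unfolding h_def using U(2) Ints.integral_closure_base[OF Ints_of_int]
      by (intro submodule_of_sum[OF frac_idealsD(1)[OF a]] submodule_ofD(3)[OF frac_idealsD(1)[OF a]]) auto
    have Lh: "\<bar>Re (\<tau> h) + Im (\<tau> h)\<bar> \<le> \<delta>" if "\<tau> \<in> E" for \<tau>
    proof -
      have "\<tau> \<in> embeddings" using that by (simp add: E_def)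
      then have "Re (\<tau> h) + Im (\<tau> h) = (\<Sum>v\<in>U. of_int (c v) * L \<tau> v)"
        by (simp add: h_def embedding_sum embeddingsD embedding_of_int L_def sum.distrib algebra_simps)
      then show ?thesis using c(2)[OF that] by simp
    qed
    have "cmod (\<tau> h) \<le> exp s" if "\<tau> \<in> E" for \<tau>
    proof -
      have "arch_val (cnj \<circ> \<tau>) = arch_val \<tau>" by (auto simp: arch_val_def)
      then have cnj: "cnj \<circ> \<tau> \<in> E" using that by (simp add: E_def cnj_embedding)
      have "\<bar>x\<bar> + \<bar>y\<bar> \<le> d" if "\<bar>x + y\<bar> \<le> d" "\<bar>x - y\<bar> \<le> d" for x y d :: real
        using that by (cases "0 \<le> x"; cases "0 \<le> y") (auto simp: abs_le_iff)
      from this[of "Re (\<tau> h)" "Im (\<tau> h)" \<delta>]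
      have "\<bar>Re (\<tau> h)\<bar> + \<bar>Im (\<tau> h)\<bar> \<le> exp s"
        using Lh[OF cnj] Lh[OF that] \<open>\<delta> > 0\<close> by (simp add: \<delta>_def)
      then show ?thesis using cmod_le[of "\<tau> h"] by linarith
    qed
    moreover have "\<sigma> i \<in> E" if "i \<in> {1..n}" for i
    proof -
      have "p i \<noteq> p (n + 1)"
        using inj_onD[OF bij_betw_imp_inj_on[OF bij], of i "n + 1"] that by auto
      then show ?thesis using that \<sigma>[of i] by (simp add: E_def)
    qed
    ultimately have "- p i h \<le> s" if "i \<in> {1..n}" for i
      using that \<sigma>[of i] arch_val_le_iff[of "\<sigma> i" h s] \<open>h \<noteq> 0\<close> by auto
    then show "\<exists>h\<in>a. h \<noteq> 0 \<and> (\<forall>i\<in>{1..n}. - p i h \<le> s)" using \<open>h \<in> a\<close> \<open>h \<noteq> 0\<close> by blast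
  qed
qed

end

section \<open>Finiteness over \<open>k(x)\<close>\<close>

abbreviation polys_over :: "'a :: idom set \<Rightarrow> 'a poly set"
  where "polys_over k \<equiv> {f. \<forall>i. Polynomial.coeff f i \<in> k}"

lemma K_ring_pow: "x [^]\<^bsub>K_ring\<^esub> (m :: nat) = (x :: 'a :: field) ^ m"
  by (induction m) (simp_all add: mult.commute)

text \<open>Polynomials as coefficient lists have their leading coefficient first, hence the
  reversal.\<close>

lemma eval_K_ring: "K_ring.eval p x = poly (Poly (rev p)) (x :: 'a :: field)"
proof (induction p)
  case (Cons a p)
  have "poly (Poly (rev p @ [a])) x = poly (Poly (rev p)) x + a * x ^ length p"
    by (simp add: Poly_append Poly_snoc poly_monom)
  with Cons show ?case by (simp add: K_ring_pow)
qed simp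

lemma transcendental_poly:
  assumes "K_ring.transcendental k (x :: 'a :: field)" "f \<in> polys_over k" "poly f x = 0"
  shows "f = 0"
proof (rule ccontr)
  assume "f \<noteq> 0"
  have "set (coeffs f) \<subseteq> k" using assms(2) by (auto simp: coeffs_def)
  then have "rev (coeffs f) \<in> carrier (univ_poly K_ring k)"
    using \<open>f \<noteq> 0\<close> hd_rev[of "coeffs f"]
    by (simp add: univ_poly_carrier[symmetric] polynomial_def last_coeffs_eq_coeff_degree)
  moreover have "[] \<in> carrier (univ_poly K_ring k)"
    by (simp add: univ_poly_carrier[symmetric] polynomial_def)
  moreover have "K_ring.eval (rev (coeffs f)) x = K_ring.eval [] x"
    using assms(3) by (simp add: eval_K_ring)
  ultimately have "rev (coeffs f) = []"
    using assms(1) unfolding K_ring.transcendental_def inj_on_def by blast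
  with \<open>f \<noteq> 0\<close> show False by simp
qed

lemma (in field_subring) idom_subring_polys_over: "idom_subring (polys_over A)"
  by (rule idom_subring_coeffs) (rule idom_subring_axioms)

lemma (in field_subring) polys_over_pCons: "pCons a f \<in> polys_over A \<longleftrightarrow> a \<in> A \<and> f \<in> polys_over A"
  by (auto simp: coeff_pCons split: nat.splits elim: allE[of _ 0] allE[of _ "Suc _"])

lemma (in field_subring) polys_over_monom: "a \<in> A \<Longrightarrow> Polynomial.monom a m \<in> polys_over A"
  by (auto simp: zero_closed)

lemma (in field_subring) simple_extension_eq:
  "K_ring.simple_extension A x = {poly f x | f. f \<in> polys_over A}"
proof (intro equalityI subsetI)
  fix z assume "z \<in> K_ring.simple_extension A x"
  then show "z \<in> {poly f x | f. f \<in> polys_over A}"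
  proof induction
    case zero
    then show ?case by (auto intro!: exI[of _ 0] simp: zero_closed)
  next
    case (lin a b)
    then obtain f where "f \<in> polys_over A" "a = poly f x" by blast
    with lin(2) show ?case
      using polys_over_pCons[of b f] by (intro CollectI exI[of _ "pCons b f"]) (simp add: algebra_simps)
  qed
next
  fix z assume "z \<in> {poly f x | f. f \<in> polys_over A}"
  then obtain f where f: "f \<in> polys_over A" "z = poly f x" by blast
  from f(1) have "poly f x \<in> K_ring.simple_extension A x"
  proof (induction f)
    case 0
    then show ?case using K_ring.simple_extension.zero[of A x] by simp
  next
    case (pCons a f)
    then have "poly f x \<in> K_ring.simple_extension A x" "a \<in> A" using polys_over_pCons by auto
    from K_ring.simple_extension.lin[OF this] show ?case by (simp add: algebra_simps)
  qed
  with f(2) show "z \<in> K_ring.simple_extension A x" by simp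
qed

lemma (in field_subring) poly_values_subring: "field_subring {poly f x | f. f \<in> polys_over A}"
proof -
  interpret P: idom_subring "polys_over A" by (rule idom_subring_polys_over)
  have mem: "poly f x \<in> {poly f x | f. f \<in> polys_over A}" if "f \<in> polys_over A" for f
    using that by blast
  show ?thesis
  proof
    show "0 \<in> {poly f x | f. f \<in> polys_over A}" using mem[OF P.zero_closed] by simp
    show "1 \<in> {poly f x | f. f \<in> polys_over A}" using mem[OF P.one_closed] by simp
  next
    fix y z assume "y \<in> {poly f x | f. f \<in> polys_over A}" "z \<in> {poly f x | f. f \<in> polys_over A}"
    then obtain f g where "f \<in> polys_over A" "g \<in> polys_over A" "y = poly f x" "z = poly g x" by blast
    then show "y + z \<in> {poly f x | f. f \<in> polys_over A}" "y * z \<in> {poly f x | f. f \<in> polys_over A}"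
      using mem[OF P.add_closed] mem[OF P.mult_closed] by simp_all
  next
    fix y assume "y \<in> {poly f x | f. f \<in> polys_over A}"
    then obtain f where "f \<in> polys_over A" "y = poly f x" by blast
    then show "- y \<in> {poly f x | f. f \<in> polys_over A}"
      using mem[OF P.minus_closed] by simp
  qed
qed

locale subfield_set = field_subring k for k :: "'a :: field set" +
  assumes inverse_closed: "c \<in> k \<Longrightarrow> inverse c \<in> k"

lemma subfield_set_if_subfield: "subfield k K_ring \<Longrightarrow> subfield_set k"
  using subfield_K_ringD by (auto simp: subfield_set_def subfield_set_axioms_def)

context subfield_set
begin

lemma divide_closed: "c \<in> k \<Longrightarrow> d \<in> k \<Longrightarrow> c / d \<in> k"
  unfolding divide_inverse by (intro mult_closed inverse_closed)

lemma subfield: "subfield k K_ring"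
  by (intro subfield_K_ringI idom_subring_axioms inverse_closed)

lemma poly_values_generate:
  "{poly f x | f. f \<in> polys_over k} \<subseteq> generate_field K_ring (insert x k)"
proof clarify
  fix f assume "\<forall>i. Polynomial.coeff f i \<in> k"
  interpret F: field_subring "generate_field K_ring (insert x k)"
    using subfield_K_ringD(1)[OF field.generate_field_is_subfield[OF field_K_ring]] by simp
  show "poly f x \<in> generate_field K_ring (insert x k)"
    using \<open>\<forall>i. Polynomial.coeff f i \<in> k\<close>
    by (intro F.poly_closed) (auto intro: generate_field.incl)
qed

lemma generate_field_fractions:
  "generate_field K_ring (insert x k) \<subseteq>
    {a / b | a b. a \<in> {poly f x | f. f \<in> polys_over k} \<and> b \<in> {poly f x | f. f \<in> polys_over k} \<and> b \<noteq> 0}"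
    (is "_ \<subseteq> ?F")
proof (rule field.generate_field_min_subfield1[OF field_K_ring])
  interpret A: field_subring "{poly f x | f. f \<in> polys_over k}" by (rule poly_values_subring)
  show "subfield ?F K_ring" by (rule A.subfield_fractions)
  have "insert x k \<subseteq> {poly f x | f. f \<in> polys_over k}"
  proof clarify
    fix z assume "z \<in> insert x k"
    then have "\<exists>f\<in>polys_over k. z = poly f x"
    proof
      assume "z = x"
      then show ?thesis
        using polys_over_monom[OF one_closed, of 1] by (intro bexI[of _ "Polynomial.monom 1 1"]) (simp_all add: poly_monom)
    next
      assume "z \<in> k"
      then show ?thesis
        using polys_over_monom[of z 0] by (intro bexI[of _ "Polynomial.monom z 0"]) (simp_all add: poly_monom)
    qed
    then show "\<exists>f. z = poly f x \<and> f \<in> polys_over k" by blast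
  qed
  moreover have "y / 1 \<in> ?F" if "y \<in> {poly f x | f. f \<in> polys_over k}" for y
    using that A.one_closed one_neq_zero by blast
  ultimately show "insert x k \<subseteq> ?F" by auto
qed auto

lemma spans_fractions_poly_values:
  assumes "K_ring.finite_dimension (generate_field K_ring (insert x k)) UNIV"
  shows "\<exists>V. idom_subring.spans_fractions {poly f x | f. f \<in> polys_over k} V"
proof -
  interpret A: field_subring "{poly f x | f. f \<in> polys_over k}" by (rule poly_values_subring)
  show ?thesis
    by (rule A.spans_fractions_if_finite_dimension[OF _ generate_field_fractions assms])
       (rule field.generate_field_is_subfield[OF field_K_ring], simp)
qed

text \<open>\<open>K\<close> is finite over \<open>k(y)\<close> for some \<open>y\<close>; a relation between the powers of \<open>x\<close> over \<open>k[y]\<close>,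
  read as a polynomial in \<open>y\<close>, shows that \<open>y\<close> is algebraic over \<open>k(x)\<close>.\<close>

lemma finite_over_transcendental:
  assumes fin: "K_ring.finite_dimension (generate_field K_ring (insert y k)) UNIV"
    and x: "K_ring.transcendental k x"
  shows "K_ring.finite_dimension (generate_field K_ring (insert x k)) UNIV"
proof -
  let ?F = "generate_field K_ring (insert x k)" and ?A = "{poly f y | f. f \<in> polys_over k}"
  have F: "subfield ?F K_ring" by (rule field.generate_field_is_subfield[OF field_K_ring]) simp
  interpret F: field_subring ?F by (rule subfield_K_ringD(1)[OF F])
  interpret A: field_subring ?A by (rule poly_values_subring)
  obtain V where V: "A.spans_fractions V" using spans_fractions_poly_values[OF fin] by blast
  obtain c where c: "\<forall>i. c i \<in> ?A" "\<exists>i\<in>{..card V}. c i \<noteq> 0" "(\<Sum>i\<in>{..card V}. c i * x ^ i) = 0"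
    using A.spans_fractions_dependent[OF V, of "{..card V}" "\<lambda>i. x ^ i"] by auto
  then have "\<forall>i. \<exists>f. f \<in> polys_over k \<and> c i = poly f y" by blast
  from choice[OF this] obtain g where g: "\<And>i. g i \<in> polys_over k" "\<And>i. c i = poly (g i) y" by blast
  define Q where "Q = (\<Sum>i\<le>card V. Polynomial.smult (x ^ i) (g i))"
  have "poly Q y = 0" using c(3) by (simp add: Q_def poly_sum g(2) mult.commute)
  have coeff_Q: "Polynomial.coeff Q j = poly (\<Sum>i\<le>card V. Polynomial.monom (Polynomial.coeff (g i) j) i) x" for j
    by (simp add: Q_def coeff_sum poly_sum poly_monom mult.commute)
  interpret P: idom_subring "polys_over k" by (rule idom_subring_polys_over)
  have over: "(\<Sum>i\<le>card V. Polynomial.monom (Polynomial.coeff (g i) j) i) \<in> polys_over k" for j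
    using g(1) by (intro P.sum_closed polys_over_monom) blast
  \<comment> \<open>Transcendence of \<open>x\<close> enters here: a coefficient of \<open>Q\<close>
    is a polynomial in \<open>x\<close> and vanishes only if all \<open>g i\<close> have coefficient
    \<open>0\<close> at that power of \<open>y\<close>.\<close>
  have "Q \<noteq> 0"
  proof
    assume "Q = 0"
    obtain i where i: "i \<le> card V" "c i \<noteq> 0" using c(2) by auto
    then have "g i \<noteq> 0" using g(2)[of i] by auto
    then obtain j where j: "Polynomial.coeff (g i) j \<noteq> 0" by (metis leading_coeff_0_iff)
    have "(\<Sum>i\<le>card V. Polynomial.monom (Polynomial.coeff (g i) j) i) = 0"
      using coeff_Q[of j] \<open>Q = 0\<close> by (intro transcendental_poly[OF x over]) simp
    then have "Polynomial.coeff (\<Sum>i\<le>card V. Polynomial.monom (Polynomial.coeff (g i) j) i) i = 0" by simp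
    with i j show False by (simp add: coeff_sum)
  qed
  have "Polynomial.coeff Q j \<in> ?F" for j
    unfolding coeff_Q using poly_values_generate[of x] over[of j] by blast
  then have "Q \<in> polys_over ?F" by simp
  with \<open>Q \<noteq> 0\<close> \<open>poly Q y = 0\<close> have alg: "K_ring.algebraic ?F y"
    using transcendental_poly by blast
  let ?E = "K_ring.simple_extension ?F y"
  have domain: "domain (K_ring :: 'a ring)" by (rule field.axioms(1)[OF field_K_ring])
  have E: "subfield ?E K_ring"
    using domain.simple_extension_is_subfield[OF domain F, of y] alg by (simp add: over_def)
  have finE: "K_ring.finite_dimension ?F ?E"
    using domain.finite_dimension_simple_extension[OF domain F, of y] alg by (simp add: over_def)
  \<comment> \<open>The field \<open>k(x, y)\<close> is finite over \<open>k(x)\<close> and contains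
    \<open>k(y)\<close>, so a basis of \<open>K\<close> over \<open>k(y)\<close> also spans
    \<open>K\<close> over \<open>k(x, y)\<close>; the tower then gives the claim.\<close>
  have "generate_field K_ring (insert y k) \<subseteq> ?E"
  proof (rule field.generate_field_min_subfield1[OF field_K_ring _ E])
    have "k \<subseteq> ?F" by (auto intro: generate_field.incl)
    moreover have "?F \<subseteq> ?E" by (rule K_ring.simple_extension_incl) auto
    moreover have "y \<in> ?E" using K_ring.simple_extension_mem[OF subfieldE(1)[OF F], of y] by simp
    ultimately show "insert y k \<subseteq> ?E" by blast
  qed simp
  moreover have Fy: "subfield (generate_field K_ring (insert y k)) K_ring"
    by (rule field.generate_field_is_subfield[OF field_K_ring]) simp
  obtain m where "K_ring.dimension m (generate_field K_ring (insert y k)) UNIV"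
    using fin by (rule K_ring.finite_dimensionE')
  then obtain Vs where Vs: "K_ring.Span (generate_field K_ring (insert y k)) Vs = UNIV"
    using K_ring.exists_base[OF Fy] by metis
  ultimately have "h \<in> K_ring.Span ?E Vs" for h
    using K_ring.Span_mem_iff_length_version[OF Fy, of Vs h] K_ring.Span_mem_iff_length_version[OF E, of Vs h]
    by auto
  then have "K_ring.Span ?E Vs = UNIV" by blast
  with K_ring.Span_finite_dimension[OF E, of Vs] have "K_ring.finite_dimension ?E UNIV" by simp
  then show ?thesis by (rule K_ring.telescopic_base_dim(1)[OF F E finE])
qed

end

text \<open>The hypotheses restated with polynomials over the whole field type whose coefficients
  lie in \<open>k\<close>. Finiteness is required over \<open>k(x)\<close> for the given
  \<open>x\<close>, not over \<open>k(y)\<close> for some \<open>y\<close>.\<close>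

locale function_field = subfield_set k for k :: "'a :: field set" +
  fixes x :: 'a
  assumes constants: "f \<in> polys_over k \<Longrightarrow> f \<noteq> 0 \<Longrightarrow> poly f z = 0 \<Longrightarrow> z \<in> k"
    and transcendental: "f \<in> polys_over k \<Longrightarrow> poly f x = 0 \<Longrightarrow> f = 0"
    and finite_over: "K_ring.finite_dimension (generate_field K_ring (insert x k)) UNIV"

lemma function_field_if_valid:
  assumes "is_function_field k" "K_ring.transcendental k x"
  shows "function_field k x"
proof -
  interpret subfield_set k using assms(1) by (intro subfield_set_if_subfield) (simp add: is_function_field_def)
  show ?thesis
  proof
    show "z \<in> k" if "f \<in> polys_over k" "f \<noteq> 0" "poly f z = 0" for f z
      using assms(1) transcendental_poly[OF _ that(1,3)] that(2) unfolding is_function_field_def by blast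
    show "f = 0" if "f \<in> polys_over k" "poly f x = 0" for f
      using transcendental_poly[OF assms(2) that] .
    show "K_ring.finite_dimension (generate_field K_ring (insert x k)) UNIV"
      using assms finite_over_transcendental unfolding is_function_field_def by blast
  qed
qed

section \<open>Existence of places\<close>

lemma integral_closure_mono: "A \<subseteq> B \<Longrightarrow> integral_closure A \<subseteq> integral_closure B"
  unfolding integral_closure_def by blast

locale valuation_ring = field_subring V for V :: "'a :: field set" +
  assumes dichotomy: "y \<noteq> 0 \<Longrightarrow> y \<in> V \<or> inverse y \<in> V"
begin

definition nonunits :: "'a set"
  where "nonunits = {t \<in> V. t = 0 \<or> inverse t \<notin> V}"

lemma nonunits_mult: assumes "z \<in> V" "t \<in> nonunits" shows "z * t \<in> nonunits"
proof -
  have "z * t = 0" if "inverse (z * t) \<in> V"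
  proof (rule ccontr)
    assume "z * t \<noteq> 0"
    then have "inverse t = z * inverse (z * t)" by (simp add: field_simps)
    then have "inverse t \<in> V" using mult_closed[OF assms(1) that] by metis
    with assms(2) \<open>z * t \<noteq> 0\<close> show False by (simp add: nonunits_def)
  qed
  then show ?thesis using assms mult_closed by (auto simp: nonunits_def)
qed

text \<open>One of the two quotients lies in \<open>V\<close>, so the sum is a multiple of one of
  the summands.\<close>

lemma nonunits_add: assumes "s \<in> nonunits" "t \<in> nonunits" shows "s + t \<in> nonunits"
proof (cases "s = 0 \<or> t = 0")
  case False
  then have "s / t \<in> V \<or> t / s \<in> V" using dichotomy[of "s / t"] by auto
  then show ?thesis
  proof
    assume "s / t \<in> V"
    then have "(s / t + 1) * t \<in> nonunits" by (intro nonunits_mult add_closed one_closed assms)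
    then show ?thesis using False by (simp add: field_simps)
  next
    assume "t / s \<in> V"
    then have "(t / s + 1) * s \<in> nonunits" by (intro nonunits_mult add_closed one_closed assms)
    then show ?thesis using False by (simp add: field_simps)
  qed
qed (use assms in auto)

lemma nonunits_sum: "(\<And>i. i \<in> I \<Longrightarrow> f i \<in> nonunits) \<Longrightarrow> sum f I \<in> nonunits"
  by (induction I rule: infinite_finite_induct)
     (auto simp: nonunits_add nonunits_def[THEN eqset_imp_iff, of 0] zero_closed)

lemma nonunits_minus: "t \<in> nonunits \<Longrightarrow> - t \<in> nonunits"
  using nonunits_mult[OF minus_closed[OF one_closed], of t] by simp

lemma one_not_nonunit: "1 \<notin> nonunits"
  by (simp add: nonunits_def one_closed)

text \<open>If \<open>z\<close> is outside \<open>V\<close>, its inverse is inside. Multiplying the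
  integral equation, of degree \<open>m + 1\<close>, by \<open>inverse z ^ m\<close> expresses
  \<open>z\<close> through powers of the inverse.\<close>

lemma integrally_closed: assumes "z \<in> integral_closure V" shows "z \<in> V"
proof (rule ccontr)
  assume "z \<notin> V"
  then have "z \<noteq> 0" using zero_closed by auto
  define u where "u = inverse z"
  have u: "u \<in> V" using dichotomy[OF \<open>z \<noteq> 0\<close>] \<open>z \<notin> V\<close> by (simp add: u_def)
  obtain f where f: "Polynomial.lead_coeff f = 1" "\<And>i. Polynomial.coeff f i \<in> V" "poly f z = 0"
    using assms by (auto simp: integral_closure_def)
  obtain m where m: "Polynomial.degree f = Suc m"
    using f(1,3) by (cases "Polynomial.degree f") (auto elim!: degree_eq_zeroE)
  have "0 = u ^ m * poly f z" using f(3) by simp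
  also have "\<dots> = (\<Sum>i\<le>Suc m. Polynomial.coeff f i * (u ^ m * z ^ i))"
    by (simp add: poly_altdef m sum_distrib_left mult_ac del: sum.atMost_Suc)
  also have "\<dots> = u ^ m * z ^ Suc m + (\<Sum>i\<le>m. Polynomial.coeff f i * (u ^ m * z ^ i))"
    using f(1) m by simp
  also have "(\<Sum>i\<le>m. Polynomial.coeff f i * (u ^ m * z ^ i)) = (\<Sum>i\<le>m. Polynomial.coeff f i * u ^ (m - i))"
    using \<open>z \<noteq> 0\<close> by (intro sum.cong) (auto simp: u_def power_diff field_simps)
  also have "u ^ m * z ^ Suc m = z" using \<open>z \<noteq> 0\<close> by (simp add: u_def field_simps)
  finally have "z = - (\<Sum>i\<le>m. Polynomial.coeff f i * u ^ (m - i))" by (simp add: eq_neg_iff_add_eq_0)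
  also have "\<dots> \<in> V" by (intro minus_closed sum_closed mult_closed power_closed f u)
  finally show False using \<open>z \<notin> V\<close> by simp
qed

end

section \<open>Valuation rings as maximal subrings omitting an inverse\<close>

context
  fixes V :: "'a :: field set" and u :: 'a
  assumes V: "field_subring V" and u: "u \<in> V" "u \<noteq> 0" "inverse u \<notin> V"
    and max: "\<And>W. field_subring W \<Longrightarrow> V \<subseteq> W \<Longrightarrow> inverse u \<notin> W \<Longrightarrow> W \<subseteq> V"
begin

interpretation V: field_subring V by (rule V)

lemma maximal_adjoin:
  assumes "s \<notin> V" shows "\<exists>f\<in>polys_over V. inverse u = poly f s"
proof (rule ccontr)
  assume no: "\<not> ?thesis"
  let ?W = "{poly f s | f. f \<in> polys_over V}"
  have "V \<subseteq> ?W"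
  proof
    fix v assume "v \<in> V"
    then have "Polynomial.monom v 0 \<in> polys_over V" by (rule V.polys_over_monom)
    then show "v \<in> ?W" by (intro CollectI exI[of _ "Polynomial.monom v 0"]) (simp add: poly_monom)
  qed
  then have "?W \<subseteq> V" using no by (intro max V.poly_values_subring) blast+
  moreover have "s \<in> ?W"
    using V.polys_over_monom[OF V.one_closed, of 1]
    by (intro CollectI exI[of _ "Polynomial.monom 1 1"]) (simp add: poly_monom)
  ultimately show False using assms by blast
qed

text \<open>This puts \<open>u\<close> into the Jacobson radical. If the inverse of
  \<open>w = 1 - u * b\<close> were outside \<open>V\<close>, adjoining it would produce
  \<open>inverse u\<close> as a polynomial in \<open>inverse w\<close>. Multiplying by a power of
  \<open>w\<close>, which is \<open>1\<close> modulo \<open>u\<close>, then brings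
  \<open>inverse u\<close> into \<open>V\<close>.\<close>

lemma maximal_local:
  assumes b: "b \<in> V"
  shows "1 - u * b \<noteq> 0" "inverse (1 - u * b) \<in> V"
proof -
  let ?w = "1 - u * b"
  show w: "?w \<noteq> 0"
  proof
    assume "?w = 0"
    then have "inverse u = b" using u by (simp add: field_simps)
    with b u show False by simp
  qed
  have w_in: "?w \<in> V" by (intro V.diff_closed V.one_closed V.mult_closed u b)
  have pow: "\<exists>b'\<in>V. ?w ^ m = 1 - u * b'" for m
  proof (induction m)
    case (Suc m)
    then obtain b' where b': "b' \<in> V" "?w ^ m = 1 - u * b'" by blast
    have "?w ^ Suc m = ?w * (1 - u * b')" by (simp add: b')
    then have "?w ^ Suc m = 1 - u * (b + b' * ?w)" by (simp add: algebra_simps)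
    moreover have "b + b' * ?w \<in> V" by (intro V.add_closed V.mult_closed b b' w_in)
    ultimately show ?case by blast
  qed (use V.zero_closed in \<open>auto intro!: bexI[of _ 0]\<close>)
  show "inverse ?w \<in> V"
  proof (rule ccontr)
    assume "inverse ?w \<notin> V"
    then obtain f where f: "f \<in> polys_over V" "inverse u = poly f (inverse ?w)"
      using maximal_adjoin by blast
    define m where "m = Polynomial.degree f"
    obtain b' where b': "b' \<in> V" "?w ^ m = 1 - u * b'" using pow by blast
    have "inverse u * ?w ^ m = (\<Sum>i\<le>m. Polynomial.coeff f i * (inverse ?w ^ i * ?w ^ m))"
      unfolding f(2) poly_altdef sum_distrib_right m_def by (simp add: mult.assoc)
    also have "\<dots> = (\<Sum>i\<le>m. Polynomial.coeff f i * ?w ^ (m - i))"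
      using w by (intro sum.cong) (auto simp: power_diff power_inverse field_simps)
    also have "\<dots> \<in> V" using f(1) by (intro V.sum_closed V.mult_closed V.power_closed w_in) auto
    finally have "inverse u * ?w ^ m + b' \<in> V" using b'(1) by (rule V.add_closed)
    moreover have "inverse u * ?w ^ m + b' = inverse u"
      unfolding b'(2) using u(2) by (simp add: right_diff_distrib mult.assoc[symmetric])
    ultimately show False using u by simp
  qed
qed

text \<open>As \<open>1 - u g(0)\<close> is a unit, the relation \<open>g(z) = 1 / u\<close> expresses \<open>y ^ n\<close> by lower powers of \<open>y\<close>.\<close>

lemma maximal_descent:
  assumes yz: "y * z = 1" and f: "f \<in> polys_over V" "poly f y = inverse u"
    and g: "g \<in> polys_over V" "poly g z = inverse u" and deg: "Polynomial.degree g \<le> Polynomial.degree f"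
  shows "\<exists>f'\<in>polys_over V. poly f' y = inverse u \<and> Polynomial.degree f' < Polynomial.degree f"
proof -
  interpret P: idom_subring "polys_over V" by (rule V.idom_subring_polys_over)
  define n where "n = Polynomial.degree f"
  define m where "m = Polynomial.degree g"
  have "m > 0"
  proof (rule Nat.gr0I)
    assume "m = 0"
    then have "inverse u = Polynomial.coeff g 0" using g by (auto simp: m_def elim!: degree_eq_zeroE)
    with g(1) u show False by auto
  qed
  then have "n > 0" using deg by (simp add: n_def m_def)
  define s where "s = inverse (1 - u * Polynomial.coeff g 0)"
  have "Polynomial.coeff g 0 \<in> V" using g(1) by simp
  note loc = maximal_local[OF this]
  then have s: "s \<in> V" "s * (1 - u * Polynomial.coeff g 0) = 1" by (simp_all add: s_def)
  define e where "e = (\<lambda>j. Polynomial.lead_coeff f * s * u * Polynomial.coeff g j)"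
  have e: "e j \<in> V" for j unfolding e_def using f g s u by (intro V.mult_closed) auto
  have "{..m} = insert 0 {1..m}" by auto
  then have "inverse u = Polynomial.coeff g 0 + (\<Sum>j=1..m. Polynomial.coeff g j * z ^ j)"
    using g(2) by (simp add: poly_altdef m_def)
  then have "u * inverse u = u * (Polynomial.coeff g 0 + (\<Sum>j=1..m. Polynomial.coeff g j * z ^ j))" by simp
  then have "1 - u * Polynomial.coeff g 0 = u * (\<Sum>j=1..m. Polynomial.coeff g j * z ^ j)"
    using u(2) by (simp add: algebra_simps)
  then have one: "s * u * (\<Sum>j=1..m. Polynomial.coeff g j * z ^ j) = 1"
    using s(2) by (simp add: mult.assoc)
  have "Polynomial.lead_coeff f * y ^ n = Polynomial.lead_coeff f * y ^ n * (s * u * (\<Sum>j=1..m. Polynomial.coeff g j * z ^ j))"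
    unfolding one by simp
  also have "\<dots> = (\<Sum>j=1..m. e j * (y ^ n * z ^ j))"
    by (simp add: e_def sum_distrib_left mult_ac)
  also have "\<dots> = (\<Sum>j=1..m. e j * y ^ (n - j))"
  proof (intro sum.cong refl)
    fix j assume "j \<in> {1..m}"
    then have "y ^ n = y ^ (n - j) * y ^ j" using deg by (simp add: n_def m_def flip: power_add)
    then have "y ^ n * z ^ j = y ^ (n - j) * (y * z) ^ j" by (simp add: power_mult_distrib mult_ac)
    then show "e j * (y ^ n * z ^ j) = e j * y ^ (n - j)" by (simp add: yz)
  qed
  finally have lead: "Polynomial.lead_coeff f * y ^ n = (\<Sum>j=1..m. e j * y ^ (n - j))" .
  define f' where "f' = f - Polynomial.monom (Polynomial.lead_coeff f) n + (\<Sum>j=1..m. Polynomial.monom (e j) (n - j))"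
  have "f' \<in> polys_over V"
    unfolding f'_def using f(1) e
    by (intro P.add_closed P.diff_closed P.sum_closed V.polys_over_monom) auto
  moreover have "poly f' y = inverse u"
    using lead f(2) by (simp add: f'_def poly_monom poly_sum)
  moreover have "Polynomial.degree f' < n"
  proof (rule degree_lessI)
    show "f' \<noteq> 0 \<or> n > 0" using \<open>n > 0\<close> by simp
    show "\<forall>i\<ge>n. Polynomial.coeff f' i = 0"
    proof (intro allI impI)
      fix i assume i: "n \<le> i"
      have "(\<Sum>j=1..m. Polynomial.coeff (Polynomial.monom (e j) (n - j)) i) = 0"
        using i \<open>n > 0\<close> by (intro sum.neutral) auto
      then show "Polynomial.coeff f' i = 0"
        using i by (cases "i = n") (auto simp: f'_def coeff_sum n_def coeff_eq_0)
    qed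
  qed
  ultimately show ?thesis unfolding n_def by blast
qed

text \<open>If \<open>y\<close> and its inverse were both outside \<open>V\<close>, each would
  satisfy a relation of least degree, and the longer one could be shortened with the help of the
  other.\<close>

lemma valuation_ring_if_maximal: "valuation_ring V"
proof
  fix y :: 'a assume "y \<noteq> 0"
  show "y \<in> V \<or> inverse y \<in> V"
  proof (rule ccontr)
    assume "\<not> (y \<in> V \<or> inverse y \<in> V)"
    then have no: "y \<notin> V" "inverse y \<notin> V" by auto
    have least: "\<exists>f. (f \<in> polys_over V \<and> poly f s = inverse u) \<and>
      (\<forall>g. g \<in> polys_over V \<and> poly g s = inverse u \<longrightarrow> Polynomial.degree f \<le> Polynomial.degree g)"
      if s: "s \<notin> V" for s
    proof -
      obtain f0 where f0: "f0 \<in> polys_over V \<and> poly f0 s = inverse u" using maximal_adjoin[OF s] by auto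
      from ex_has_least_nat[where P = "\<lambda>f. f \<in> polys_over V \<and> poly f s = inverse u"
          and m = Polynomial.degree, OF f0] show ?thesis .
    qed
    from least[OF no(1)] obtain f where f: "(f \<in> polys_over V \<and> poly f y = inverse u) \<and>
      (\<forall>g. g \<in> polys_over V \<and> poly g y = inverse u \<longrightarrow> Polynomial.degree f \<le> Polynomial.degree g)" ..
    from least[OF no(2)] obtain g where g: "(g \<in> polys_over V \<and> poly g (inverse y) = inverse u) \<and>
      (\<forall>f. f \<in> polys_over V \<and> poly f (inverse y) = inverse u \<longrightarrow> Polynomial.degree g \<le> Polynomial.degree f)" ..
    show False
    proof (cases "Polynomial.degree g \<le> Polynomial.degree f")
      case True
      have "\<exists>f'\<in>polys_over V. poly f' y = inverse u \<and> Polynomial.degree f' < Polynomial.degree f"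
        using f g \<open>y \<noteq> 0\<close> True by (intro maximal_descent[of y "inverse y" f g]) simp_all
      with f show False by (metis not_le)
    next
      case False
      have "\<exists>g'\<in>polys_over V. poly g' (inverse y) = inverse u \<and> Polynomial.degree g' < Polynomial.degree g"
        using f g \<open>y \<noteq> 0\<close> False by (intro maximal_descent[of "inverse y" y g f]) simp_all
      with g show False by (metis not_le)
    qed
  qed
qed

end

text \<open>Zorn's lemma applies because the union of a chain of subrings omits
  \<open>inverse u\<close> if all members do.\<close>

lemma valuation_ring_exists:
  assumes R: "field_subring R" "u \<in> R" "u \<noteq> 0" "inverse u \<notin> R"
  shows "\<exists>V. valuation_ring V \<and> R \<subseteq> V \<and> inverse u \<notin> V"
proof -
  define S where "S = {V. field_subring V \<and> R \<subseteq> V \<and> inverse u \<notin> V}"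
  have "\<exists>M\<in>S. \<forall>Y\<in>S. M \<subseteq> Y \<longrightarrow> Y = M"
  proof (rule subset_Zorn_nonempty)
    show "S \<noteq> {}" using R by (auto simp: S_def)
    fix C assume C: "C \<noteq> {}" "subset.chain S C"
    then have CS: "C \<subseteq> S" by (auto simp: subset.chain_def)
    have lin: "H \<subseteq> H' \<or> H' \<subseteq> H" if "H \<in> C" "H' \<in> C" for H H'
      using C(2) that unfolding subset.chain_def by blast
    have fs: "idom_subring H" if "H \<in> C" for H using CS that by (auto simp: S_def field_subring_def)
    obtain H0 where H0: "H0 \<in> C" using C by blast
    have "idom_subring (\<Union>C)"
    proof
      show "0 \<in> \<Union>C" using idom_subring.zero_closed[OF fs[OF H0]] H0 by blast
      show "1 \<in> \<Union>C" using idom_subring.one_closed[OF fs[OF H0]] H0 by blast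
    next
      fix a b assume "a \<in> \<Union>C" "b \<in> \<Union>C"
      then obtain H where H: "H \<in> C" "a \<in> H" "b \<in> H" using lin by blast
      show "a + b \<in> \<Union>C" using idom_subring.add_closed[OF fs[OF H(1)] H(2,3)] H(1) by blast
      show "a * b \<in> \<Union>C" using idom_subring.mult_closed[OF fs[OF H(1)] H(2,3)] H(1) by blast
    next
      fix a assume "a \<in> \<Union>C"
      then obtain H where H: "H \<in> C" "a \<in> H" by blast
      show "- a \<in> \<Union>C" using idom_subring.minus_closed[OF fs[OF H(1)] H(2)] H(1) by blast
    qed
    then show "\<Union>C \<in> S" using C CS by (auto simp: S_def field_subring_def)
  qed
  then obtain M where M: "M \<in> S" "\<forall>Y\<in>S. M \<subseteq> Y \<longrightarrow> Y = M" by blast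
  have "valuation_ring M"
  proof (rule valuation_ring_if_maximal)
    show "field_subring M" "u \<in> M" "u \<noteq> 0" "inverse u \<notin> M" using M(1) R by (auto simp: S_def)
    show "W \<subseteq> M" if "field_subring W" "M \<subseteq> W" "inverse u \<notin> W" for W
      using M that by (auto simp: S_def)
  qed
  with M(1) show ?thesis by (auto simp: S_def)
qed

section \<open>Comparison of values\<close>

context valuation_ring
begin

text \<open>Equality in the value group: \<open>a / b\<close> is a unit of \<open>V\<close>. The
  relation spares the construction of that group.\<close>

definition same_value :: "'a \<Rightarrow> 'a \<Rightarrow> bool"
  where "same_value a b \<longleftrightarrow> a \<noteq> 0 \<and> b \<noteq> 0 \<and> a / b \<in> V \<and> b / a \<in> V"

lemma same_value_refl: "a \<noteq> 0 \<Longrightarrow> same_value a a"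
  by (simp add: same_value_def one_closed)

lemma same_value_sym: "same_value a b \<Longrightarrow> same_value b a"
  by (auto simp: same_value_def)

lemma same_value_trans: assumes "same_value a b" "same_value b c" shows "same_value a c"
proof -
  have "(a / b) * (b / c) \<in> V" "(c / b) * (b / a) \<in> V"
    using assms by (auto simp only: same_value_def intro: mult_closed)
  then show ?thesis using assms by (simp add: same_value_def)
qed

lemma same_value_mult: assumes "same_value a b" "same_value c d" shows "same_value (a * c) (b * d)"
  using assms mult_closed[of "a / b" "c / d"] mult_closed[of "b / a" "d / c"]
  by (auto simp: same_value_def)

lemma same_value_inverse: "same_value a b \<Longrightarrow> same_value (inverse a) (inverse b)"
  by (auto simp: same_value_def field_simps)

lemma same_value_divide: "same_value a b \<Longrightarrow> same_value c d \<Longrightarrow> same_value (a / c) (b / d)"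
  unfolding divide_inverse by (intro same_value_mult same_value_inverse)

lemma same_value_power: "same_value a b \<Longrightarrow> same_value (a ^ m) (b ^ m)"
  by (induction m) (auto intro: same_value_mult same_value_refl)

lemma same_value_in_ring: "same_value a b \<Longrightarrow> b \<in> V \<Longrightarrow> a \<in> V"
  using mult_closed[of "a / b" b] by (auto simp: same_value_def)

text \<open>The least value must occur twice: after division by a term \<open>t m\<close> of least
  value, all other terms would be nonunits and could not add up to \<open>- 1\<close>.\<close>

lemma same_value_in_zero_sum:
  assumes fin: "finite I" and sum: "sum t I = 0" and nz: "\<exists>i\<in>I. t i \<noteq> 0"
  shows "\<exists>i\<in>I. \<exists>j\<in>I. i \<noteq> j \<and> same_value (t i) (t j)"
proof (rule ccontr)
  assume no: "\<not> ?thesis"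
  define J where "J = {i \<in> I. t i \<noteq> 0}"
  have J: "finite J" "J \<noteq> {}" using fin nz by (auto simp: J_def)
  \<comment> \<open>Every finite family has a term of least value, since the dichotomy makes values
    linearly ordered.\<close>
  have "\<exists>m\<in>J'. \<forall>i\<in>J'. t i / t m \<in> V" if "finite J'" "J' \<noteq> {}" "J' \<subseteq> J" for J'
    using that
  proof (induction J' rule: finite_ne_induct)
    case (singleton i)
    then show ?case by (auto simp: J_def one_closed)
  next
    case (insert i J')
    then obtain m where m: "m \<in> J'" "\<forall>i\<in>J'. t i / t m \<in> V" by blast
    have nz: "t i \<noteq> 0" "t m \<noteq> 0" using insert.prems m by (auto simp: J_def)
    show ?case
    proof (cases "t i / t m \<in> V")
      case True
      with m show ?thesis by blast
    next
      case False
      then have mi: "t m / t i \<in> V" using dichotomy[of "t i / t m"] nz by auto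
      have "t j / t i \<in> V" if "j \<in> J'" for j
      proof -
        have "t j / t i = (t j / t m) * (t m / t i)" using nz by simp
        then show ?thesis using mult_closed mi m that by metis
      qed
      moreover have "t i / t i \<in> V" using nz one_closed by simp
      ultimately show ?thesis by blast
    qed
  qed
  from this[OF J order.refl] obtain m where m: "m \<in> J" "\<And>i. i \<in> J \<Longrightarrow> t i / t m \<in> V" by blast
  have tm: "t m \<noteq> 0" using m by (simp add: J_def)
  have "sum t J = sum t I" unfolding J_def using fin by (intro sum.mono_neutral_left) auto
  with sum have "(\<Sum>i\<in>J. t i / t m) = 0" by (simp flip: sum_divide_distrib)
  then have "1 = - (\<Sum>i\<in>J - {m}. t i / t m)"
    using tm sum.remove[OF J(1) m(1), of "\<lambda>i. t i / t m"] by (simp add: eq_neg_iff_add_eq_0)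
  also have "\<dots> \<in> nonunits"
  proof (intro nonunits_minus nonunits_sum)
    fix i assume i: "i \<in> J - {m}"
    then have "\<not> same_value (t i) (t m)" using no m(1) by (auto simp: J_def)
    then have "t m / t i \<notin> V" using i m tm by (auto simp: same_value_def J_def)
    then show "t i / t m \<in> nonunits" using i m(2) by (simp add: nonunits_def)
  qed
  finally show False using one_not_nonunit by simp
qed

end

text \<open>The values form a subgroup of the integers, generated by the least positive value
  \<open>\<gamma>\<close>. Division by \<open>\<gamma>\<close> will make the valuation
  surjective.\<close>

lemma int_hom_normalise:
  fixes \<mu> :: "'a :: field \<Rightarrow> int"
  assumes hom: "\<And>f g. f \<noteq> 0 \<Longrightarrow> g \<noteq> 0 \<Longrightarrow> \<mu> (f * g) = \<mu> f + \<mu> g" and w: "w \<noteq> 0" "\<mu> w \<noteq> 0"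
  obtains \<gamma> :: int where "\<gamma> > 0" "\<And>f. f \<noteq> 0 \<Longrightarrow> \<gamma> dvd \<mu> f" "\<And>j. \<exists>f. f \<noteq> 0 \<and> \<mu> f = j * \<gamma>"
proof -
  have one: "\<mu> 1 = 0" using hom[of 1 1] by simp
  have inv: "\<mu> (inverse f) = - \<mu> f" if "f \<noteq> 0" for f using hom[of f "inverse f"] that one by simp
  have nat: "\<mu> (f ^ m) = int m * \<mu> f" if "f \<noteq> 0" for f m
    using that by (induction m) (auto simp: one hom algebra_simps)
  have powi: "\<mu> (f powi j) = j * \<mu> f" if "f \<noteq> 0" for f j
    using that by (cases j rule: int_cases2) (auto simp: nat inv power_int_minus)
  define P where "P = (\<lambda>m. m > 0 \<and> (\<exists>f. f \<noteq> 0 \<and> \<mu> f = int m))"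
  have "\<exists>m. P m"
  proof (cases "\<mu> w > 0")
    case True
    then show ?thesis using w by (intro exI[of _ "nat (\<mu> w)"]) (auto simp: P_def intro: exI[of _ w])
  next
    case False
    then show ?thesis using w inv[of w]
      by (intro exI[of _ "nat (- \<mu> w)"]) (auto simp: P_def intro!: exI[of _ "inverse w"])
  qed
  then have least: "P (LEAST m. P m)" by (rule LeastI_ex)
  define \<gamma> where "\<gamma> = int (LEAST m. P m)"
  obtain c where c: "\<gamma> > 0" "c \<noteq> 0" "\<mu> c = \<gamma>" using least by (auto simp: P_def \<gamma>_def)
  show thesis
  proof (rule that[OF c(1)])
    fix f :: 'a assume f: "f \<noteq> 0"
    have "\<mu> (f * c powi (- (\<mu> f div \<gamma>))) = \<mu> f - (\<mu> f div \<gamma>) * \<gamma>"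
      using f c by (subst hom) (auto simp: powi)
    then have eq: "\<mu> (f * c powi (- (\<mu> f div \<gamma>))) = \<mu> f mod \<gamma>" by (simp add: minus_div_mult_eq_mod)
    show "\<gamma> dvd \<mu> f"
    proof (rule ccontr)
      assume "\<not> \<gamma> dvd \<mu> f"
      then have pos: "\<mu> f mod \<gamma> > 0" using c(1) by (simp add: dvd_eq_mod_eq_0 order_neq_le_trans)
      then have "P (nat (\<mu> f mod \<gamma>))"
        unfolding P_def using eq f c by (intro conjI exI[of _ "f * c powi (- (\<mu> f div \<gamma>))"]) auto
      from Least_le[of P, OF this] have "\<gamma> \<le> \<mu> f mod \<gamma>" using pos by (simp add: \<gamma>_def le_nat_iff)
      with pos_mod_bound[OF c(1), of "\<mu> f"] show False by simp
    qed
  next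
    show "\<exists>f. f \<noteq> 0 \<and> \<mu> f = j * \<gamma>" for j
      using c by (intro exI[of _ "c powi j"]) (auto simp: powi)
  qed
qed

section \<open>From valuation rings to places above infinity\<close>

context function_field
begin

abbreviation kx :: "'a set"
  where "kx \<equiv> {poly f x | f. f \<in> polys_over k}"

sublocale A: field_subring kx
  by (rule poly_values_subring)

lemma x_nonzero: "x \<noteq> 0"
  using transcendental[OF polys_over_monom[OF one_closed, of 1]] by (auto simp: poly_monom monom_eq_0_iff)

lemma poly_nonzero: "f \<in> polys_over k \<Longrightarrow> f \<noteq> 0 \<Longrightarrow> poly f x \<noteq> 0"
  using transcendental by blast

lemma spanning_set_exists: "\<exists>W. A.spans_fractions W"
  by (rule spans_fractions_poly_values[OF finite_over])

context
  fixes V assumes V: "valuation_ring V" "k \<subseteq> V" "x \<notin> V"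
begin

interpretation V: valuation_ring V by (rule V(1))

lemma inverse_x_nonunit: "inverse x \<in> V.nonunits"
  using V.dichotomy[OF x_nonzero] V(3) by (simp add: V.nonunits_def)

text \<open>The leading term dominates: after division by the top power of \<open>x\<close>, the
  lower terms contain positive powers of the nonunit \<open>inverse x\<close>, whereas the leading
  coefficient is a unit of \<open>V\<close>.\<close>

lemma same_value_poly:
  assumes f: "f \<in> polys_over k" "f \<noteq> 0"
  shows "V.same_value (poly f x) (x ^ Polynomial.degree f)"
proof -
  define d where "d = Polynomial.degree f"
  define c where "c = Polynomial.lead_coeff f"
  have c: "c \<in> k" "c \<noteq> 0" using f by (auto simp: c_def)
  define t where "t = (\<Sum>i<d. Polynomial.coeff f i * inverse x ^ (d - i))"
  have "{..d} = insert d {..<d}" by auto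
  then have "poly f x / x ^ d = (\<Sum>i\<in>insert d {..<d}. Polynomial.coeff f i * (x ^ i / x ^ d))"
    by (simp add: poly_altdef d_def sum_divide_distrib add_divide_distrib)
  also have "\<dots> = c + (\<Sum>i<d. Polynomial.coeff f i * (x ^ i / x ^ d))"
    using x_nonzero by (simp add: c_def d_def)
  also have "(\<Sum>i<d. Polynomial.coeff f i * (x ^ i / x ^ d)) = t"
    unfolding t_def using x_nonzero by (intro sum.cong) (auto simp: power_diff power_inverse field_simps)
  finally have eq: "poly f x / x ^ d = c + t" .
  have "t \<in> V.nonunits"
    unfolding t_def
  proof (intro V.nonunits_sum)
    fix i assume i: "i \<in> {..<d}"
    have "Polynomial.coeff f i * inverse x ^ (d - i - 1) * inverse x \<in> V.nonunits"
    proof (rule V.nonunits_mult[OF _ inverse_x_nonunit])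
      have "inverse x \<in> V" using inverse_x_nonunit by (simp add: V.nonunits_def)
      moreover have "Polynomial.coeff f i \<in> V" using f(1) V(2) by auto
      ultimately show "Polynomial.coeff f i * inverse x ^ (d - i - 1) \<in> V"
        by (intro V.mult_closed V.power_closed)
    qed
    moreover have "inverse x ^ (d - i) = inverse x ^ (d - i - 1) * inverse x"
      using i by (simp flip: power_Suc2 add: Suc_diff_Suc)
    ultimately show "Polynomial.coeff f i * inverse x ^ (d - i) \<in> V.nonunits" by (simp add: mult.assoc)
  qed
  have "c + t \<notin> V.nonunits"
  proof
    assume "c + t \<in> V.nonunits"
    from V.nonunits_add[OF this V.nonunits_minus[OF \<open>t \<in> V.nonunits\<close>]] have "c \<in> V.nonunits" by simp
    moreover have "inverse c \<in> V" using inverse_closed[OF c(1)] V(2) by blast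
    ultimately show False using c by (simp add: V.nonunits_def)
  qed
  moreover have "c + t \<in> V"
    using c V(2) \<open>t \<in> V.nonunits\<close> by (intro V.add_closed) (auto simp: V.nonunits_def)
  ultimately have "inverse (c + t) \<in> V" by (auto simp: V.nonunits_def)
  then have "x ^ d / poly f x \<in> V" unfolding eq[symmetric] by simp
  moreover have "poly f x / x ^ d \<in> V" unfolding eq by fact
  ultimately show ?thesis
    unfolding V.same_value_def d_def[symmetric] using poly_nonzero[OF f] x_nonzero by simp
qed

lemma powi_in_ring_iff: "x powi j \<in> V \<longleftrightarrow> j \<le> 0"
proof
  have ix: "inverse x \<in> V" using inverse_x_nonunit by (simp add: V.nonunits_def)
  show "x powi j \<in> V" if "j \<le> 0"
    using that V.power_closed[OF ix] V.one_closed by (simp add: power_int_def)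
  show "j \<le> 0" if j: "x powi j \<in> V"
  proof (rule ccontr)
    assume "\<not> j \<le> 0"
    then have "x powi (j - 1) * inverse x ^ nat (j - 1) = 1"
      using x_nonzero by (simp add: power_int_def power_inverse)
    moreover have "x powi j = x powi (j - 1) * x"
      using x_nonzero by (simp add: power_int_diff)
    ultimately have "x = x powi j * inverse x ^ nat (j - 1)" by simp
    also have "\<dots> \<in> V" by (intro V.mult_closed V.power_closed j ix)
    finally show False using V(3) by simp
  qed
qed

lemma same_value_powi_unique:
  assumes "V.same_value a (x powi i)" "V.same_value a (x powi j)"
  shows "i = j"
proof -
  have "V.same_value (x powi i) (x powi j)" using assms V.same_value_sym V.same_value_trans by blast
  then have "x powi (i - j) \<in> V" "x powi (j - i) \<in> V"
    using x_nonzero by (simp_all add: V.same_value_def power_int_diff)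
  then show ?thesis by (simp add: powi_in_ring_iff)
qed

lemma same_value_kx:
  assumes "c \<in> kx" "c \<noteq> 0"
  shows "\<exists>d :: nat. V.same_value c (x powi int d)"
proof -
  obtain f where f: "f \<in> polys_over k" "c = poly f x" using assms by blast
  with assms have "f \<noteq> 0" by auto
  with same_value_poly[OF f(1)] f(2) show ?thesis by auto
qed

text \<open>In a relation over \<open>k[x]\<close> between powers of \<open>h\<close> two terms have
  the same value, so \<open>h ^ l\<close> has the value of a power of \<open>x\<close> for some
  positive \<open>l\<close> up to \<open>card W\<close>. The factorial is a common multiple of all
  these \<open>l\<close>.\<close>

lemma same_value_power_of_x:
  assumes W: "A.spans_fractions W" and "h \<noteq> 0"
  shows "\<exists>j. V.same_value (h ^ fact (card W)) (x powi j)"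
proof -
  obtain c where c: "\<forall>i. c i \<in> kx" "\<exists>i\<in>{..card W}. c i \<noteq> 0" "(\<Sum>i\<in>{..card W}. c i * h ^ i) = 0"
    using A.spans_fractions_dependent[OF W, of "{..card W}" "\<lambda>i. h ^ i"] by auto
  have "\<exists>i\<in>{..card W}. \<exists>j\<in>{..card W}. i \<noteq> j \<and> V.same_value (c i * h ^ i) (c j * h ^ j)"
    using c(2,3) \<open>h \<noteq> 0\<close> by (intro V.same_value_in_zero_sum) auto
  obtain i j where ij: "i \<le> card W" "j \<le> card W" "i < j" "V.same_value (c i * h ^ i) (c j * h ^ j)"
  proof -
    obtain i j where "i \<le> card W" "j \<le> card W" "i \<noteq> j" "V.same_value (c i * h ^ i) (c j * h ^ j)"
      using \<open>\<exists>i\<in>{..card W}. \<exists>j\<in>{..card W}. i \<noteq> j \<and> V.same_value (c i * h ^ i) (c j * h ^ j)\<close> by auto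
    then show thesis
      using that[of i j] that[of j i] V.same_value_sym by (cases "i < j") auto
  qed
  then have nz: "c i \<noteq> 0" "c j \<noteq> 0" by (auto simp: V.same_value_def)
  obtain d e :: nat where de: "V.same_value (c i) (x powi int d)" "V.same_value (c j) (x powi int e)"
    using same_value_kx[of "c i"] same_value_kx[of "c j"] spec[OF c(1)] nz by auto
  define l where "l = j - i"
  have l: "l > 0" "l \<le> card W" "j = i + l" using ij by (auto simp: l_def)
  have "V.same_value (h ^ l) (c i / c j)"
    using V.same_value_divide[OF V.same_value_sym[OF ij(4)] V.same_value_refl[of "c j * h ^ i"]] nz \<open>h \<noteq> 0\<close>
    by (simp add: l(3) power_add)
  also have "V.same_value \<dots> (x powi (int d - int e))"
    using V.same_value_divide[OF de] x_nonzero by (simp add: power_int_diff)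
  finally (V.same_value_trans) have same: "V.same_value (h ^ l) (x powi (int d - int e))" .
  have "l dvd fact (card W)" using l by (intro dvd_fact) auto
  then obtain m where "fact (card W) = l * m" by (auto elim!: dvdE)
  then have "V.same_value (h ^ fact (card W)) (x powi ((int d - int e) * int m))"
    using V.same_value_power[OF same, of m] by (simp add: power_mult power_int_mult)
  then show ?thesis by blast
qed

text \<open>With \<open>N = r!\<close>, \<open>r\<close> the size of a spanning set, the \<open>N\<close>-th power of every element has the
  value of a power of \<open>x\<close>; the exponent, normalised, is a discrete valuation.\<close>

lemma place_of_valuation_ring:
  "\<exists>\<nu>\<in>infinite_places k x. \<forall>h. h \<noteq> 0 \<longrightarrow> (h \<in> V \<longleftrightarrow> \<nu> h \<ge> 0)"
proof -
  obtain W where W: "A.spans_fractions W" using spanning_set_exists by blast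
  define N :: nat where "N = fact (card W)"
  have "N > 0" by (simp add: N_def)
  \<comment> \<open>The sign makes \<open>\<mu>\<close> positive on the nonunits of
    \<open>V\<close>, as \<open>x\<close> itself lies outside \<open>V\<close>.\<close>
  define \<mu> where "\<mu> = (\<lambda>h. THE j. V.same_value (h ^ N) (x powi (- j)))"
  have \<mu>: "V.same_value (h ^ N) (x powi (- \<mu> h))" if h: "h \<noteq> 0" for h
  proof -
    obtain j where "V.same_value (h ^ N) (x powi (- (- j)))"
      using same_value_power_of_x[OF W h] by (auto simp: N_def)
    then show ?thesis
      unfolding \<mu>_def
    proof (rule theI)
      fix i assume "V.same_value (h ^ N) (x powi - i)"
      from same_value_powi_unique[OF this \<open>V.same_value (h ^ N) (x powi (- (- j)))\<close>]
      show "i = - j" by simp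
    qed
  qed
  have \<mu>_eq: "\<mu> h = j" if "V.same_value (h ^ N) (x powi (- j))" for h j
  proof -
    have "h \<noteq> 0" using that \<open>N > 0\<close> by (auto simp: V.same_value_def)
    from same_value_powi_unique[OF \<mu>[OF this] that] show ?thesis by simp
  qed
  have hom: "\<mu> (f * g) = \<mu> f + \<mu> g" if "f \<noteq> 0" "g \<noteq> 0" for f g
    using V.same_value_mult[OF \<mu>[OF that(1)] \<mu>[OF that(2)]] x_nonzero
    by (intro \<mu>_eq) (simp add: power_mult_distrib power_int_diff power_int_minus field_simps)
  have V_iff: "h \<in> V \<longleftrightarrow> \<mu> h \<ge> 0" if h: "h \<noteq> 0" for h
  proof
    assume "h \<in> V"
    then have "h ^ N \<in> V" by (rule V.power_closed)
    from V.same_value_in_ring[OF V.same_value_sym[OF \<mu>[OF h]] this] show "\<mu> h \<ge> 0"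
      by (simp add: powi_in_ring_iff)
  next
    assume "\<mu> h \<ge> 0"
    then have hN: "h ^ N \<in> V" by (intro V.same_value_in_ring[OF \<mu>[OF h]]) (simp add: powi_in_ring_iff)
    show "h \<in> V"
    proof (rule ccontr)
      assume "h \<notin> V"
      then have "inverse h \<in> V" using V.dichotomy[OF h] by simp
      then have "h ^ N * inverse h ^ (N - 1) \<in> V" by (intro V.mult_closed V.power_closed hN)
      moreover have "h ^ N = h * h ^ (N - 1)" using \<open>N > 0\<close> by (cases N) auto
      then have "h ^ N * inverse h ^ (N - 1) = h" using h by (simp add: power_inverse)
      ultimately show False using \<open>h \<notin> V\<close> by simp
    qed
  qed
  have \<mu>_poly: "\<mu> (poly f x) = - (int N * int (Polynomial.degree f))" if "f \<in> polys_over k" "f \<noteq> 0" for f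
    using V.same_value_power[OF same_value_poly[OF that], of N]
    by (intro \<mu>_eq) (simp add: power_mult[symmetric] mult.commute flip: of_nat_mult)
  have "\<mu> x = - int N"
    using \<mu>_poly[OF polys_over_monom[OF one_closed, of 1]]
    by (simp add: poly_monom monom_eq_0_iff degree_monom_eq)
  then have "\<mu> x \<noteq> 0" using \<open>N > 0\<close> by simp
  obtain \<gamma> where \<gamma>: "\<gamma> > 0" "\<And>f. f \<noteq> 0 \<Longrightarrow> \<gamma> dvd \<mu> f" "\<And>j. \<exists>f. f \<noteq> 0 \<and> \<mu> f = j * \<gamma>"
    using int_hom_normalise[OF hom x_nonzero \<open>\<mu> x \<noteq> 0\<close>] by blast
  define \<nu> where "\<nu> = (\<lambda>h. if h = 0 then 0 else of_int (\<mu> h div \<gamma>) :: real)"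
  have \<mu>\<nu>: "of_int (\<mu> h) = of_int \<gamma> * \<nu> h" if "h \<noteq> 0" for h
    using \<gamma>(2)[OF that] that unfolding \<nu>_def by (simp flip: of_int_mult)
  have \<nu>_ge: "\<nu> h \<ge> 0 \<longleftrightarrow> h \<in> V" if "h \<noteq> 0" for h
  proof -
    have "\<mu> h \<ge> 0 \<longleftrightarrow> real_of_int (\<mu> h) \<ge> 0" by simp
    also have "\<dots> \<longleftrightarrow> \<nu> h \<ge> 0" unfolding \<mu>\<nu>[OF that] using \<gamma>(1) by (simp add: zero_le_mult_iff)
    finally show ?thesis using V_iff[OF that] by simp
  qed
  have \<nu>_mult: "\<nu> (f * g) = \<nu> f + \<nu> g" if "f \<noteq> 0" "g \<noteq> 0" for f g
  proof -
    have "of_int \<gamma> * \<nu> (f * g) = of_int \<gamma> * (\<nu> f + \<nu> g)"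
      using \<mu>\<nu>[of f] \<mu>\<nu>[of g] \<mu>\<nu>[of "f * g"] hom[OF that] that by (simp add: distrib_left)
    then show ?thesis using \<gamma>(1) by simp
  qed
  have \<nu>_div: "\<nu> (f / g) = \<nu> f - \<nu> g" if "f \<noteq> 0" "g \<noteq> 0" for f g
    using \<nu>_mult[of "f / g" g] that by simp
  have half: "\<nu> f \<le> \<nu> (f + g)" if "f \<noteq> 0" "g \<noteq> 0" "f + g \<noteq> 0" "\<nu> f \<le> \<nu> g" for f g
  proof -
    have "g / f \<in> V" using that \<nu>_ge[of "g / f"] by (simp add: \<nu>_div)
    then have "1 + g / f \<in> V" by (intro V.add_closed V.one_closed)
    moreover have "1 + g / f = (f + g) / f" using that by (simp add: field_simps)
    ultimately show ?thesis using that \<nu>_ge[of "(f + g) / f"] by (simp add: \<nu>_div)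
  qed
  have "is_place k \<nu>"
    unfolding is_place_def
  proof (intro conjI allI impI ballI)
    show "\<nu> 0 = 0" by (simp add: \<nu>_def)
    show "\<nu> (f * g) = \<nu> f + \<nu> g" if "f \<noteq> 0 \<and> g \<noteq> 0" for f g using \<nu>_mult that by simp
    show "min (\<nu> f) (\<nu> g) \<le> \<nu> (f + g)" if "f \<noteq> 0 \<and> g \<noteq> 0 \<and> f + g \<noteq> 0" for f g
      using that half[of f g] half[of g f] by (cases "\<nu> f \<le> \<nu> g") (auto simp: min_def add.commute)
    show "\<nu> ` (- {0}) = \<int>"
    proof
      show "\<nu> ` (- {0}) \<subseteq> \<int>" by (auto simp: \<nu>_def)
      show "\<int> \<subseteq> \<nu> ` (- {0})"
      proof
        fix z :: real assume "z \<in> \<int>"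
        then obtain j where j: "z = of_int j" by (auto elim: Ints_cases)
        obtain f where "f \<noteq> 0" "\<mu> f = j * \<gamma>" using \<gamma>(3) by blast
        then show "z \<in> \<nu> ` (- {0})" using j \<gamma>(1) by (intro image_eqI[of _ _ f]) (auto simp: \<nu>_def)
      qed
    qed
    fix c assume c: "c \<in> k - {0}"
    then have "c \<in> V" "inverse c \<in> V" using V(2) inverse_closed by auto
    then show "\<nu> c = 0"
      using \<nu>_ge[of c] \<nu>_ge[of "inverse c"] \<nu>_mult[of c "inverse c"] \<nu>_mult[of 1 1] c by auto
  qed
  moreover have "above_infinity k x \<nu>"
    unfolding above_infinity_def
  \<comment> \<open>\<open>N\<close> is the value of \<open>inverse x\<close> before normalisation;
    divided by \<open>\<gamma>\<close> it is the ramification index.\<close>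
  proof (intro exI[of _ "nat (int N div \<gamma>)"] conjI allI impI)
    have "\<gamma> dvd int N" using \<gamma>(2)[OF x_nonzero] \<open>\<mu> x = - int N\<close> by simp
    then obtain e where e: "int N = \<gamma> * e" by (auto elim!: dvdE)
    then have "e > 0" using \<open>N > 0\<close> \<gamma>(1) by (metis of_nat_0_less_iff zero_less_mult_pos)
    have N_div: "int N div \<gamma> = e" using e \<gamma>(1) by simp
    show "0 < nat (int N div \<gamma>)" using \<open>e > 0\<close> by (simp add: N_div)
    fix a b :: "'a poly"
    assume "a \<noteq> 0 \<and> b \<noteq> 0 \<and> set (coeffs a) \<subseteq> k \<and> set (coeffs b) \<subseteq> k"
    moreover have "f \<in> polys_over k" if "set (coeffs f) \<subseteq> k" for f
    proof (intro CollectI allI)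
      show "Polynomial.coeff f i \<in> k" for i
      proof (cases "Polynomial.coeff f i = 0")
        case True
        then show ?thesis using zero_closed by simp
      next
        case False
        then have "f \<noteq> 0" "i \<le> Polynomial.degree f" by (auto intro: le_degree)
        from coeff_in_coeffs[OF this] that show ?thesis by blast
      qed
    qed
    ultimately have ab: "a \<noteq> 0" "b \<noteq> 0" "a \<in> polys_over k" "b \<in> polys_over k" by auto
    have deg: "\<nu> (poly f x) = - (of_int e * real (Polynomial.degree f))" if "f \<in> polys_over k" "f \<noteq> 0" for f
    proof -
      have "of_int \<gamma> * \<nu> (poly f x) = of_int \<gamma> * (- (of_int e * real (Polynomial.degree f)))"
        using \<mu>\<nu>[OF poly_nonzero[OF that]] \<mu>_poly[OF that] by (simp add: e)
      then show ?thesis using \<gamma>(1) by (subst (asm) mult_left_cancel) auto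
    qed
    show "\<nu> (poly a x / poly b x) = real (nat (int N div \<gamma>)) * (real (Polynomial.degree b) - real (Polynomial.degree a))"
      using \<open>e > 0\<close> poly_nonzero ab by (simp add: N_div \<nu>_div deg algebra_simps)
  qed
  ultimately show ?thesis using \<nu>_ge by (auto simp: infinite_places_def)
qed

end

text \<open>A valuation ring that contains \<open>k\<close> but not \<open>h\<close> cannot contain
  \<open>x\<close>: it would contain \<open>k[x]\<close> and, being integrally closed, also
  \<open>h\<close>. So its place lies above infinity.\<close>

lemma place_with_pole:
  assumes h: "h \<in> integral_closure kx" "h \<notin> k"
  shows "\<exists>\<nu>\<in>infinite_places k x. \<nu> h < 0"
proof -
  have "h \<noteq> 0" using h(2) zero_closed by auto
  let ?R = "{poly f (inverse h) | f. f \<in> polys_over k}"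
  have "h \<notin> ?R"
  proof
    assume "h \<in> ?R"
    then obtain f where f: "f \<in> polys_over k" "h = poly f (inverse h)" by blast
    \<comment> \<open>Reflection turns \<open>h = poly f (inverse h)\<close> into a monic equation
      for \<open>h\<close> over \<open>k\<close>, of degree one more than that of \<open>f\<close>.
      Hence \<open>h\<close> would be constant.\<close>
    have "poly (reflect_poly f) h = h ^ Polynomial.degree f * h"
      using poly_reflect_poly_nz[OF \<open>h \<noteq> 0\<close>, of f] f(2) by simp
    then have "poly (Polynomial.monom 1 (Suc (Polynomial.degree f)) - reflect_poly f) h = 0"
      by (simp add: poly_monom)
    moreover have "Polynomial.monom 1 (Suc (Polynomial.degree f)) - reflect_poly f \<in> polys_over k"
      using f(1) zero_closed one_closed minus_closed
      by (auto simp: coeff_reflect_poly intro!: diff_closed)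
    moreover have "Polynomial.coeff (Polynomial.monom 1 (Suc (Polynomial.degree f)) - reflect_poly f)
      (Suc (Polynomial.degree f)) = 1"
      by (simp add: coeff_reflect_poly)
    then have "Polynomial.monom 1 (Suc (Polynomial.degree f)) - reflect_poly f \<noteq> 0" by force
    ultimately show False using constants h(2) by blast
  qed
  moreover have "inverse h \<in> ?R"
    using polys_over_monom[OF one_closed, of 1]
    by (intro CollectI exI[of _ "Polynomial.monom 1 1"]) (simp add: poly_monom)
  ultimately obtain V where V: "valuation_ring V" "?R \<subseteq> V" "h \<notin> V"
    using valuation_ring_exists[of ?R "inverse h"] poly_values_subring \<open>h \<noteq> 0\<close> by auto
  interpret V: valuation_ring V by (rule V(1))
  have "k \<subseteq> ?R"
  proof
    fix c assume "c \<in> k"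
    then show "c \<in> ?R"
      using polys_over_monom[of c 0]
      by (intro CollectI exI[of _ "Polynomial.monom c 0"]) (simp add: poly_monom)
  qed
  with V(2) have "k \<subseteq> V" by blast
  have "x \<notin> V"
  proof
    assume "x \<in> V"
    then have "kx \<subseteq> V" using \<open>k \<subseteq> V\<close> by (auto intro!: V.poly_closed)
    then have "h \<in> V" using h(1) integral_closure_mono V.integrally_closed by blast
    with V(3) show False by simp
  qed
  from place_of_valuation_ring[OF V(1) \<open>k \<subseteq> V\<close> this] show ?thesis
    using V(3) \<open>h \<noteq> 0\<close> by (meson not_le)
qed

end

section \<open>Places of function fields\<close>

text \<open>\<open>0\<close> is included explicitly, as the convention \<open>\<nu> 0 = 0\<close>
  does not give it the value infinity.\<close>

definition filtration :: "('a :: field \<Rightarrow> real) \<Rightarrow> real \<Rightarrow> 'a set"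
  where "filtration \<nu> m = {f. f = 0 \<or> \<nu> f \<ge> m}"

lemma filtration_antimono: "m \<le> m' \<Longrightarrow> filtration \<nu> m' \<subseteq> filtration \<nu> m"
  by (auto simp: filtration_def)

locale place = subfield_set k for k :: "'a :: field set" +
  fixes \<nu> :: "'a \<Rightarrow> real"
  assumes is_place: "is_place k \<nu>"
begin

lemma mult: "f \<noteq> 0 \<Longrightarrow> g \<noteq> 0 \<Longrightarrow> \<nu> (f * g) = \<nu> f + \<nu> g"
  using is_place unfolding is_place_def by blast

lemma min_le: "f \<noteq> 0 \<Longrightarrow> g \<noteq> 0 \<Longrightarrow> f + g \<noteq> 0 \<Longrightarrow> min (\<nu> f) (\<nu> g) \<le> \<nu> (f + g)"
  using is_place unfolding is_place_def by blast

lemma const: "c \<in> k \<Longrightarrow> c \<noteq> 0 \<Longrightarrow> \<nu> c = 0"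
  using is_place unfolding is_place_def by blast

lemma integral_value: "f \<noteq> 0 \<Longrightarrow> \<nu> f \<in> \<int>"
  using is_place unfolding is_place_def by blast

lemma surj_values: "\<exists>f. f \<noteq> 0 \<and> \<nu> f = of_int j"
proof -
  have "of_int j \<in> \<nu> ` (- {0})" using is_place unfolding is_place_def by simp
  then show ?thesis by (metis ComplD image_iff insertI1)
qed

lemma one: "\<nu> 1 = 0" using const[OF one_closed] by simp

lemma divide: "f \<noteq> 0 \<Longrightarrow> g \<noteq> 0 \<Longrightarrow> \<nu> (f / g) = \<nu> f - \<nu> g"
  using mult[of "f / g" g] by simp

lemma minus: "\<nu> (- f) = \<nu> f"
  using mult[of "- 1" f] const[OF minus_closed[OF one_closed]] by (cases "f = 0") auto

lemma power: "f \<noteq> 0 \<Longrightarrow> \<nu> (f ^ m) = real m * \<nu> f"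
  by (induction m) (auto simp: one mult algebra_simps)

lemma power_int: "f \<noteq> 0 \<Longrightarrow> \<nu> (f powi j) = of_int j * \<nu> f"
  by (cases j rule: int_cases2) (auto simp: power power_int_minus inverse_eq_divide divide one)

lemma add_eq:
  assumes "f \<noteq> 0" "g \<noteq> 0" "\<nu> f < \<nu> g"
  shows "f + g \<noteq> 0" "\<nu> (f + g) = \<nu> f"
proof -
  show nz: "f + g \<noteq> 0" using assms minus[of f] by (metis add_eq_0_iff less_irrefl)
  have "min (\<nu> (f + g)) (\<nu> (- g)) \<le> \<nu> f"
    using min_le[of "f + g" "- g"] nz assms by simp
  then have "\<nu> (f + g) \<le> \<nu> f" using assms(3) by (simp add: minus min_le_iff_disj)
  moreover have "\<nu> f \<le> \<nu> (f + g)" using min_le[OF assms(1,2) nz] assms(3) by simp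
  ultimately show "\<nu> (f + g) = \<nu> f" by simp
qed

lemma filtration_add: "f \<in> filtration \<nu> m \<Longrightarrow> g \<in> filtration \<nu> m \<Longrightarrow> f + g \<in> filtration \<nu> m"
  using min_le[of f g] by (cases "f = 0 \<or> g = 0 \<or> f + g = 0") (auto simp: filtration_def)

lemma filtration_mult: "f \<in> filtration \<nu> m \<Longrightarrow> g \<in> filtration \<nu> m' \<Longrightarrow> f * g \<in> filtration \<nu> (m + m')"
  using mult[of f g] by (cases "f = 0 \<or> g = 0") (auto simp: filtration_def)

lemma const_filtration: "c \<in> k \<Longrightarrow> c \<in> filtration \<nu> 0"
  using const by (cases "c = 0") (auto simp: filtration_def)

lemma submodule_filtration: "submodule_of k (filtration \<nu> m)"
  using filtration_add filtration_mult[of _ 0 _ m] const_filtration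
  by (auto simp: submodule_of_def) (simp add: filtration_def)

lemma filtration_Suc:
  assumes "f \<noteq> 0" "\<nu> f > of_int m" shows "\<nu> f \<ge> of_int m + 1"
proof -
  obtain j where "\<nu> f = of_int j" using integral_value[OF assms(1)] by (auto elim: Ints_cases)
  with assms(2) show ?thesis by simp
qed

text \<open>Among the terms with nonzero coefficient exactly one has the least value. Values are
  integers, so the others lie a full step further in the filtration and cannot cancel it.\<close>

lemma distinct_values_independent:
  assumes fin: "finite I" and nz: "\<And>h. h \<in> I \<Longrightarrow> h \<noteq> 0" and inj: "inj_on \<nu> I"
    and c: "\<And>h. c h \<in> k" and sum: "(\<Sum>h\<in>I. c h * h) = 0" and "h \<in> I"
  shows "c h = 0"
proof (rule ccontr)
  assume "c h \<noteq> 0"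
  define J where "J = {h \<in> I. c h \<noteq> 0}"
  have J: "finite J" "J \<noteq> {}" using fin \<open>h \<in> I\<close> \<open>c h \<noteq> 0\<close> by (auto simp: J_def)
  obtain g where g: "g \<in> J" "\<And>f. f \<in> J \<Longrightarrow> \<nu> g \<le> \<nu> f"
    using ex_min_if_finite[of "\<nu> ` J"] J by (metis (no_types, lifting) arg_min_if_finite(1) arg_min_least)
  obtain j where j: "\<nu> g = of_int j" using integral_value[of g] g nz by (auto simp: J_def elim: Ints_cases)
  have "c f * f \<in> filtration \<nu> (of_int j + 1)" if "f \<in> J - {g}" for f
  proof -
    have f: "f \<in> I" "c f \<noteq> 0" "f \<noteq> g" "f \<noteq> 0" using that nz by (auto simp: J_def)
    then have "\<nu> f \<noteq> \<nu> g" using inj g by (auto simp: inj_on_def J_def)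
    then have "\<nu> f > of_int j" using g(2)[of f] that j by simp
    then have "\<nu> f \<ge> of_int j + 1" using filtration_Suc f by blast
    then show ?thesis using f c[of f] by (simp add: filtration_def mult const)
  qed
  then have "(\<Sum>f\<in>J - {g}. c f * f) \<in> filtration \<nu> (of_int j + 1)"
    by (rule submodule_of_sum[OF submodule_filtration])
  moreover have "(\<Sum>f\<in>J. c f * f) = (\<Sum>f\<in>I. c f * f)"
    using fin by (intro sum.mono_neutral_left) (auto simp: J_def)
  then have "(\<Sum>f\<in>J - {g}. c f * f) = - (c g * g)"
    using sum by (simp add: sum.remove[OF J(1) g(1)] eq_neg_iff_add_eq_0 add.commute)
  ultimately have "- (c g * g) \<in> filtration \<nu> (of_int j + 1)" by simp
  moreover have "c g * g \<noteq> 0" "\<nu> (- (c g * g)) = of_int j"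
    using g nz j c by (auto simp: J_def minus mult const)
  ultimately show False by (simp add: filtration_def)
qed

lemma lspan_finitely_many_values:
  assumes B: "finite B"
  shows "finite (\<nu> ` (lspan k B - {0}))"
proof (rule finite_if_finite_subsets_card_bdd[THEN conjunct1])
  fix F assume F: "F \<subseteq> \<nu> ` (lspan k B - {0})" "finite F"
  then obtain I where I: "I \<subseteq> lspan k B - {0}" "finite I" "inj_on \<nu> I" "F = \<nu> ` I"
    by (metis finite_imageD subset_image_inj)
  show "card F \<le> card B"
  proof (rule ccontr)
    assume "\<not> card F \<le> card B"
    then have "card B < card I" using I by (simp add: card_image)
    then obtain c where "\<forall>i. c i \<in> k" "\<exists>i\<in>I. c i \<noteq> 0" "(\<Sum>i\<in>I. c i * i) = 0"
      using lspan_dependent[OF B I(2), of "\<lambda>i. i"] I(1) by blast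
    then show False using distinct_values_independent[OF I(2) _ I(3), of c] I(1) by blast
  qed
qed

end

definition finitely_spanned :: "'a :: field set \<Rightarrow> 'a set \<Rightarrow> bool"
  where "finitely_spanned k W \<longleftrightarrow> (\<exists>B. finite B \<and> B \<subseteq> W \<and> W \<subseteq> lspan k B)"

lemma submodule_of_Int: "submodule_of A M \<Longrightarrow> submodule_of A M' \<Longrightarrow> submodule_of A (M \<inter> M')"
  by (auto simp: submodule_of_def)

lemma submodule_of_INT: "(\<And>i. i \<in> I \<Longrightarrow> submodule_of A (M i)) \<Longrightarrow> submodule_of A (\<Inter>i\<in>I. M i)"
  by (simp add: submodule_of_def)

text \<open>If \<open>w\<close> were nonnegative wherever \<open>v\<close> is, it would vanish
  wherever \<open>v\<close> does and thus be a nonnegative multiple of \<open>v\<close>. Both take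
  the value \<open>1\<close>, so the factor is \<open>1\<close>.\<close>

lemma two_places:
  assumes v: "is_place k v" and w: "is_place k w" and k: "subfield_set k" and "v \<noteq> w"
  shows "\<exists>y. y \<noteq> 0 \<and> v y \<ge> 0 \<and> w y < 0"
proof (rule ccontr)
  assume no: "\<not> ?thesis"
  interpret v: place k v using k v by (simp add: place_def place_axioms_def)
  interpret w: place k w using k w by (simp add: place_def place_axioms_def)
  have ge: "w y \<ge> 0" if "y \<noteq> 0" "v y \<ge> 0" for y using no that by force
  have zero: "w y = 0" if "y \<noteq> 0" "v y = 0" for y
    using ge[of y] ge[of "1 / y"] that by (simp add: v.divide w.divide v.one w.one)
  obtain c where c: "c \<noteq> 0" "v c = 1" using v.surj_values[of 1] by auto
  have proportional: "w y = v y * w c" if y: "y \<noteq> 0" for y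
  proof -
    obtain j where j: "v y = of_int j" using v.integral_value[OF y] by (auto elim: Ints_cases)
    have "w (y / c powi j) = 0" using y c j by (intro zero) (auto simp: v.divide v.power_int)
    then show ?thesis using y c j by (simp add: w.divide w.power_int)
  qed
  obtain i where i: "w c = of_int i" using w.integral_value[OF c(1)] by (auto elim: Ints_cases)
  obtain d where d: "d \<noteq> 0" "w d = 1" using w.surj_values[of 1] by auto
  obtain j where j: "v d = of_int j" using v.integral_value[OF d(1)] by (auto elim: Ints_cases)
  have "of_int (j * i) = (1 :: real)" using proportional[OF d(1)] d i j by simp
  then have "j * i = 1" by linarith
  moreover have "i \<ge> 0" using ge[of c] c i by simp
  ultimately have "i = 1" by (simp add: zmult_eq_1_iff)
  then have "v y = w y" for y
    using proportional[of y] i v.is_place w.is_place by (cases "y = 0") (auto simp: is_place_def)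
  with \<open>v \<noteq> w\<close> show False by blast
qed

text \<open>In the induction step \<open>y\<close> serves the old places and \<open>z\<close>
  separates the new place from \<open>w\<close>; a high power of \<open>y\<close> outweighs
  \<open>z\<close> at the old places.\<close>

lemma separating_element:
  assumes k: "subfield_set k" and fin: "finite J" and J: "\<And>v. v \<in> J \<Longrightarrow> is_place k v"
    and w: "is_place k w" "w \<notin> J"
  shows "\<exists>z. z \<noteq> 0 \<and> (\<forall>v\<in>J. v z > 0) \<and> w z < 0"
  using fin J w(2)
proof (induction J rule: finite_induct)
  case empty
  interpret w: place k w using k w by (simp add: place_def place_axioms_def)
  show ?case using w.surj_values[of "- 1"] by auto
next
  case (insert v J)
  interpret w: place k w using k w by (simp add: place_def place_axioms_def)
  interpret v: place k v using k insert.prems by (simp add: place_def place_axioms_def)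
  have pl: "place k u" if "u \<in> J" for u using k insert.prems that by (simp add: place_def place_axioms_def)
  obtain y where y: "y \<noteq> 0" "\<forall>u\<in>J. u y > 0" "w y < 0" using insert by auto
  have "v \<noteq> w" using insert.prems by auto
  then obtain z1 z2 where z12: "z1 \<noteq> 0" "v z1 \<ge> 0" "w z1 < 0" "z2 \<noteq> 0" "w z2 \<ge> 0" "v z2 < 0"
    using two_places[OF v.is_place w.is_place k] two_places[OF w.is_place v.is_place k] by metis
  define z where "z = z1 / z2"
  have z: "z \<noteq> 0" "v z > 0" "w z < 0" using z12 by (auto simp: z_def v.divide w.divide)
  \<comment> \<open>The values of \<open>y\<close> at the old places are integers, hence at least
    \<open>1\<close>, so it suffices that \<open>m\<close> exceeds the absolute value of every
    \<open>u z\<close>.\<close>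
  define m where "m = nat \<lceil>\<Sum>u\<in>J. \<bar>u z\<bar>\<rceil> + 1"
  have m: "m > 0" by (simp add: m_def)
  have J_pos: "real m * u y + u z > 0" if u: "u \<in> J" for u
  proof -
    interpret u: place k u by (rule pl[OF u])
    have "u y \<ge> of_int 0 + 1" using y u by (intro u.filtration_Suc) auto
    then have "real m * 1 \<le> real m * u y" by (intro mult_left_mono) auto
    moreover have "\<bar>u z\<bar> \<le> (\<Sum>u\<in>J. \<bar>u z\<bar>)" using insert.hyps(1) u by (intro member_le_sum) auto
    then have "\<bar>u z\<bar> < real m" unfolding m_def by linarith
    ultimately show ?thesis by linarith
  qed
  show ?case
  proof (cases "v y \<ge> 0")
    case True
    have "u (y ^ m * z) > 0" if "u \<in> J" for u
    proof -
      interpret u: place k u by (rule pl[OF that])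
      show ?thesis using J_pos[OF that] y z by (simp add: u.mult u.power)
    qed
    moreover have "v (y ^ m * z) > 0" using True y z by (simp add: v.mult v.power add_nonneg_pos)
    moreover have "w (y ^ m * z) < 0"
      using y z m by (simp add: w.mult w.power add_neg_neg mult_pos_neg)
    ultimately show ?thesis using y z by (intro exI[of _ "y ^ m * z"]) auto
  next
    case False
    \<comment> \<open>Here \<open>y\<close> has a pole at \<open>v\<close> too. The quotient
      \<open>y ^ m / (y ^ m + 1)\<close> has value \<open>0\<close> at \<open>v\<close> and
      \<open>w\<close>, but the value of \<open>y ^ m\<close> on \<open>J\<close>, where the
      denominator has value \<open>0\<close>.\<close>
    have v_ym: "v (y ^ m) < v 1" using False y m by (simp add: v.power v.one mult_pos_neg)
    have w_ym: "w (y ^ m) < w 1" using y m by (simp add: w.power w.one mult_pos_neg)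
    have nz: "y ^ m + 1 \<noteq> 0" using w.add_eq(1)[OF _ _ w_ym] y by simp
    define t where "t = y ^ m * z / (y ^ m + 1)"
    have "t \<noteq> 0" using nz y z by (simp add: t_def)
    moreover have "v t > 0"
      using nz y z v.add_eq(2)[OF _ _ v_ym] by (simp add: t_def v.divide v.mult)
    moreover have "w t < 0"
      using nz y z w.add_eq(2)[OF _ _ w_ym] by (simp add: t_def w.divide w.mult)
    moreover have "u t > 0" if u: "u \<in> J" for u
    proof -
      interpret u: place k u by (rule pl[OF u])
      have "u 1 < u (y ^ m)" using y u m by (simp add: u.power u.one)
      from u.add_eq(2)[OF _ _ this] have "u (y ^ m + 1) = 0" using y by (simp add: u.one add.commute)
      then show ?thesis using nz y z J_pos[OF u] by (simp add: t_def u.divide u.mult u.power)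
    qed
    ultimately show ?thesis by (intro exI[of _ t]) auto
  qed
qed

section \<open>Finite dimension of spaces with bounded poles\<close>

context function_field
begin

lemma infinite_place:
  assumes "\<nu> \<in> infinite_places k x"
  shows "place k \<nu>" "\<exists>e\<ge>1. \<forall>f\<in>polys_over k. \<forall>g\<in>polys_over k. f \<noteq> 0 \<longrightarrow> g \<noteq> 0 \<longrightarrow>
    \<nu> (poly f x / poly g x) = e * (real (Polynomial.degree g) - real (Polynomial.degree f))"
proof -
  have "is_place k \<nu>" "above_infinity k x \<nu>" using assms by (auto simp: infinite_places_def)
  then show "place k \<nu>" using subfield_set_axioms by (simp add: place_def place_axioms_def)
  obtain e :: nat where e: "e > 0"
    "\<forall>a b :: 'a poly. a \<noteq> 0 \<and> b \<noteq> 0 \<and> set (coeffs a) \<subseteq> k \<and> set (coeffs b) \<subseteq> k \<longrightarrow>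
        \<nu> (poly a x / poly b x) = real e * (real (Polynomial.degree b) - real (Polynomial.degree a))"
    using \<open>above_infinity k x \<nu>\<close> unfolding above_infinity_def by blast
  have "set (coeffs f) \<subseteq> k" if "f \<in> polys_over k" for f using that by (auto simp: coeffs_def)
  with e show "\<exists>e\<ge>1. \<forall>f\<in>polys_over k. \<forall>g\<in>polys_over k. f \<noteq> 0 \<longrightarrow> g \<noteq> 0 \<longrightarrow>
    \<nu> (poly f x / poly g x) = e * (real (Polynomial.degree g) - real (Polynomial.degree f))"
    by (intro exI[of _ "real e"]) auto
qed

lemma proper_fraction_value:
  assumes \<nu>: "\<nu> \<in> infinite_places k x" and fg: "f \<in> polys_over k" "g \<in> polys_over k" "g \<noteq> 0"
    and deg: "f = 0 \<or> Polynomial.degree f < Polynomial.degree g"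
  shows "poly f x / poly g x \<in> filtration \<nu> 1"
proof (cases "f = 0")
  case False
  obtain e where e: "e \<ge> 1" "\<nu> (poly f x / poly g x) = e * (real (Polynomial.degree g) - real (Polynomial.degree f))"
    using infinite_place(2)[OF \<nu>] fg False by blast
  have "1 * 1 \<le> e * (real (Polynomial.degree g) - real (Polynomial.degree f))"
    using e(1) deg False by (intro mult_mono) auto
  with e(2) show ?thesis by (simp add: filtration_def)
qed (simp add: filtration_def)

text \<open>A relation over \<open>k[x]\<close>, divided by its highest power of \<open>x\<close>, is a relation over \<open>k\<close> up to
  terms of positive value.\<close>

lemma residually_dependent:
  assumes W: "A.spans_fractions W" and \<nu>: "\<nu> \<in> infinite_places k x"
    and I: "finite I" "card W < card I" and z: "\<And>i. i \<in> I \<Longrightarrow> z i \<in> filtration \<nu> 0"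
  shows "\<exists>c. (\<forall>i. c i \<in> k) \<and> (\<exists>i\<in>I. c i \<noteq> 0) \<and> (\<Sum>i\<in>I. c i * z i) \<in> filtration \<nu> 1"
proof -
  interpret place k \<nu> by (rule infinite_place(1)[OF \<nu>])
  interpret P: idom_subring "polys_over k" by (rule idom_subring_polys_over)
  obtain b where b: "\<forall>i. b i \<in> kx" "\<exists>i\<in>I. b i \<noteq> 0" "(\<Sum>i\<in>I. b i * z i) = 0"
    using A.spans_fractions_dependent[OF W I] by blast
  then have "\<forall>i. \<exists>f. f \<in> polys_over k \<and> b i = poly f x" by blast
  from choice[OF this] obtain g where g: "\<And>i. g i \<in> polys_over k" "\<And>i. b i = poly (g i) x" by blast
  \<comment> \<open>Division by \<open>x ^ d\<close> turns \<open>b i\<close> into its coefficient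
    at \<open>x ^ d\<close> plus a proper fraction, whose value is at least
    \<open>1\<close>.\<close>
  define d where "d = Max (Polynomial.degree ` g ` I)"
  have deg: "Polynomial.degree (g i) \<le> d" if "i \<in> I" for i
    unfolding d_def using I(1) that by (intro Max_ge) auto
  define c where "c = (\<lambda>i. Polynomial.coeff (g i) d)"
  have "\<exists>i\<in>I. c i \<noteq> 0"
  \<comment> \<open>Attaining degree \<open>0\<close> does not exhibit a nonzero coefficient,
    because the zero polynomial has degree \<open>0\<close> as well.\<close>
  proof (cases "d = 0")
    case True
    obtain i where i: "i \<in> I" "b i \<noteq> 0" using b(2) by blast
    then have "g i \<noteq> 0" "Polynomial.degree (g i) = 0" using g(2)[of i] deg[of i] True by auto
    then have "c i \<noteq> 0" unfolding c_def True by (metis leading_coeff_0_iff)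
    with i show ?thesis by blast
  next
    case False
    have "I \<noteq> {}" using b(2) by blast
    then have "d \<in> Polynomial.degree ` g ` I" unfolding d_def using I(1) by (intro Max_in) auto
    then obtain i where i: "i \<in> I" "Polynomial.degree (g i) = d" by auto
    then have "c i \<noteq> 0" using False unfolding c_def by (metis degree_0 leading_coeff_0_iff)
    with i show ?thesis by blast
  qed
  moreover have "(\<Sum>i\<in>I. c i * z i) \<in> filtration \<nu> 1"
  proof -
    have "(\<Sum>i\<in>I. b i / x ^ d * z i) = 0"
      using b(3) by (simp add: sum_divide_distrib[symmetric])
    then have "(\<Sum>i\<in>I. c i * z i) = (\<Sum>i\<in>I. (c i - b i / x ^ d) * z i)"
      by (simp add: left_diff_distrib sum_subtractf)
    also have "\<dots> \<in> filtration \<nu> 1"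
    proof (rule submodule_of_sum[OF submodule_filtration])
      fix i assume i: "i \<in> I"
      define f where "f = Polynomial.monom (c i) d - g i"
      have f: "f \<in> polys_over k"
        unfolding f_def using g(1) by (intro P.diff_closed polys_over_monom) (auto simp: c_def)
      have "Polynomial.degree f \<le> d"
        unfolding f_def using deg[OF i] degree_monom_le[of "c i" d] by (intro degree_diff_le)
      moreover have "Polynomial.coeff f d = 0" by (simp add: f_def c_def)
      ultimately have "f = 0 \<or> Polynomial.degree f < d"
        by (metis leading_coeff_0_iff order_le_imp_less_or_eq)
      then have "poly f x / poly (Polynomial.monom 1 d) x \<in> filtration \<nu> 1"
        using f polys_over_monom[OF one_closed]
        by (intro proper_fraction_value[OF \<nu>]) (auto simp: degree_monom_eq monom_eq_0_iff)
      moreover have "poly f x / poly (Polynomial.monom 1 d) x = c i - b i / x ^ d"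
        using x_nonzero by (simp add: f_def g(2) poly_monom field_simps)
      ultimately show "(c i - b i / x ^ d) * z i \<in> filtration \<nu> 1"
        using filtration_mult[of "c i - b i / x ^ d" 1 "z i" 0] z[OF i] by simp
    qed
    finally show ?thesis .
  qed
  moreover have "c i \<in> k" for i using g(1) by (simp add: c_def)
  ultimately show ?thesis by blast
qed

lemma residually_dependent_shift:
  assumes W: "A.spans_fractions W" and \<nu>: "\<nu> \<in> infinite_places k x"
    and I: "finite I" "card W < card I" and z: "\<And>i. i \<in> I \<Longrightarrow> z i \<in> filtration \<nu> (of_int m)"
  shows "\<exists>c. (\<forall>i. c i \<in> k) \<and> (\<exists>i\<in>I. c i \<noteq> 0) \<and> (\<Sum>i\<in>I. c i * z i) \<in> filtration \<nu> (of_int m + 1)"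
proof -
  interpret place k \<nu> by (rule infinite_place(1)[OF \<nu>])
  obtain w where w: "w \<noteq> 0" "\<nu> w = of_int m" using surj_values[of m] by blast
  have "z i / w \<in> filtration \<nu> 0" if "i \<in> I" for i
    using z[OF that] w by (cases "z i = 0") (auto simp: filtration_def divide)
  then obtain c where c: "\<forall>i. c i \<in> k" "\<exists>i\<in>I. c i \<noteq> 0" "(\<Sum>i\<in>I. c i * (z i / w)) \<in> filtration \<nu> 1"
    using residually_dependent[OF W \<nu> I, of "\<lambda>i. z i / w"] by blast
  have "w * (\<Sum>i\<in>I. c i * (z i / w)) = (\<Sum>i\<in>I. c i * z i)"
    using w(1) by (simp add: sum_distrib_left)
  moreover have "w \<in> filtration \<nu> (of_int m)" using w by (simp add: filtration_def)
  ultimately have "(\<Sum>i\<in>I. c i * z i) \<in> filtration \<nu> (of_int m + 1)"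
    using filtration_mult[OF _ c(3)] by metis
  with c show ?thesis by blast
qed

text \<open>Consecutive filtration steps have a quotient of dimension at most \<open>card W\<close>.
  A largest subset \<open>Z\<close> of \<open>U\<close> independent modulo the next step, together
  with generators of the part of \<open>U\<close> in that step, spans \<open>U\<close>.\<close>

lemma finitely_spanned_step:
  assumes \<nu>: "\<nu> \<in> infinite_places k x" and U: "submodule_of k U" "U \<subseteq> filtration \<nu> (of_int m)"
    and fin: "finitely_spanned k (U \<inter> filtration \<nu> (of_int m + 1))"
  shows "finitely_spanned k U"
proof -
  interpret place k \<nu> by (rule infinite_place(1)[OF \<nu>])
  obtain W where W: "A.spans_fractions W" using spanning_set_exists by blast
  obtain B where B: "finite B" "B \<subseteq> U" "U \<inter> filtration \<nu> (of_int m + 1) \<subseteq> lspan k B"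
    using fin by (auto simp: finitely_spanned_def)
  define indep where "indep = (\<lambda>Z. finite Z \<and> Z \<subseteq> U \<and>
    (\<forall>c. (\<forall>i. c i \<in> k) \<longrightarrow> (\<Sum>z\<in>Z. c z * z) \<in> filtration \<nu> (of_int m + 1) \<longrightarrow> (\<forall>z\<in>Z. c z = 0)))"
  have bound: "card Z \<le> card W" if "indep Z" for Z
  proof (rule ccontr)
    assume "\<not> card Z \<le> card W"
    then obtain c where "\<forall>i. c i \<in> k" "\<exists>z\<in>Z. c z \<noteq> 0" "(\<Sum>z\<in>Z. c z * z) \<in> filtration \<nu> (of_int m + 1)"
      using residually_dependent_shift[OF W \<nu>, of Z "\<lambda>z. z" m] \<open>indep Z\<close> U(2)
      unfolding indep_def by fastforce
    with \<open>indep Z\<close> show False unfolding indep_def by blast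
  qed
  have "indep {}" by (simp add: indep_def)
  then have "\<exists>Z. indep Z \<and> (\<forall>Y. indep Y \<longrightarrow> card Y \<le> card Z)"
    using bound by (intro Lattices_Big.ex_has_greatest_nat[where b = "Suc (card W)"]) (auto simp: less_Suc_eq_le)
  then obtain Z where Z: "indep Z" "\<And>Y. indep Y \<Longrightarrow> card Y \<le> card Z" by blast
  have finZ: "finite Z" "Z \<subseteq> U" using Z(1) by (auto simp: indep_def)
  have span: "submodule_of k (lspan k (Z \<union> B))" by (rule submodule_lspan)
  have incl: "Z \<subseteq> lspan k (Z \<union> B)" "lspan k B \<subseteq> lspan k (Z \<union> B)"
    using lspan_incl[of "Z \<union> B"] lspan_mono[of "Z \<union> B" B] finZ B by auto
  have "h \<in> lspan k (Z \<union> B)" if h: "h \<in> U" for h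
  proof (cases "h \<in> Z")
    case False
    then have "card (insert h Z) > card Z" using finZ by simp
    then have "\<not> indep (insert h Z)" using Z(2)[of "insert h Z"] by linarith
    then obtain c where c: "\<And>i. c i \<in> k" "(\<Sum>z\<in>insert h Z. c z * z) \<in> filtration \<nu> (of_int m + 1)"
      "\<exists>z\<in>insert h Z. c z \<noteq> 0"
      using finZ h unfolding indep_def by blast
    define r where "r = (\<Sum>z\<in>Z. c z * z)"
    have sum: "c h * h + r \<in> filtration \<nu> (of_int m + 1)"
      using c(2) False finZ by (simp add: r_def)
    have "c h \<noteq> 0"
    proof
      assume "c h = 0"
      then have "(\<Sum>z\<in>Z. c z * z) \<in> filtration \<nu> (of_int m + 1)" using sum by (simp add: r_def)
      with Z(1) c(1) have "\<forall>z\<in>Z. c z = 0" unfolding indep_def by blast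
      with c(3) \<open>c h = 0\<close> show False by blast
    qed
    have "r \<in> U" unfolding r_def using c(1) finZ(2) by (intro submodule_of_sum[OF U(1)] submodule_ofD(3)[OF U(1)]) auto
    then have "c h * h + r \<in> U" using submodule_ofD(2,3)[OF U(1)] c(1) h by blast
    with sum B(3) incl have "c h * h + r \<in> lspan k (Z \<union> B)" by blast
    moreover have "r \<in> lspan k (Z \<union> B)"
      unfolding r_def using c(1) incl(1) by (intro submodule_of_sum[OF span] submodule_ofD(3)[OF span]) auto
    ultimately have "c h * h + r - r \<in> lspan k (Z \<union> B)" by (rule submodule_diff[OF span])
    then have "inverse (c h) * (c h * h) \<in> lspan k (Z \<union> B)"
      using c(1) inverse_closed by (intro submodule_ofD(3)[OF span, of "inverse (c h)" "c h * h"]) auto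
    then show ?thesis using \<open>c h \<noteq> 0\<close> by (simp add: mult.assoc[symmetric])
  qed (use incl in blast)
  then show ?thesis
    unfolding finitely_spanned_def using finZ B by (intro exI[of _ "Z \<union> B"]) auto
qed

lemma finitely_spanned_iterate:
  assumes \<nu>: "\<nu> \<in> infinite_places k x" and "submodule_of k U" "U \<subseteq> filtration \<nu> (of_int m)"
    and "finitely_spanned k (U \<inter> filtration \<nu> (of_int m + real N))"
  shows "finitely_spanned k U"
  using assms(2-)
proof (induction N arbitrary: U)
  case 0
  then show ?case by (simp add: Int_absorb2)
next
  case (Suc N)
  interpret place k \<nu> by (rule infinite_place(1)[OF \<nu>])
  let ?U = "U \<inter> filtration \<nu> (of_int m + real N)"
  have le: "filtration \<nu> (of_int m + real (Suc N)) \<subseteq> filtration \<nu> (of_int m + real N)"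
    by (intro filtration_antimono) simp
  have "finitely_spanned k ?U"
  proof (rule finitely_spanned_step[OF \<nu>, of _ "m + int N"])
    show "submodule_of k ?U" by (intro submodule_of_Int Suc.prems(1) submodule_filtration)
    show "?U \<subseteq> filtration \<nu> (of_int (m + int N))" by auto
    have "?U \<inter> filtration \<nu> (of_int (m + int N) + 1) = U \<inter> filtration \<nu> (of_int m + real (Suc N))"
      using le by (auto simp: add_ac)
    then show "finitely_spanned k (?U \<inter> filtration \<nu> (of_int (m + int N) + 1))"
      using Suc.prems(3) by simp
  qed
  then show ?case using Suc.IH Suc.prems by blast
qed

text \<open>At each place only finitely many filtration steps lie between \<open>s\<close> and
  \<open>t\<close>. The places are treated one after the other, and beyond \<open>t\<close> at all
  of them only \<open>0\<close> is left.\<close>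

lemma finitely_spanned_if_bounded:
  assumes J: "finite J" "J \<subseteq> infinite_places k x"
    and U: "submodule_of k U" "\<And>\<nu>. \<nu> \<in> J \<Longrightarrow> U \<subseteq> filtration \<nu> s"
    and zero: "\<And>h. h \<in> U \<Longrightarrow> (\<And>\<nu>. \<nu> \<in> J \<Longrightarrow> h \<in> filtration \<nu> t) \<Longrightarrow> h = 0"
  shows "finitely_spanned k U"
  using J U zero
proof (induction J arbitrary: U rule: finite_induct)
  case empty
  then have "U \<subseteq> {0}" by blast
  then have "U \<subseteq> lspan k {}" using submodule_ofD(1)[OF submodule_lspan] by blast
  then show ?case unfolding finitely_spanned_def by (intro exI[of _ "{}"]) auto
next
  case (insert \<nu> J)
  then have \<nu>: "\<nu> \<in> infinite_places k x" by simp
  interpret place k \<nu> by (rule infinite_place(1)[OF \<nu>])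
  define m where "m = \<lfloor>s\<rfloor>"
  define N where "N = nat \<lceil>t - of_int m\<rceil>"
  have N: "t \<le> of_int m + real N" unfolding N_def by linarith
  show ?case
  proof (rule finitely_spanned_iterate[OF \<nu> insert.prems(2), of m N])
    show "U \<subseteq> filtration \<nu> (of_int m)"
      using insert.prems(3)[of \<nu>] filtration_antimono[of "of_int m" s \<nu>] by (auto simp: m_def)
    show "finitely_spanned k (U \<inter> filtration \<nu> (of_int m + real N))"
    proof (rule insert.IH)
      show "J \<subseteq> infinite_places k x" using insert.prems by simp
      show "submodule_of k (U \<inter> filtration \<nu> (of_int m + real N))"
        by (intro submodule_of_Int insert.prems(2) submodule_filtration)
      show "U \<inter> filtration \<nu> (of_int m + real N) \<subseteq> filtration \<nu>' s" if "\<nu>' \<in> J" for \<nu>'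
        using insert.prems(3)[of \<nu>'] that by auto
      fix h assume h: "h \<in> U \<inter> filtration \<nu> (of_int m + real N)"
        and hJ: "\<And>\<nu>'. \<nu>' \<in> J \<Longrightarrow> h \<in> filtration \<nu>' t"
      have "h \<in> filtration \<nu>' t" if "\<nu>' \<in> insert \<nu> J" for \<nu>'
        using that h hJ filtration_antimono[OF N] by blast
      with h show "h = 0" by (intro insert.prems(4)) auto
    qed
  qed
qed

text \<open>Without poles at infinity the element is constant, and nonzero constants have value
  \<open>0\<close>.\<close>

lemma integral_positive_zero:
  assumes "h \<in> integral_closure kx" "infinite_places k x \<noteq> {}"
    and pos: "\<And>\<nu>. \<nu> \<in> infinite_places k x \<Longrightarrow> h \<in> filtration \<nu> 1"
  shows "h = 0"
proof (rule ccontr)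
  assume "h \<noteq> 0"
  then have pos: "\<nu> h \<ge> 1" if "\<nu> \<in> infinite_places k x" for \<nu>
    using pos[OF that] by (simp add: filtration_def)
  have "h \<in> k" using place_with_pole[OF assms(1)] pos by force
  obtain \<nu> where \<nu>: "\<nu> \<in> infinite_places k x" using assms(2) by blast
  interpret place k \<nu> by (rule infinite_place(1)[OF \<nu>])
  show False using const[OF \<open>h \<in> k\<close> \<open>h \<noteq> 0\<close>] pos[OF \<nu>] by simp
qed

lemma base_in_kx: "k \<subseteq> kx"
proof
  fix c assume "c \<in> k"
  then show "c \<in> kx"
    using polys_over_monom[of c 0]
    by (intro CollectI exI[of _ "Polynomial.monom c 0"]) (simp add: poly_monom)
qed

lemma frac_ideal_submodule:
  assumes "a \<in> frac_ideals (integral_closure kx)"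
  shows "submodule_of kx a" "submodule_of k a"
proof -
  show "submodule_of kx a"
    by (rule submodule_of_mono[OF frac_idealsD(1)[OF assms]]) (rule subsetI, rule A.integral_closure_base)
  then show "submodule_of k a" using base_in_kx by (rule submodule_of_mono)
qed

lemma box_finitely_spanned:
  assumes a: "a \<in> frac_ideals (integral_closure kx)"
    and S: "finite (infinite_places k x)" "infinite_places k x \<noteq> {}"
  shows "finitely_spanned k {h\<in>a. \<forall>\<nu>\<in>infinite_places k x. h \<in> filtration \<nu> s}"
proof -
  obtain d where d: "d \<noteq> 0" "\<forall>f\<in>a. d * f \<in> integral_closure kx" using frac_idealsD(3)[OF a] by blast
  \<comment> \<open>Chosen so that values of at least \<open>t\<close> remain at least
    \<open>1\<close> after multiplication by the denominator \<open>d\<close>.\<close>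
  define t where "t = 1 + (\<Sum>\<nu>\<in>infinite_places k x. \<bar>\<nu> d\<bar>)"
  show ?thesis
  proof (rule finitely_spanned_if_bounded[OF S(1) order.refl, where t = t and s = s])
    have "{h\<in>a. \<forall>\<nu>\<in>infinite_places k x. h \<in> filtration \<nu> s} = a \<inter> (\<Inter>\<nu>\<in>infinite_places k x. filtration \<nu> s)"
      by auto
    moreover have "submodule_of k (\<Inter>\<nu>\<in>infinite_places k x. filtration \<nu> s)"
      by (intro submodule_of_INT place.submodule_filtration infinite_place(1))
    ultimately show "submodule_of k {h\<in>a. \<forall>\<nu>\<in>infinite_places k x. h \<in> filtration \<nu> s}"
      using frac_ideal_submodule(2)[OF a] submodule_of_Int by metis
    fix h assume h: "h \<in> {h\<in>a. \<forall>\<nu>\<in>infinite_places k x. h \<in> filtration \<nu> s}"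
      and ht: "\<And>\<nu>. \<nu> \<in> infinite_places k x \<Longrightarrow> h \<in> filtration \<nu> t"
    have "d * h \<in> filtration \<nu> 1" if \<nu>: "\<nu> \<in> infinite_places k x" for \<nu>
    proof -
      interpret place k \<nu> by (rule infinite_place(1)[OF \<nu>])
      have "\<bar>\<nu> d\<bar> \<le> (\<Sum>\<nu>\<in>infinite_places k x. \<bar>\<nu> d\<bar>)" using S(1) \<nu> by (intro member_le_sum) auto
      then have "1 \<le> \<nu> d + t" unfolding t_def by linarith
      moreover have "d * h \<in> filtration \<nu> (\<nu> d + t)"
        by (intro filtration_mult ht[OF \<nu>]) (simp add: filtration_def)
      ultimately show ?thesis using filtration_antimono by blast
    qed
    then have "d * h = 0" using d h S(2) by (intro integral_positive_zero) auto
    with d show "h = 0" by simp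
  qed auto
qed

text \<open>Division over the field type would not show that quotient and remainder have
  coefficients in \<open>k\<close>, so it is carried out with attention to the coefficients.\<close>

lemma division_over:
  assumes g: "g \<in> polys_over k" "g \<noteq> 0" and f: "f \<in> polys_over k"
  shows "\<exists>q\<in>polys_over k. \<exists>r\<in>polys_over k. f = g * q + r \<and> (r = 0 \<or> Polynomial.degree r < Polynomial.degree g)"
  using f
proof (induction "Polynomial.degree f" arbitrary: f rule: less_induct)
  case less
  interpret P: idom_subring "polys_over k" by (rule idom_subring_polys_over)
  show ?case
  proof (cases "f = 0 \<or> Polynomial.degree f < Polynomial.degree g")
    case True
    then show ?thesis
      using less.prems P.zero_closed by (intro bexI[of _ 0] bexI[of _ f]) auto
  next
    case False
    define c where "c = Polynomial.monom (Polynomial.lead_coeff f / Polynomial.lead_coeff g)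
      (Polynomial.degree f - Polynomial.degree g)"
    define f' where "f' = f - g * c"
    have c: "c \<in> polys_over k"
      unfolding c_def using less.prems g by (intro polys_over_monom divide_closed) auto
    have f': "f' \<in> polys_over k" unfolding f'_def using less.prems g c by (intro P.diff_closed P.mult_closed)
    have "Polynomial.degree (g * c) \<le> Polynomial.degree f"
      using degree_mult_le[of g c] degree_monom_le[of "Polynomial.lead_coeff f / Polynomial.lead_coeff g"
          "Polynomial.degree f - Polynomial.degree g"] False unfolding c_def by linarith
    then have le: "Polynomial.degree f' \<le> Polynomial.degree f" unfolding f'_def by (intro degree_diff_le) auto
    have "Polynomial.coeff (c * g) (Polynomial.degree f) = Polynomial.lead_coeff f"
      using False g(2) unfolding c_def by (simp add: coeff_monom_mult)
    then have "Polynomial.coeff f' (Polynomial.degree f) = 0" by (simp add: f'_def mult.commute)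
    then have "f' = 0 \<or> Polynomial.degree f' < Polynomial.degree f"
      using le by (metis leading_coeff_0_iff order_le_imp_less_or_eq)
    then have "\<exists>q\<in>polys_over k. \<exists>r\<in>polys_over k. f' = g * q + r \<and> (r = 0 \<or> Polynomial.degree r < Polynomial.degree g)"
    proof
      assume "f' = 0"
      then show ?thesis using P.zero_closed by (intro bexI[of _ 0]) auto
    next
      assume "Polynomial.degree f' < Polynomial.degree f"
      then show ?thesis using less.hyps f' by blast
    qed
    then obtain q r where qr: "q \<in> polys_over k" "r \<in> polys_over k" "f' = g * q + r"
      "r = 0 \<or> Polynomial.degree r < Polynomial.degree g" by blast
    have "f = g * (q + c) + r" using qr(3) by (simp add: f'_def algebra_simps)
    moreover have "q + c \<in> polys_over k" using qr(1) c by (rule P.add_closed)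
    ultimately show ?thesis using qr by blast
  qed
qed

text \<open>The coordinates are divided by the common denominator \<open>\<beta>\<close>; the
  remainders give proper fractions, which have no poles at infinity. So the bound depends on
  \<open>W\<close> but not on \<open>h\<close>.\<close>

lemma fundamental_domain:
  assumes W: "A.spans_fractions W"
  shows "\<exists>l\<in>lspan kx W. \<forall>\<nu>\<in>infinite_places k x. h - l \<in> filtration \<nu> (- (\<Sum>v\<in>W. \<bar>\<nu> v\<bar>))"
proof -
  have finW: "finite W" using W unfolding A.spans_fractions_def by blast
  obtain b where b: "b \<in> kx - {0}" "b * h \<in> lspan kx W"
    using W unfolding A.spans_fractions_def by blast
  obtain \<beta> where "\<beta> \<in> polys_over k" "b = poly \<beta> x" using b(1) by blast
  moreover from this have "\<beta> \<noteq> 0" using b(1) by auto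
  ultimately have \<beta>: "\<beta> \<in> polys_over k" "b = poly \<beta> x" "\<beta> \<noteq> 0" by simp_all
  obtain m where m: "\<forall>v. m v \<in> kx" "b * h = (\<Sum>v\<in>W. m v * v)" using b(2) by (auto simp: lspan_def)
  have "\<forall>v. \<exists>qr. fst qr \<in> polys_over k \<and> snd qr \<in> polys_over k \<and>
    m v = poly (\<beta> * fst qr + snd qr) x \<and> (snd qr = 0 \<or> Polynomial.degree (snd qr) < Polynomial.degree \<beta>)"
  proof
    fix v
    obtain f where f: "f \<in> polys_over k" "m v = poly f x" using m(1) by blast
    obtain q r where "q \<in> polys_over k" "r \<in> polys_over k" "f = \<beta> * q + r"
      "r = 0 \<or> Polynomial.degree r < Polynomial.degree \<beta>"
      using division_over[OF \<beta>(1,3) f(1)] by blast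
    with f(2) show "\<exists>qr. fst qr \<in> polys_over k \<and> snd qr \<in> polys_over k \<and>
      m v = poly (\<beta> * fst qr + snd qr) x \<and> (snd qr = 0 \<or> Polynomial.degree (snd qr) < Polynomial.degree \<beta>)"
      by (intro exI[of _ "(q, r)"]) simp
  qed
  from choice[OF this] obtain qr where "\<forall>v. fst (qr v) \<in> polys_over k \<and> snd (qr v) \<in> polys_over k \<and>
    m v = poly (\<beta> * fst (qr v) + snd (qr v)) x \<and>
    (snd (qr v) = 0 \<or> Polynomial.degree (snd (qr v)) < Polynomial.degree \<beta>)" ..
  then have qr: "\<And>v. fst (qr v) \<in> polys_over k" "\<And>v. snd (qr v) \<in> polys_over k"
    "\<And>v. m v = poly (\<beta> * fst (qr v) + snd (qr v)) x"
    "\<And>v. snd (qr v) = 0 \<or> Polynomial.degree (snd (qr v)) < Polynomial.degree \<beta>"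
    by blast+
  define l where "l = (\<Sum>v\<in>W. poly (fst (qr v)) x * v)"
  have "l \<in> lspan kx W"
    unfolding l_def lspan_def using qr(1) by (intro CollectI exI[of _ "\<lambda>v. poly (fst (qr v)) x"]) blast
  moreover have "h - l \<in> filtration \<nu> (- (\<Sum>v\<in>W. \<bar>\<nu> v\<bar>))" if \<nu>: "\<nu> \<in> infinite_places k x" for \<nu>
  proof -
    interpret place k \<nu> by (rule infinite_place(1)[OF \<nu>])
    have "b * (h - l) = (\<Sum>v\<in>W. m v * v - b * (poly (fst (qr v)) x * v))"
      by (simp add: right_diff_distrib m(2) l_def sum_distrib_left sum_subtractf)
    also have "\<dots> = (\<Sum>v\<in>W. b * (poly (snd (qr v)) x / poly \<beta> x * v))"
      using b(1) by (intro sum.cong) (auto simp: qr(3) \<beta>(2) algebra_simps)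
    also have "\<dots> = b * (\<Sum>v\<in>W. poly (snd (qr v)) x / poly \<beta> x * v)" by (simp add: sum_distrib_left)
    finally have "h - l = (\<Sum>v\<in>W. poly (snd (qr v)) x / poly \<beta> x * v)" using b(1) by simp
    also have "\<dots> \<in> filtration \<nu> (- (\<Sum>v\<in>W. \<bar>\<nu> v\<bar>))"
    proof (rule submodule_of_sum[OF submodule_filtration])
      fix v assume "v \<in> W"
      then have "\<bar>\<nu> v\<bar> \<le> (\<Sum>v\<in>W. \<bar>\<nu> v\<bar>)" using finW by (intro member_le_sum) auto
      then have "v \<in> filtration \<nu> (- (\<Sum>v\<in>W. \<bar>\<nu> v\<bar>))" by (auto simp: filtration_def)
      moreover have "poly (snd (qr v)) x / poly \<beta> x \<in> filtration \<nu> 0"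
        using proper_fraction_value[OF \<nu> qr(2) \<beta>(1,3) qr(4)] filtration_antimono[of 0 1] by auto
      ultimately show "poly (snd (qr v)) x / poly \<beta> x * v \<in> filtration \<nu> (- (\<Sum>v\<in>W. \<bar>\<nu> v\<bar>))"
        using filtration_mult by fastforce
    qed
    finally show ?thesis .
  qed
  ultimately show ?thesis by blast
qed

text \<open>Otherwise the space \<open>U\<close> of elements of \<open>a\<close> with values at
  least \<open>- C\<close> on \<open>J\<close> would be finite-dimensional, and pole orders at
  \<open>\<omega>\<close> would be bounded on \<open>U\<close>. But high powers of a separating
  element, corrected by a bounded remainder to lie in \<open>a\<close>, violate every such
  bound.\<close>

lemma small_element_exists:
  assumes a: "a \<in> frac_ideals (integral_closure kx)"
    and J: "finite J" "J \<subseteq> infinite_places k x" and \<omega>: "\<omega> \<in> infinite_places k x" "\<omega> \<notin> J"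
  shows "\<exists>h\<in>a. h \<noteq> 0 \<and> (\<forall>\<nu>\<in>J. \<nu> h \<ge> t)"
proof (rule ccontr)
  assume no: "\<not> ?thesis"
  obtain W0 where W0: "A.spans_fractions W0" using spanning_set_exists by blast
  obtain W where W: "A.spans_fractions W" "W \<subseteq> a" using A.frac_ideal_basis[OF W0 a] by blast
  \<comment> \<open>A single constant that bounds the remainders modulo the span of \<open>W\<close>
    at all places of \<open>insert \<omega> J\<close>.\<close>
  define C where "C = (\<Sum>\<nu>\<in>insert \<omega> J. \<Sum>v\<in>W. \<bar>\<nu> v\<bar>)"
  have C: "(\<Sum>v\<in>W. \<bar>\<nu> v\<bar>) \<le> C" if "\<nu> \<in> insert \<omega> J" for \<nu>
    unfolding C_def using that J(1)
    by (intro member_le_sum[of \<nu> "insert \<omega> J" "\<lambda>\<nu>. \<Sum>v\<in>W. \<bar>\<nu> v\<bar>"]) (auto intro: sum_nonneg)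
  have "C \<ge> 0" unfolding C_def by (intro sum_nonneg) auto
  define U where "U = a \<inter> (\<Inter>\<nu>\<in>J. filtration \<nu> (- C))"
  have inf: "submodule_of k (\<Inter>\<nu>\<in>J. filtration \<nu> (- C))"
    using J(2) by (intro submodule_of_INT place.submodule_filtration infinite_place(1)) auto
  have "finitely_spanned k U"
  proof (rule finitely_spanned_if_bounded[OF J, where t = t and s = "- C"])
    show "submodule_of k U" unfolding U_def by (intro submodule_of_Int frac_ideal_submodule[OF a] inf)
    show "h = 0" if "h \<in> U" "\<And>\<nu>. \<nu> \<in> J \<Longrightarrow> h \<in> filtration \<nu> t" for h
    proof (rule ccontr)
      assume "h \<noteq> 0"
      then have "\<nu> h \<ge> t" if "\<nu> \<in> J" for \<nu>
        using \<open>\<And>\<nu>. \<nu> \<in> J \<Longrightarrow> h \<in> filtration \<nu> t\<close>[OF that] by (simp add: filtration_def)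
      with no \<open>h \<noteq> 0\<close> \<open>h \<in> U\<close> show False by (auto simp: U_def)
    qed
  qed (auto simp: U_def)
  then obtain B where B: "finite B" "U \<subseteq> lspan k B" by (auto simp: finitely_spanned_def)
  interpret w: place k \<omega> by (rule infinite_place(1)[OF \<omega>(1)])
  have "finite (\<omega> ` (U - {0}))"
    using finite_subset[OF _ w.lspan_finitely_many_values[OF B(1)]] B(2) by (metis Diff_mono image_mono order.refl)
  then obtain b where b: "\<And>h. h \<in> U \<Longrightarrow> h \<noteq> 0 \<Longrightarrow> b \<le> \<omega> h"
  proof -
    assume fin: "finite (\<omega> ` (U - {0}))"
    \<comment> \<open>The inserted \<open>0\<close> covers the case that \<open>U\<close> is
      trivial.\<close>
    have "Min (insert 0 (\<omega> ` (U - {0}))) \<le> \<omega> h" if "h \<in> U" "h \<noteq> 0" for h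
      using fin that by (intro Min_le) auto
    then show thesis using that by blast
  qed
  obtain z where z: "z \<noteq> 0" "\<forall>\<nu>\<in>J. \<nu> z > 0" "\<omega> z < 0"
    using separating_element[OF subfield_set_axioms J(1) _ w.is_place \<omega>(2)] J(2)
      place.is_place[OF infinite_place(1)] by blast
  \<comment> \<open>By integrality \<open>\<omega> z \<le> - 1\<close>, so this power has value
    below \<open>b\<close> and below \<open>- C\<close>. The latter ensures that the remainder does
    not change the value at \<open>\<omega>\<close>.\<close>
  define M where "M = nat \<lceil>C + \<bar>b\<bar>\<rceil> + 1"
  have M: "C + \<bar>b\<bar> < real M" unfolding M_def by linarith
  have "\<omega> z \<le> - 1" using w.filtration_Suc[of "1 / z" 0] z by (simp add: w.divide w.one)
  then have "real M * \<omega> z \<le> real M * (- 1)" by (intro mult_left_mono) auto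
  then have "\<omega> (z ^ M) \<le> - real M" using z(1) by (simp add: w.power)
  then have wz: "\<omega> (z ^ M) < - C" "\<omega> (z ^ M) < b" using M \<open>C \<ge> 0\<close> by linarith+
  obtain l where l: "l \<in> lspan kx W"
    "\<forall>\<nu>\<in>infinite_places k x. z ^ M - l \<in> filtration \<nu> (- (\<Sum>v\<in>W. \<bar>\<nu> v\<bar>))"
    using fundamental_domain[OF W(1), of "z ^ M"] by blast
  have e: "z ^ M - l \<in> filtration \<nu> (- C)" if "\<nu> \<in> insert \<omega> J" for \<nu>
    using l(2) that J(2) \<omega>(1) C[OF that] filtration_antimono[of "- C" "- (\<Sum>v\<in>W. \<bar>\<nu> v\<bar>)" \<nu>] by auto
  have "l \<in> U"
    unfolding U_def
  proof (intro IntI INT_I)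
    show "l \<in> a" using lspan_subset[OF frac_ideal_submodule(1)[OF a] W(2)] l(1) by blast
    fix \<nu> assume \<nu>: "\<nu> \<in> J"
    interpret v: place k \<nu> using infinite_place(1) \<nu> J(2) by blast
    have "0 \<le> real M * \<nu> z" using z(2) \<nu> by (simp add: less_imp_le)
    then have "z ^ M \<in> filtration \<nu> (- C)"
      using z(1) \<open>C \<ge> 0\<close> by (simp add: filtration_def v.power)
    then have "z ^ M - (z ^ M - l) \<in> filtration \<nu> (- C)"
      by (rule submodule_diff[OF v.submodule_filtration]) (rule e, use \<nu> in simp)
    then show "l \<in> filtration \<nu> (- C)" by simp
  qed
  have "l \<noteq> 0 \<and> \<omega> l = \<omega> (z ^ M)"
  proof (cases "z ^ M - l = 0")
    case True
    then have "l = z ^ M" by simp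
    with z(1) show ?thesis by simp
  next
    case False
    then have "\<omega> (z ^ M) < \<omega> (- (z ^ M - l))"
      using e[of \<omega>] wz(1) by (auto simp: filtration_def w.minus simp del: minus_diff_eq)
    from w.add_eq[OF _ _ this] False z(1) show ?thesis by simp
  qed
  with b[OF \<open>l \<in> U\<close>] wz(2) show False by simp
qed

end

section \<open>Residue degrees and the function field case\<close>

context function_field
begin

context
  fixes \<nu> assumes \<nu>: "\<nu> \<in> infinite_places k x"
begin

interpretation place k \<nu> by (rule infinite_place(1)[OF \<nu>])

lemma val_max_eq: "val_max \<nu> = filtration \<nu> 1"
proof -
  have "\<nu> f \<ge> 1 \<longleftrightarrow> \<nu> f > 0" if "f \<noteq> 0" for f
    using filtration_Suc[OF that, of 0] by auto
  then show ?thesis by (auto simp: val_max_def filtration_def)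
qed

lemma val_ring_eq: "val_ring \<nu> = K_ring \<lparr>carrier := filtration \<nu> 0\<rparr>"
  by (simp add: val_ring_def filtration_def)

lemma val_ring_simps [simp]:
  "carrier (val_ring \<nu>) = filtration \<nu> 0" "a \<otimes>\<^bsub>val_ring \<nu>\<^esub> b = a * b" "a \<oplus>\<^bsub>val_ring \<nu>\<^esub> b = a + b"
  "\<one>\<^bsub>val_ring \<nu>\<^esub> = 1" "\<zero>\<^bsub>val_ring \<nu>\<^esub> = 0"
  by (simp_all add: val_ring_eq)

lemma ring_val_ring: "ring (val_ring \<nu>)"
  unfolding val_ring_eq
proof (intro K_ring.subring_is_ring K_ring.subringI)
  fix a b :: 'a assume "a \<in> filtration \<nu> 0" "b \<in> filtration \<nu> 0"
  then show "a \<otimes>\<^bsub>K_ring\<^esub> b \<in> filtration \<nu> 0" "a \<oplus>\<^bsub>K_ring\<^esub> b \<in> filtration \<nu> 0"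
    using filtration_mult[of a 0 b 0] filtration_add by simp_all
qed (use const_filtration[OF one_closed] submodule_minus[OF submodule_filtration] in auto)

lemma ideal_val_max: "ideal (val_max \<nu>) (val_ring \<nu>)"
proof -
  interpret R: ring "val_ring \<nu>" by (rule ring_val_ring)
  have a_inv: "\<ominus>\<^bsub>val_ring \<nu>\<^esub> a = - a" if "a \<in> filtration \<nu> 0" for a
    using that submodule_minus[OF submodule_filtration] by (intro R.minus_equality) auto
  have sub: "filtration \<nu> 1 \<subseteq> filtration \<nu> 0" by (rule filtration_antimono) simp
  show ?thesis
    unfolding val_max_eq
  proof (rule idealI[OF ring_val_ring])
    show "subgroup (filtration \<nu> 1) (add_monoid (val_ring \<nu>))"
    proof (rule R.add.subgroupI)
      show "filtration \<nu> 1 \<subseteq> carrier (val_ring \<nu>)" using sub by simp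
      show "filtration \<nu> 1 \<noteq> {}" by (auto simp: filtration_def)
      fix a assume a: "a \<in> filtration \<nu> 1"
      then show "\<ominus>\<^bsub>val_ring \<nu>\<^esub> a \<in> filtration \<nu> 1"
        using a_inv sub submodule_minus[OF submodule_filtration] by auto
      fix b assume "b \<in> filtration \<nu> 1"
      with a show "a \<oplus>\<^bsub>val_ring \<nu>\<^esub> b \<in> filtration \<nu> 1" by (simp add: filtration_add)
    qed
  next
    fix a c assume "a \<in> filtration \<nu> 1" "c \<in> carrier (val_ring \<nu>)"
    then show "c \<otimes>\<^bsub>val_ring \<nu>\<^esub> a \<in> filtration \<nu> 1" "a \<otimes>\<^bsub>val_ring \<nu>\<^esub> c \<in> filtration \<nu> 1"
      using filtration_mult[of a 1 c 0] by (simp_all add: mult.commute)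
  qed
qed

text \<open>\<open>dim\<close> yields the dimension once finiteness is known, and that comes from
  \<open>residually_dependent\<close>: any \<open>Suc (card W)\<close> residue classes are
  dependent. Positivity then holds because the residue field is nontrivial.\<close>

lemma residue_deg_pos: "residue_deg k \<nu> > 0"
proof -
  let ?R = "val_ring \<nu>" and ?S = "residue_field \<nu>" and ?h = "\<lambda>c. val_max \<nu> +>\<^bsub>val_ring \<nu>\<^esub> c"
  interpret R: ring ?R by (rule ring_val_ring)
  interpret I: ideal "val_max \<nu>" ?R by (rule ideal_val_max)
  interpret S: ring ?S unfolding residue_field_def by (rule I.quotient_is_ring)
  interpret H: ring_hom_ring ?R ?S ?h
    unfolding residue_field_def by (rule I.rcos_ring_hom_ring)
  have zero_iff: "?h c = \<zero>\<^bsub>?S\<^esub> \<longleftrightarrow> c \<in> filtration \<nu> 1" if "c \<in> filtration \<nu> 0" for c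
    using I.rcos_const_imp_mem[of c] I.a_rcos_const[of c] that
    by (auto simp: residue_field_def FactRing_def val_max_eq)
  have "\<one>\<^bsub>?S\<^esub> \<noteq> \<zero>\<^bsub>?S\<^esub>"
  proof -
    have "(1 :: 'a) \<in> filtration \<nu> 0" "(1 :: 'a) \<notin> filtration \<nu> 1" by (simp_all add: filtration_def one)
    then show ?thesis using zero_iff[of 1] H.hom_one by simp
  qed
  have "field (?R \<lparr>carrier := k\<rparr>)"
    using K_ring.subfield_iff(2)[OF subfield] by (simp add: val_ring_eq)
  then have k: "subfield k ?R"
    using const_filtration by (intro R.subfield_iff(1)) auto
  have K: "subfield (?h ` k) ?S"
    by (rule H.img_is_subfield(2)[OF k \<open>\<one>\<^bsub>?S\<^esub> \<noteq> \<zero>\<^bsub>?S\<^esub>\<close>])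
  have carrier_S: "carrier ?S = ?h ` filtration \<nu> 0"
    by (auto simp: residue_field_def FactRing_def A_RCOSETS_def' a_r_coset_def')
  obtain W where W: "A.spans_fractions W" using spanning_set_exists by blast
  have "\<not> S.independent (?h ` k) Us" if "length Us = Suc (card W)" "set Us \<subseteq> carrier ?S" for Us
  proof -
    have "\<forall>u\<in>set Us. \<exists>z\<in>filtration \<nu> 0. u = ?h z" using that(2) carrier_S by blast
    then obtain f where f: "\<And>u. u \<in> set Us \<Longrightarrow> f u \<in> filtration \<nu> 0 \<and> u = ?h (f u)" by metis
    define zs where "zs = map f Us"
    have zs: "length zs = Suc (card W)" "set zs \<subseteq> filtration \<nu> 0" "Us = map ?h zs"
      using that(1) f by (auto simp: zs_def intro!: map_idI[symmetric])
    obtain c where c: "\<forall>i. c i \<in> k" "\<exists>i\<in>{..<Suc (card W)}. c i \<noteq> 0"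
      "(\<Sum>i\<in>{..<Suc (card W)}. c i * (zs ! i)) \<in> filtration \<nu> 1"
      using residually_dependent[OF W \<nu>, of "{..<Suc (card W)}" "\<lambda>i. zs ! i"] zs(1,2) by (auto simp: subset_iff)
    define cs where "cs = map c [0..<Suc (card W)]"
    have cs: "set cs \<subseteq> k" "length cs = length zs" using c(1) zs(1) by (auto simp: cs_def)
    have "R.combine cs zs = (\<Sum>i<length zs. cs ! i * zs ! i)" if "length cs = length zs" for cs zs
      using that
    proof (induction cs zs rule: list_induct2)
      case (Cons c cs z zs)
      then show ?case by (simp add: sum.lessThan_Suc_shift del: sum.lessThan_Suc)
    qed simp
    then have "R.combine cs zs = (\<Sum>i\<in>{..<Suc (card W)}. c i * (zs ! i))"
      using cs zs(1) by (simp add: cs_def del: upt_Suc sum.lessThan_Suc)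
    then have comb: "R.combine cs zs \<in> filtration \<nu> 1" using c(3) by simp
    then have "R.combine cs zs \<in> filtration \<nu> 0" using filtration_antimono[of 0 1 \<nu>] by auto
    then have "?h (R.combine cs zs) = \<zero>\<^bsub>?S\<^esub>" using comb zero_iff by simp
    moreover have "S.combine (map ?h cs) Us = ?h (R.combine cs zs)"
      unfolding zs(3) using cs(1) zs(2) const_filtration by (intro H.combine_hom) auto
    ultimately have comb0: "S.combine (map ?h cs) Us = \<zero>\<^bsub>?S\<^esub>" by simp
    have "\<not> set (take (length Us) (map ?h cs)) \<subseteq> {\<zero>\<^bsub>?S\<^esub>}"
    proof
      assume *: "set (take (length Us) (map ?h cs)) \<subseteq> {\<zero>\<^bsub>?S\<^esub>}"
      obtain i where i: "i < Suc (card W)" "c i \<noteq> 0" using c(2) by blast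
      have "?h (c i) \<in> set (take (length Us) (map ?h cs))"
        using i that(1) by (auto simp: cs_def simp del: upt_Suc)
      with * have "?h (c i) = \<zero>\<^bsub>?S\<^esub>" by blast
      then have "c i \<in> filtration \<nu> 1" using zero_iff const_filtration c(1) by blast
      then show False using i(2) const[of "c i"] c(1) by (simp add: filtration_def)
    qed
    then show ?thesis
      using S.non_trivial_combine_imp_dependent[OF K, of "map ?h cs" Us] comb0 cs(1) by auto
  qed
  note bounded = this
  have fin: "S.finite_dimension (?h ` k) (carrier ?S)"
  proof (rule ccontr)
    assume inf: "\<not> ?thesis"
    \<comment> \<open>In infinite dimension an independent list never spans, so it can be prolonged
      to any length.\<close>
    have "\<exists>Us. length Us = m \<and> set Us \<subseteq> carrier ?S \<and> S.independent (?h ` k) Us" for m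
    proof (induction m)
      case 0
      then show ?case by (intro exI[of _ "[]"]) auto
    next
      case (Suc m)
      then obtain Us where Us: "length Us = m" "set Us \<subseteq> carrier ?S" "S.independent (?h ` k) Us" by blast
      have "S.Span (?h ` k) Us \<noteq> carrier ?S"
        using S.dimension_independent[OF Us(3)] inf S.finite_dimensionI by metis
      moreover have "S.Span (?h ` k) Us \<subseteq> carrier ?S"
        using S.Span_in_carrier[OF _ Us(2)] subfieldE(3)[OF K] by blast
      ultimately obtain u where "u \<in> carrier ?S" "u \<notin> S.Span (?h ` k) Us" by blast
      with Us show ?case by (intro exI[of _ "u # Us"]) (auto intro!: S.li_Cons simp del: S.Span.simps)
    qed
    with bounded show False by blast
  qed
  have "S.dimension (residue_deg k \<nu>) (?h ` k) (carrier ?S)"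
    using S.finite_dimensionE[OF K fin] by (simp add: residue_deg_def over_def)
  moreover have "\<not> S.dimension 0 (?h ` k) (carrier ?S)"
    using S.dimension_zero[OF K] \<open>\<one>\<^bsub>?S\<^esub> \<noteq> \<zero>\<^bsub>?S\<^esub>\<close> S.one_closed by blast
  ultimately show ?thesis by (metis neq0_conv)
qed

end

lemma place_system_function_field:
  assumes "bij_betw p {1..n+1} (infinite_places k x)" "q > 1"
  shows "place_system (FunctionField k x q) n p"
proof -
  let ?K = "FunctionField k x q"
  have int_ring: "int_ring ?K = integral_closure kx" by (simp add: simple_extension_eq)
  have surj: "p ` {1..n+1} = infinite_places k x" using assms(1) by (rule bij_betw_imp_surj_on)
  then have S: "finite (infinite_places k x)" "infinite_places k x \<noteq> {}"
    using finite_imageI[of "{1..n+1}" p] by auto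
  have p: "p i \<in> infinite_places k x" if "i \<in> {1..n+1}" for i using surj that by blast
  note pl = infinite_place(1)[OF p]
  show ?thesis
  proof (rule place_system.intro)
    show "bij_betw p {1..n+1} (places ?K)" using assms(1) by simp
    show "base ?K > 1" using assms(2) by simp
    show "place_deg ?K (p i) > 0" if "i \<in> {1..n+1}" for i using residue_deg_pos[OF p[OF that]] by simp
    show "p i (f * g) = p i f + p i g" if "i \<in> {1..n+1}" "f \<noteq> 0" "g \<noteq> 0" for i f g
      using place.mult[OF pl[OF that(1)] that(2,3)] .
    show "p i f \<in> val_group ?K" if "i \<in> {1..n+1}" "f \<noteq> 0" for i f
      using place.integral_value[OF pl[OF that(1)] that(2)] by simp
    show "idom_subring (int_ring ?K)" unfolding int_ring by (rule A.idom_subring_integral_closure)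
    show "\<exists>b\<in>int_ring ?K - {0}. b * h \<in> int_ring ?K" for h
    proof -
      obtain W where "A.spans_fractions W" using spanning_set_exists by blast
      from A.integral_multiple[OF this, of h] show ?thesis
        unfolding int_ring using A.integral_closure_base by blast
    qed
  next
    fix a :: "'a set" and \<epsilon>
    assume "a \<in> frac_ideals (int_ring ?K)" and stable: "\<And>y. y \<in> a \<Longrightarrow> \<epsilon> * y \<in> a"
    note a = this(1)[unfolded int_ring]
    obtain W0 where "A.spans_fractions W0" using spanning_set_exists by blast
    from A.frac_ideal_basis[OF this a] obtain W where W: "A.spans_fractions W" "W \<subseteq> a" by blast
    have finW: "finite W" using W(1) unfolding A.spans_fractions_def by blast
    define C where "C = (\<Sum>\<nu>\<in>infinite_places k x. \<Sum>v\<in>W. \<bar>\<nu> v\<bar>)"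
    have C: "(\<Sum>v\<in>W. \<bar>\<nu> v\<bar>) \<le> C" if "\<nu> \<in> infinite_places k x" for \<nu>
      unfolding C_def using that S(1)
      by (intro member_le_sum[of \<nu> "infinite_places k x" "\<lambda>\<nu>. \<Sum>v\<in>W. \<bar>\<nu> v\<bar>"]) (auto intro: sum_nonneg)
    obtain B where B: "finite B" "B \<subseteq> {h\<in>a. \<forall>\<nu>\<in>infinite_places k x. h \<in> filtration \<nu> (- C)}"
      "{h\<in>a. \<forall>\<nu>\<in>infinite_places k x. h \<in> filtration \<nu> (- C)} \<subseteq> lspan k B"
      using box_finitely_spanned[OF a S, of "- C"] unfolding finitely_spanned_def by blast
    have "\<epsilon> \<in> integral_closure kx"
    proof (rule A.unit_if_stable[OF finW W(2) B(1) _ frac_ideal_submodule(1)[OF a] frac_idealsD(2)[OF a] _ stable])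
      show "B \<subseteq> a" using B(2) by blast
      fix h assume "h \<in> a"
      obtain l where l: "l \<in> lspan kx W"
        "\<forall>\<nu>\<in>infinite_places k x. h - l \<in> filtration \<nu> (- (\<Sum>v\<in>W. \<bar>\<nu> v\<bar>))"
        using fundamental_domain[OF W(1)] by blast
      have "l \<in> a" using lspan_subset[OF frac_ideal_submodule(1)[OF a] W(2)] l(1) by blast
      then have "h - l \<in> a" using A.submodule_diff[OF frac_ideal_submodule(1)[OF a] \<open>h \<in> a\<close>] by blast
      moreover have "h - l \<in> filtration \<nu> (- C)" if "\<nu> \<in> infinite_places k x" for \<nu>
        using l(2) that C[OF that] filtration_antimono[of "- C" "- (\<Sum>v\<in>W. \<bar>\<nu> v\<bar>)" \<nu>] by auto
      ultimately have "h - l \<in> lspan k B" using B(3) by blast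
      then have "h - l \<in> lspan kx B" unfolding lspan_def using base_in_kx by blast
      with l(1) show "\<exists>l\<in>lspan kx W. h - l \<in> lspan kx B" by blast
    qed
    then show "\<epsilon> \<in> int_ring ?K" unfolding int_ring .
  next
    fix a :: "'a set" and C assume "a \<in> frac_ideals (int_ring ?K)"
    note a = this[unfolded int_ring]
    define Y where "Y = {h\<in>a. \<forall>\<nu>\<in>infinite_places k x. h \<in> filtration \<nu> (- C)}"
    obtain B where B: "finite B" "Y \<subseteq> lspan k B"
      using box_finitely_spanned[OF a S, of "- C"] unfolding finitely_spanned_def Y_def by blast
    let ?Z = "{h\<in>a. h \<noteq> 0 \<and> (\<forall>i\<in>{1..n+1}. - p i h \<le> C)}"
    have "?Z \<subseteq> lspan k B - {0}"
    proof -
      have "h \<in> Y" if "h \<in> ?Z" for h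
        using that unfolding Y_def surj[symmetric] by (auto simp: filtration_def minus_le_iff)
      with B(2) show ?thesis by blast
    qed
    \<comment> \<open>The box itself may be infinite, but its value vectors lie in a product of
      finite sets, one for each place.\<close>
    moreover have "(\<lambda>h. \<lambda>i\<in>{1..n+1}. p i h) ` (lspan k B - {0})
        \<subseteq> PiE {1..n+1} (\<lambda>i. p i ` (lspan k B - {0}))"
      by (auto simp: PiE_iff)
    ultimately have "(\<lambda>h. \<lambda>i\<in>{1..n+1}. p i h) ` ?Z \<subseteq> PiE {1..n+1} (\<lambda>i. p i ` (lspan k B - {0}))"
      by (meson image_mono subset_trans)
    moreover have "finite (PiE {1..n+1} (\<lambda>i. p i ` (lspan k B - {0})))"
      using place.lspan_finitely_many_values[OF pl B(1)] by (intro finite_PiE) auto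
    ultimately show "finite ((\<lambda>h. \<lambda>i\<in>{1..n+1}. p i h) ` ?Z)" by (rule finite_subset)
  next
    fix a :: "'a set" and s assume "a \<in> frac_ideals (int_ring ?K)"
    note a = this[unfolded int_ring]
    have "p (n+1) \<notin> p ` {1..n}"
    proof
      assume "p (n+1) \<in> p ` {1..n}"
      then obtain i where "i \<in> {1..n}" "p i = p (n+1)" by auto
      then show False using inj_onD[OF bij_betw_imp_inj_on[OF assms(1)], of i "n+1"] by auto
    qed
    moreover have "p ` {1..n} \<subseteq> infinite_places k x" unfolding surj[symmetric] by (rule image_mono) auto
    ultimately obtain h where "h \<in> a" "h \<noteq> 0" "\<forall>\<nu>\<in>p ` {1..n}. \<nu> h \<ge> - s"
      using small_element_exists[OF a, of "p ` {1..n}" "p (n+1)" "- s"] p[of "n+1"] by auto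
    then show "\<exists>h\<in>a. h \<noteq> 0 \<and> (\<forall>i\<in>{1..n}. - p i h \<le> s)" by (auto simp: minus_le_iff)
  qed
qed

end

lemma place_system_if_valid:
  fixes \<K> :: "'a :: field setting"
  assumes "valid_setting \<K>" "bij_betw p {1..n+1} (places \<K>)"
  shows "place_system \<K> n p"
proof (cases \<K>)
  case NumberField
  then have nf: "is_number_field TYPE('a)" using assms(1) by simp
  then obtain V :: "'a set" where "Ints.spans_fractions V" using number_field_spans by blast
  with nf interpret algebraic_field V by unfold_locales (simp_all add: is_number_field_def)
  show ?thesis using place_system_number_field assms(2) NumberField by simp
next
  case (FunctionField k x q)
  then have ff: "is_function_field k" "K_ring.transcendental k x" using assms(1) by simp_all
  interpret function_field k x by (rule function_field_if_valid[OF ff])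
  have "q > 1"
  proof (cases "finite k")
    case True
    then have "card {0 :: 'a, 1} \<le> card k" by (intro card_mono) (auto simp: zero_closed one_closed)
    with True assms(1) FunctionField show ?thesis by simp
  next
    case False
    with assms(1) FunctionField show ?thesis by simp
  qed
  then show ?thesis using place_system_function_field assms(2) FunctionField by simp
qed

section \<open>Minimal elements and representations\<close>

text \<open>Only the order relations between corresponding entries matter. This allows passing from
  absolute values to the exponents \<open>- p i h\<close>, and scaling two elements by a common
  factor.\<close>

lemma lexordp_eq_map_cong:
  fixes f g f' g' :: "'i \<Rightarrow> 'b :: linorder"
  assumes "\<And>i. i \<in> set xs \<Longrightarrow> f i < g i \<longleftrightarrow> f' i < g' i" "\<And>i. i \<in> set xs \<Longrightarrow> g i < f i \<longleftrightarrow> g' i < f' i"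
  shows "lexordp_eq (map f xs) (map g xs) \<longleftrightarrow> lexordp_eq (map f' xs) (map g' xs)"
  using assms by (induction xs) auto

lemma lexordp_eq_pointwise:
  fixes f g :: "'i \<Rightarrow> 'b :: linorder"
  assumes "\<And>i. i \<in> set xs \<Longrightarrow> f i \<le> g i"
  shows "lexordp_eq (map f xs) (map g xs)"
  using assms by (induction xs) (auto simp: not_less)

lemma lexordp_eq_finite_min:
  assumes "finite S" "S \<noteq> {}"
  shows "\<exists>x\<in>S. \<forall>y\<in>S. lexordp_eq x (y :: 'b :: linorder list)"
  using assms
proof (induction S rule: finite_ne_induct)
  case (insert x S)
  then obtain m where m: "m \<in> S" "\<forall>y\<in>S. lexordp_eq m y" by blast
  show ?case
  proof (cases "lexordp_eq x m")
    case True
    with m have "\<forall>y\<in>insert x S. lexordp_eq x y"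
      using lexordp_eq_trans[of x m] by (auto simp: lexordp_eq_refl)
    then show ?thesis by blast
  next
    case False
    with m show ?thesis using lexordp_eq_linear[of x m] by blast
  qed
qed (auto simp: lexordp_eq_refl)

lemma val_group_closed:
  "0 \<in> val_group \<K>" "x \<in> val_group \<K> \<Longrightarrow> y \<in> val_group \<K> \<Longrightarrow> x + y \<in> val_group \<K>"
  "x \<in> val_group \<K> \<Longrightarrow> - x \<in> val_group \<K>"
  by (cases \<K>; simp)+

lemma comm_group_val_group: "comm_group \<lparr>carrier = val_group \<K>, monoid.mult = (+), one = 0\<rparr>"
  by (rule comm_groupI) (auto simp: val_group_closed add_ac intro!: bexI[of _ "- _"])

lemma carrier_vec_group: "carrier (vec_group \<K> n) = PiE {1..n} (\<lambda>_. val_group \<K>)"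
  by (simp add: vec_group_def)

lemma mult_vec_group: "x \<otimes>\<^bsub>vec_group \<K> n\<^esub> y = (\<lambda>i\<in>{1..n}. x i + y i)"
  by (simp add: vec_group_def)

lemma comm_group_vec_group: "comm_group (vec_group \<K> n)"
proof (rule group.group_comm_groupI)
  show "group (vec_group \<K> n)"
    unfolding vec_group_def using comm_group_val_group by (intro product_group) (rule comm_group.axioms)
qed (simp add: mult_vec_group add.commute)

lemma one_vec_group: "\<one>\<^bsub>vec_group \<K> n\<^esub> = (\<lambda>i\<in>{1..n}. 0)"
  by (simp add: vec_group_def)

lemma inv_vec_group:
  assumes "x \<in> carrier (vec_group \<K> n)"
  shows "inv\<^bsub>vec_group \<K> n\<^esub> x = (\<lambda>i\<in>{1..n}. - x i)"
proof -
  interpret V: comm_group "vec_group \<K> n" by (rule comm_group_vec_group)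
  show ?thesis
    using assms
    by (intro V.inv_equality) (auto simp: mult_vec_group one_vec_group carrier_vec_group PiE_iff val_group_closed intro: restrict_ext)
qed

context place_system
begin

sublocale R: field_subring "int_ring \<K>"
  by (intro field_subring.intro subring_int_ring)

sublocale V: comm_group "vec_group \<K> n"
  by (rule comm_group_vec_group)

declare image_cong_simp [cong del]

lemma val_one: "i \<in> {1..n+1} \<Longrightarrow> p i 1 = 0"
  using val_mult[of i 1 1] by simp

lemma val_divide: "i \<in> {1..n+1} \<Longrightarrow> f \<noteq> 0 \<Longrightarrow> g \<noteq> 0 \<Longrightarrow> p i (f / g) = p i f - p i g"
  using val_mult[of i "f / g" g] by simp

lemma absval_le_iff:
  assumes "i \<in> {1..n+1}" "h \<noteq> 0"
  shows "absval \<K> (p i) h \<le> base \<K> powr (t * real (place_deg \<K> (p i))) \<longleftrightarrow> - p i h \<le> t"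
proof -
  have "- p i h * real (place_deg \<K> (p i)) \<le> t * real (place_deg \<K> (p i)) \<longleftrightarrow> - p i h \<le> t"
    using deg_pos[OF assms(1)] by (intro mult_le_cancel_right_pos) simp
  then show ?thesis using assms base_gt_1 by (simp add: absval_def powr_le_cancel_iff)
qed

lemma absval_less_iff:
  assumes "i \<in> {1..n+1}" "h \<noteq> 0" "g \<noteq> 0"
  shows "absval \<K> (p i) h < absval \<K> (p i) g \<longleftrightarrow> - p i h < - p i g"
  using assms absval_le_iff[of i g "- p i h"] by (simp add: absval_def not_le[symmetric])

lemma absval_eq_1_iff:
  assumes "i \<in> {1..n+1}" "h \<noteq> 0"
  shows "absval \<K> (p i) h = 1 \<longleftrightarrow> p i h = 0"
  using assms absval_less_iff[of i h 1] absval_less_iff[of i 1 h] val_one[of i] base_gt_1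
  by (auto simp: absval_def)

lemma all_absval_eq_1_iff:
  assumes "h \<noteq> 0"
  shows "(\<forall>\<pp>\<in>places \<K>. absval \<K> \<pp> h = 1) \<longleftrightarrow> (\<forall>i\<in>{1..n+1}. p i h = 0)"
  using assms absval_eq_1_iff by (simp flip: bij_betw_imp_surj_on[OF places])

lemma in_box_iff:
  "h \<noteq> 0 \<Longrightarrow> h \<in> box \<K> n p b t \<longleftrightarrow> h \<in> b \<and> (\<forall>i\<in>{1..n+1}. - p i h \<le> t i)"
  using absval_le_iff by (auto simp: box_def)

abbreviation key :: "'a \<Rightarrow> real list"
  where "key h \<equiv> map (\<lambda>i. - p i h) ((n+1) # [1..<n+1])"

lemma set_indices: "set ((n+1) # [1..<n+1]) = {1..n+1}"
  by auto

lemma elem_le_iff: "h \<noteq> 0 \<Longrightarrow> g \<noteq> 0 \<Longrightarrow> elem_le \<K> n p h g \<longleftrightarrow> lexordp_eq (key h) (key g)"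
  unfolding elem_le_def using set_indices absval_less_iff by (intro lexordp_eq_map_cong) blast+

lemma elem_le_scale:
  assumes "h \<noteq> 0" "g \<noteq> 0" "c \<noteq> 0"
  shows "elem_le \<K> n p (h * c) (g * c) \<longleftrightarrow> elem_le \<K> n p h g"
proof -
  have "elem_le \<K> n p (h * c) (g * c) \<longleftrightarrow> lexordp_eq (key (h * c)) (key (g * c))"
    using assms by (simp add: elem_le_iff del: list.map)
  also have "\<dots> \<longleftrightarrow> lexordp_eq (key h) (key g)"
    using assms set_indices val_mult by (intro lexordp_eq_map_cong) auto
  finally show ?thesis using assms by (simp add: elem_le_iff del: list.map)
qed

lemma elem_le_head: "h \<noteq> 0 \<Longrightarrow> g \<noteq> 0 \<Longrightarrow> - p (n+1) h < - p (n+1) g \<Longrightarrow> elem_le \<K> n p h g"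
  by (simp add: elem_le_iff)

lemma elem_le_pointwise:
  "h \<noteq> 0 \<Longrightarrow> g \<noteq> 0 \<Longrightarrow> (\<And>i. i \<in> {1..n+1} \<Longrightarrow> - p i h \<le> - p i g) \<Longrightarrow> elem_le \<K> n p h g"
  unfolding elem_le_iff using set_indices by (intro lexordp_eq_pointwise) blast

lemma elem_le_antisym:
  assumes "h \<noteq> 0" "g \<noteq> 0" "elem_le \<K> n p h g" "elem_le \<K> n p g h" "i \<in> {1..n+1}"
  shows "p i h = p i g"
proof -
  have "key h = key g" using assms by (intro lexordp_eq_antisym) (simp_all add: elem_le_iff del: list.map)
  then have "\<forall>i\<in>set ((n+1) # [1..<n+1]). - p i h = - p i g" by (simp only: map_eq_conv)
  then show ?thesis using assms(5) set_indices by (metis neg_equal_iff_equal)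
qed

text \<open>No bound is imposed at the last place: it is compared first, and so it is minimised
  first.\<close>

definition smallest :: "'a set \<Rightarrow> (nat \<Rightarrow> real) \<Rightarrow> 'a \<Rightarrow> bool"
  where "smallest a s \<mu> \<longleftrightarrow> \<mu> \<in> a \<and> \<mu> \<noteq> 0 \<and> (\<forall>i\<in>{1..n}. - p i \<mu> \<le> s i) \<and>
    (\<forall>h\<in>a. h \<noteq> 0 \<longrightarrow> (\<forall>i\<in>{1..n}. - p i h \<le> s i) \<longrightarrow> elem_le \<K> n p \<mu> h)"

lemma smallest_cong: "(\<And>i. i \<in> {1..n} \<Longrightarrow> s i = t i) \<Longrightarrow> smallest a s \<mu> \<longleftrightarrow> smallest a t \<mu>"
  by (simp add: smallest_def)

lemma smallest_unique:
  "smallest a s \<mu> \<Longrightarrow> smallest a s \<nu> \<Longrightarrow> i \<in> {1..n+1} \<Longrightarrow> p i \<mu> = p i \<nu>"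
  by (rule elem_le_antisym) (simp_all add: smallest_def)

text \<open>Only elements not exceeding a fixed \<open>h0\<close> at the last place can compete.
  They lie in a box, so finitely many keys occur among them.\<close>

lemma smallest_exists:
  assumes a: "a \<in> frac_ideals (int_ring \<K>)"
  shows "\<exists>\<mu>. smallest a s \<mu>"
proof -
  \<comment> \<open>\<open>small_element\<close> works with one bound for all places, hence the
    minimum; the inserted \<open>0\<close> serves the case \<open>n = 0\<close>.\<close>
  obtain h0 where h0: "h0 \<in> a" "h0 \<noteq> 0" "\<forall>i\<in>{1..n}. - p i h0 \<le> Min (insert 0 (s ` {1..n}))"
    using small_element[OF a] by blast
  have h0s: "- p i h0 \<le> s i" if "i \<in> {1..n}" for i
    using h0(3) that by (intro order.trans[OF bspec[OF h0(3) that] Min_le]) auto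
  define X' where "X' = {h\<in>a. h \<noteq> 0 \<and> (\<forall>i\<in>{1..n}. - p i h \<le> s i) \<and> - p (n+1) h \<le> - p (n+1) h0}"
  define C where "C = Max (insert (- p (n+1) h0) (s ` {1..n}))"
  define Y where "Y = {h\<in>a. h \<noteq> 0 \<and> (\<forall>i\<in>{1..n+1}. - p i h \<le> C)}"
  have "X' \<subseteq> Y"
  proof
    fix h assume h: "h \<in> X'"
    have "- p i h \<le> C" if "i \<in> {1..n+1}" for i
    proof (cases "i = n + 1")
      case True
      have "- p (n+1) h0 \<le> C" unfolding C_def by (rule Max_ge) auto
      with True h show ?thesis by (auto simp: X'_def)
    next
      case False
      with that have i: "i \<in> {1..n}" by auto
      then have "s i \<le> C" unfolding C_def by (intro Max_ge) auto
      with i h show ?thesis by (force simp: X'_def)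
    qed
    with h show "h \<in> Y" by (simp add: X'_def Y_def)
  qed
  have key_eq: "key h = map (\<lambda>i. - (\<lambda>i\<in>{1..n+1}. p i h) i) ((n+1) # [1..<n+1])" for h
    using set_indices by (intro map_cong) auto
  have "key ` X' \<subseteq> (\<lambda>v. map (\<lambda>i. - v i) ((n+1) # [1..<n+1])) ` (\<lambda>h. \<lambda>i\<in>{1..n+1}. p i h) ` Y"
    unfolding image_image using \<open>X' \<subseteq> Y\<close> key_eq by blast
  moreover have "finite ((\<lambda>h. \<lambda>i\<in>{1..n+1}. p i h) ` Y)" unfolding Y_def by (rule finite_values[OF a])
  ultimately have "finite (key ` X')" by (meson finite_imageI finite_subset)
  moreover have "h0 \<in> X'" using h0 h0s by (simp add: X'_def)
  ultimately obtain \<mu> where \<mu>: "\<mu> \<in> X'" "\<forall>h\<in>X'. lexordp_eq (key \<mu>) (key h)"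
    using lexordp_eq_finite_min[of "key ` X'"] by blast
  have "elem_le \<K> n p \<mu> h" if "h \<in> a" "h \<noteq> 0" "\<forall>i\<in>{1..n}. - p i h \<le> s i" for h
  proof (cases "- p (n+1) h \<le> - p (n+1) h0")
    case True
    with that have "h \<in> X'" by (simp add: X'_def)
    then have "lexordp_eq (key \<mu>) (key h)" using \<mu>(2) by blast
    moreover have "\<mu> \<noteq> 0" using \<mu>(1) by (simp add: X'_def)
    ultimately show ?thesis using that by (simp only: elem_le_iff not_False_eq_True)
  next
    case False
    with \<mu>(1) that show ?thesis by (intro elem_le_head) (auto simp: X'_def)
  qed
  with \<mu>(1) have "smallest a s \<mu>" by (simp add: smallest_def X'_def)
  then show ?thesis ..
qed

lemma scale_ideal_mem: "c \<noteq> 0 \<Longrightarrow> h \<in> scale_ideal (c :: 'a) a \<longleftrightarrow> h / c \<in> a"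
  by (auto simp: image_iff intro!: bexI[of _ "h / c"])

lemma scale_ideal_scale: "scale_ideal c (scale_ideal d a) = scale_ideal (c * d :: 'a) a"
  by (auto simp: image_image mult.assoc)

lemma scale_ideal_one: "scale_ideal (1 :: 'a) a = a"
  by auto

text \<open>Multiplication by \<open>\<mu>\<close> maps \<open>b\<close> onto \<open>a\<close>,
  preserves the order and shifts the bounds by \<open>Psi n p \<mu>\<close>. The bound
  \<open>0\<close> at the last place becomes the size of \<open>\<mu>\<close> there; elements of
  \<open>a\<close> beyond it are larger than \<open>\<mu>\<close> by the first comparison.\<close>

lemma representation_iff_smallest:
  fixes a :: "'a set"
  assumes \<mu>: "\<mu> \<noteq> 0"
  defines "b \<equiv> scale_ideal (1 / \<mu>) a"
  shows "1 \<in> box \<K> n p b (t(n+1 := 0)) - {0} \<and> (\<forall>h \<in> box \<K> n p b (t(n+1 := 0)) - {0}. elem_le \<K> n p 1 h)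
    \<longleftrightarrow> smallest a (\<lambda>i. t i - p i \<mu>) \<mu>" (is "?L \<longleftrightarrow> ?R")
proof
  assume L: ?L
  then have one: "1 \<in> b" "\<forall>i\<in>{1..n+1}. - p i 1 \<le> (t(n+1 := 0)) i" by (simp_all add: in_box_iff)
  have "\<mu> \<in> a" using one(1) \<mu> by (simp add: b_def scale_ideal_mem)
  have t: "0 \<le> t i" if "i \<in> {1..n}" for i using bspec[OF one(2), of i] that by (simp add: val_one)
  have "elem_le \<K> n p \<mu> h" if h: "h \<in> a" "h \<noteq> 0" "\<forall>i\<in>{1..n}. - p i h \<le> t i - p i \<mu>" for h
  proof (cases "- p (n+1) \<mu> < - p (n+1) h")
    case True
    with \<mu> h show ?thesis by (intro elem_le_head)
  next
    case False
    have "- p i (h / \<mu>) \<le> (t(n+1 := 0)) i" if "i \<in> {1..n+1}" for i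
    proof (cases "i = n + 1")
      case True
      with False h \<mu> show ?thesis by (simp add: val_divide)
    next
      case False
      with that have "i \<in> {1..n}" by auto
      from bspec[OF h(3) this] show ?thesis using False val_divide[OF that h(2) \<mu>] by simp
    qed
    then have "h / \<mu> \<in> box \<K> n p b (t(n+1 := 0))"
      using h \<mu> by (subst in_box_iff) (simp_all add: b_def scale_ideal_mem)
    with L h \<mu> have "elem_le \<K> n p 1 (h / \<mu>)" by simp
    with elem_le_scale[of 1 "h / \<mu>" \<mu>] h \<mu> show ?thesis by simp
  qed
  with \<open>\<mu> \<in> a\<close> t \<mu> show ?R by (simp add: smallest_def)
next
  assume R: ?R
  then have \<mu>a: "\<mu> \<in> a" and t: "\<forall>i\<in>{1..n}. 0 \<le> t i" by (auto simp: smallest_def)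
  have "1 \<in> box \<K> n p b (t(n+1 := 0))"
    using \<mu>a t \<mu> by (subst in_box_iff) (auto simp: b_def scale_ideal_mem val_one)
  moreover have "elem_le \<K> n p 1 h" if h: "h \<in> box \<K> n p b (t(n+1 := 0)) - {0}" for h
  proof -
    have "h \<noteq> 0" using h by simp
    have *: "h * \<mu> \<in> a" "\<forall>i\<in>{1..n+1}. - p i h \<le> (t(n+1 := 0)) i"
      using DiffD1[OF h] \<mu> unfolding in_box_iff[OF \<open>h \<noteq> 0\<close>] b_def by (simp_all add: scale_ideal_mem)
    have "- p i (h * \<mu>) \<le> t i - p i \<mu>" if "i \<in> {1..n}" for i
      using bspec[OF *(2), of i] that \<open>h \<noteq> 0\<close> \<mu> by (auto simp: val_mult)
    with R * \<open>h \<noteq> 0\<close> \<mu> have "elem_le \<K> n p \<mu> (h * \<mu>)" by (simp add: smallest_def)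
    with elem_le_scale[of 1 h \<mu>] \<open>h \<noteq> 0\<close> \<mu> show ?thesis by simp
  qed
  ultimately show ?L by simp
qed

text \<open>For \<open>h\<close> in the box at \<open>0\<close>, the product
  \<open>h * \<mu>\<close> satisfies the bounds imposed on \<open>\<mu>\<close>, so \<open>1\<close>
  is at most \<open>h\<close> in the order. The box gives the reverse comparison at every place, and
  antisymmetry leaves equal values.\<close>

lemma reduced_if_smallest:
  assumes "smallest a s \<mu>"
  shows "scale_ideal (1 / \<mu>) a \<in> Red \<K> n p a"
proof -
  have \<mu>: "\<mu> \<noteq> 0" "\<mu> \<in> a" using assms by (auto simp: smallest_def)
  have "\<forall>i\<in>{1..n+1}. p i h = 0"
    if h: "h \<in> box \<K> n p (scale_ideal (1 / \<mu>) a) (\<lambda>_. 0)" "h \<noteq> 0" for h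
  proof -
    have h': "h * \<mu> \<in> a" "\<forall>i\<in>{1..n+1}. - p i h \<le> 0"
      using h \<mu> by (simp_all add: in_box_iff scale_ideal_mem)
    have "- p i (h * \<mu>) \<le> s i" if "i \<in> {1..n}" for i
    proof -
      have "- p i \<mu> \<le> s i" using assms that by (simp add: smallest_def)
      moreover have "- p i h \<le> 0" using that h'(2) by simp
      ultimately show ?thesis using that h \<mu> by (simp add: val_mult)
    qed
    with assms h' h \<mu> have "elem_le \<K> n p \<mu> (h * \<mu>)" by (simp add: smallest_def)
    with elem_le_scale[of 1 h \<mu>] h \<mu> have "elem_le \<K> n p 1 h" by simp
    moreover have "elem_le \<K> n p h 1" using h h' by (intro elem_le_pointwise) (auto simp: val_one)
    ultimately have "p i 1 = p i h" if "i \<in> {1..n+1}" for i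
      using that h by (intro elem_le_antisym) auto
    then show ?thesis by (simp add: val_one)
  qed
  then have "reduced \<K> n p (scale_ideal (1 / \<mu>) a)"
    unfolding reduced_def using \<mu> by (auto simp: scale_ideal_mem all_absval_eq_1_iff simp del: One_nat_def)
  then show ?thesis using \<mu> by (auto simp: Red_def)
qed

section \<open>Ideal classes and the distance map\<close>

text \<open>The scalar is an arbitrary nonzero field element, so its own denominator
  \<open>b\<close> joins the denominator \<open>d\<close> of the ideal.\<close>

lemma frac_ideal_scale:
  assumes a: "a \<in> frac_ideals (int_ring \<K>)" and c: "c \<noteq> 0"
  shows "scale_ideal c a \<in> frac_ideals (int_ring \<K>)"
proof -
  obtain d where d: "d \<in> int_ring \<K>" "d \<noteq> 0" "\<forall>f\<in>a. d * f \<in> int_ring \<K>"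
    using frac_idealsD(3)[OF a] by blast
  obtain b where b: "b \<in> int_ring \<K> - {0}" "b * c \<in> int_ring \<K>" using denominators by blast
  have "\<forall>f\<in>scale_ideal c a. (b * d) * f \<in> int_ring \<K>"
  proof clarify
    fix f assume "f \<in> a"
    then have "(b * c) * (d * f) \<in> int_ring \<K>" using d b R.mult_closed[of "b * c" "d * f"] by blast
    then show "b * d * (c * f) \<in> int_ring \<K>" by (simp add: mult_ac)
  qed
  moreover have "b * d \<in> int_ring \<K>" "b * d \<noteq> 0" using b d R.mult_closed by auto
  moreover obtain x where "x \<in> a" "x \<noteq> 0" using a by (auto simp: frac_ideals_def)
  then have "c * x \<in> scale_ideal c a" "c * x \<noteq> 0" using c by auto
  then have "scale_ideal c a \<noteq> {0}" by blast
  moreover have "0 \<in> scale_ideal c a" using a c by (simp add: scale_ideal_mem frac_ideals_def)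
  moreover have "\<forall>f\<in>scale_ideal c a. \<forall>g\<in>scale_ideal c a. f + g \<in> scale_ideal c a"
    using a c by (simp add: scale_ideal_mem frac_ideals_def add_divide_distrib)
  moreover have "\<forall>r\<in>int_ring \<K>. \<forall>f\<in>scale_ideal c a. r * f \<in> scale_ideal c a"
  proof clarify
    fix r x assume "r \<in> int_ring \<K>" "x \<in> a"
    then have "r * x \<in> a" using a by (simp add: frac_ideals_def)
    then show "r * (c * x) \<in> scale_ideal c a" by (auto simp: mult.left_commute)
  qed
  ultimately show ?thesis unfolding frac_ideals_def by blast
qed

lemma ideal_sim_iff:
  "(b, b') \<in> ideal_sim \<K> \<longleftrightarrow> b \<in> frac_ideals (int_ring \<K>) \<and> b' \<in> frac_ideals (int_ring \<K>) \<and>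
    (\<exists>h. h \<noteq> 0 \<and> b = scale_ideal h b' \<and> (\<forall>i\<in>{1..n+1}. p i h = 0))"
  unfolding ideal_sim_def mem_Collect_eq case_prod_conv by (metis all_absval_eq_1_iff)

lemma equiv_ideal_sim: "equiv (frac_ideals (int_ring \<K>)) (ideal_sim \<K>)"
proof (rule equivI)
  show "ideal_sim \<K> \<subseteq> frac_ideals (int_ring \<K>) \<times> frac_ideals (int_ring \<K>)"
    by (auto simp: ideal_sim_def)
  show "refl_on (frac_ideals (int_ring \<K>)) (ideal_sim \<K>)"
    unfolding refl_on_def ideal_sim_iff by (auto simp: val_one intro!: exI[of _ 1])
  show "sym (ideal_sim \<K>)"
  proof (rule symI)
    fix b b' assume "(b, b') \<in> ideal_sim \<K>"
    then obtain h where h: "b \<in> frac_ideals (int_ring \<K>)" "b' \<in> frac_ideals (int_ring \<K>)"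
      "h \<noteq> 0" "b = scale_ideal h b'" "\<forall>i\<in>{1..n+1}. p i h = 0"
      unfolding ideal_sim_iff by blast
    have "b' = scale_ideal (1 / h) b" unfolding h(4) scale_ideal_scale using h(3) by (simp add: scale_ideal_one)
    moreover have "\<forall>i\<in>{1..n+1}. p i (1 / h) = 0" using h by (simp add: val_divide val_one)
    ultimately show "(b', b) \<in> ideal_sim \<K>"
      unfolding ideal_sim_iff using h by (intro conjI exI[of _ "1 / h"]) auto
  qed
  show "trans (ideal_sim \<K>)"
  proof (rule transI)
    fix b b' b'' assume "(b, b') \<in> ideal_sim \<K>" "(b', b'') \<in> ideal_sim \<K>"
    then obtain h h' where h: "b \<in> frac_ideals (int_ring \<K>)" "b'' \<in> frac_ideals (int_ring \<K>)"
      "h \<noteq> 0" "b = scale_ideal h b'" "\<forall>i\<in>{1..n+1}. p i h = 0"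
      "h' \<noteq> 0" "b' = scale_ideal h' b''" "\<forall>i\<in>{1..n+1}. p i h' = 0"
      unfolding ideal_sim_iff by blast
    have "b = scale_ideal (h * h') b''" unfolding h(4,7) scale_ideal_scale ..
    moreover have "\<forall>i\<in>{1..n+1}. p i (h * h') = 0" using h by (simp add: val_mult)
    ultimately show "(b, b'') \<in> ideal_sim \<K>"
      unfolding ideal_sim_iff using h by (intro conjI exI[of _ "h * h'"]) auto
  qed
qed

lemma sim_class_eq_iff:
  "b \<in> frac_ideals (int_ring \<K>) \<Longrightarrow> b' \<in> frac_ideals (int_ring \<K>) \<Longrightarrow>
    sim_class \<K> b = sim_class \<K> b' \<longleftrightarrow> (b, b') \<in> ideal_sim \<K>"
  by (rule eq_equiv_class_iff[OF equiv_ideal_sim])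

lemma ideal_sim_scale_iff:
  assumes "a \<in> frac_ideals (int_ring \<K>)" "c \<noteq> 0" "d \<noteq> 0"
  shows "(scale_ideal c a, scale_ideal d a) \<in> ideal_sim \<K> \<longleftrightarrow>
    (\<exists>h. h \<noteq> 0 \<and> scale_ideal c a = scale_ideal (h * d) a \<and> (\<forall>i\<in>{1..n+1}. p i h = 0))"
  unfolding ideal_sim_iff scale_ideal_scale using frac_ideal_scale[OF assms(1)] assms(2,3) by blast

definition unit_group :: "'a set"
  where "unit_group = {u \<in> int_ring \<K>. u \<noteq> 0 \<and> inverse u \<in> int_ring \<K>}"

lemma scale_ideal_unit:
  assumes a: "a \<in> frac_ideals (int_ring \<K>)" and u: "u \<in> unit_group"
  shows "scale_ideal u a = a"
proof -
  have stable: "v * x \<in> a" if "v \<in> int_ring \<K>" "x \<in> a" for v x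
    using submodule_ofD(3)[OF frac_idealsD(1)[OF a] that] .
  have u0: "u \<noteq> 0" "u \<in> int_ring \<K>" "inverse u \<in> int_ring \<K>" using u by (auto simp: unit_group_def)
  have "x \<in> scale_ideal u a" if "x \<in> a" for x
    unfolding scale_ideal_mem[OF u0(1)]
    using stable[OF u0(3) that] by (simp add: divide_inverse mult.commute)
  then show ?thesis using stable[OF u0(2)] by blast
qed

text \<open>Both \<open>u\<close> and its inverse stabilise the ideal, and stabilising elements are
  integral.\<close>

lemma unit_if_scale_ideal_eq:
  assumes a: "a \<in> frac_ideals (int_ring \<K>)" and "u \<noteq> 0" and eq: "scale_ideal u a = a"
  shows "u \<in> unit_group"
proof -
  have "u * x \<in> a" if "x \<in> a" for x using eq that by blast
  moreover have "inverse u * x \<in> a" if "x \<in> a" for x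
  proof -
    have "x \<in> scale_ideal u a" using eq that by simp
    then show ?thesis
      using \<open>u \<noteq> 0\<close> unfolding scale_ideal_mem[OF \<open>u \<noteq> 0\<close>] by (simp add: divide_inverse mult.commute)
  qed
  ultimately show ?thesis
    using stabilizer_integral[OF a] \<open>u \<noteq> 0\<close> by (simp add: unit_group_def)
qed

lemma Psi_in_carrier: "h \<noteq> 0 \<Longrightarrow> Psi n p h \<in> carrier (vec_group \<K> n)"
  by (auto simp: Psi_def carrier_vec_group intro!: val_group_closed(3) val_in_group)

lemma Psi_mult: "f \<noteq> 0 \<Longrightarrow> g \<noteq> 0 \<Longrightarrow> Psi n p (f * g) = Psi n p f \<otimes>\<^bsub>vec_group \<K> n\<^esub> Psi n p g"
  by (auto simp: Psi_def mult_vec_group val_mult intro!: restrict_ext)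

lemma unit_lattice_eq: "unit_lattice \<K> n p = Psi n p ` unit_group"
  by (simp add: unit_lattice_def unit_group_def)

lemma subgroup_unit_lattice: "subgroup (unit_lattice \<K> n p) (vec_group \<K> n)"
proof (rule V.subgroupI)
  show "unit_lattice \<K> n p \<subseteq> carrier (vec_group \<K> n)"
    using Psi_in_carrier by (auto simp: unit_lattice_eq unit_group_def)
  have "1 \<in> unit_group" by (simp add: unit_group_def R.one_closed)
  then show "unit_lattice \<K> n p \<noteq> {}" by (auto simp: unit_lattice_eq)
next
  fix x assume "x \<in> unit_lattice \<K> n p"
  then obtain u where u: "u \<in> unit_group" "x = Psi n p u" by (auto simp: unit_lattice_eq)
  then have "u \<noteq> 0" "inverse u \<in> unit_group" by (auto simp: unit_group_def)
  have "inv\<^bsub>vec_group \<K> n\<^esub> x = Psi n p (1 / u)"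
    unfolding u(2) inv_vec_group[OF Psi_in_carrier[OF \<open>u \<noteq> 0\<close>]]
    using \<open>u \<noteq> 0\<close> by (auto simp: Psi_def val_divide val_one intro!: restrict_ext)
  then show "inv\<^bsub>vec_group \<K> n\<^esub> x \<in> unit_lattice \<K> n p"
    using \<open>inverse u \<in> unit_group\<close> by (simp add: unit_lattice_eq divide_inverse)
next
  fix x y assume "x \<in> unit_lattice \<K> n p" "y \<in> unit_lattice \<K> n p"
  then obtain u v where u: "u \<in> unit_group" "x = Psi n p u" and v: "v \<in> unit_group" "y = Psi n p v"
    by (auto simp: unit_lattice_eq)
  then have "u * v \<in> unit_group" by (auto simp: unit_group_def intro: R.mult_closed)
  moreover have "x \<otimes>\<^bsub>vec_group \<K> n\<^esub> y = Psi n p (u * v)"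
    using u v by (subst Psi_mult) (auto simp: unit_group_def)
  ultimately show "x \<otimes>\<^bsub>vec_group \<K> n\<^esub> y \<in> unit_lattice \<K> n p" by (auto simp: unit_lattice_eq)
qed

lemma vec_class_eq_iff:
  assumes "x \<in> carrier (vec_group \<K> n)" "y \<in> carrier (vec_group \<K> n)"
  shows "vec_class \<K> n p x = vec_class \<K> n p y \<longleftrightarrow> (\<exists>u\<in>unit_group. x = Psi n p u \<otimes>\<^bsub>vec_group \<K> n\<^esub> y)"
proof
  assume "vec_class \<K> n p x = vec_class \<K> n p y"
  then have "x \<in> vec_class \<K> n p y" using V.rcos_self[OF assms(1) subgroup_unit_lattice] by simp
  then show "\<exists>u\<in>unit_group. x = Psi n p u \<otimes>\<^bsub>vec_group \<K> n\<^esub> y"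
    by (auto simp: r_coset_def unit_lattice_eq)
next
  assume "\<exists>u\<in>unit_group. x = Psi n p u \<otimes>\<^bsub>vec_group \<K> n\<^esub> y"
  then have "x \<in> vec_class \<K> n p y" by (auto simp: r_coset_def unit_lattice_eq)
  from V.repr_independence[OF this assms(2) subgroup_unit_lattice]
  show "vec_class \<K> n p x = vec_class \<K> n p y" by simp
qed

lemma vec_class_mult:
  assumes "x \<in> carrier (vec_group \<K> n)" "y \<in> carrier (vec_group \<K> n)"
  shows "vec_class \<K> n p x \<otimes>\<^bsub>vec_quot \<K> n p\<^esub> vec_class \<K> n p y = vec_class \<K> n p (x \<otimes>\<^bsub>vec_group \<K> n\<^esub> y)"
  using normal.rcos_sum[of "unit_lattice \<K> n p" "vec_group \<K> n" x y] assms
    V.normal_iff_subgroup subgroup_unit_lattice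
  by (simp add: vec_quot_def FactGroup_def)

lemma carrier_vec_quot: "carrier (vec_quot \<K> n p) = vec_class \<K> n p ` carrier (vec_group \<K> n)"
  by (auto simp: vec_quot_def FactGroup_def RCOSETS_def)

text \<open>The description by \<open>THE\<close> is justified as follows. If two scalings of
  \<open>a\<close> are equivalent through \<open>h\<close>, then
  \<open>u = h * \<mu> / \<nu>\<close> stabilises \<open>a\<close> and is a unit. As
  \<open>h\<close> has value \<open>0\<close> at all places, the tuples of \<open>\<mu>\<close> and
  \<open>\<nu>\<close> differ by that of \<open>u\<close>.\<close>

lemma dist_map_eq:
  assumes a: "a \<in> frac_ideals (int_ring \<K>)" and \<mu>: "\<mu> \<noteq> 0" "scale_ideal (1 / \<mu>) a \<in> Red \<K> n p a"
  shows "dist_map \<K> n p a (sim_class \<K> (scale_ideal (1 / \<mu>) a)) = vec_class \<K> n p (Psi n p \<mu>)"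
  unfolding dist_map_def
proof (rule the_equality)
  fix c
  assume "\<exists>\<nu>. \<nu> \<noteq> 0 \<and> scale_ideal (1 / \<nu>) a \<in> Red \<K> n p a \<and>
    sim_class \<K> (scale_ideal (1 / \<mu>) a) = sim_class \<K> (scale_ideal (1 / \<nu>) a) \<and> c = vec_class \<K> n p (Psi n p \<nu>)"
  then obtain \<nu> where \<nu>: "\<nu> \<noteq> 0" "c = vec_class \<K> n p (Psi n p \<nu>)"
    "sim_class \<K> (scale_ideal (1 / \<mu>) a) = sim_class \<K> (scale_ideal (1 / \<nu>) a)" by blast
  have "(scale_ideal (1 / \<mu>) a, scale_ideal (1 / \<nu>) a) \<in> ideal_sim \<K>"
    using sim_class_eq_iff[OF frac_ideal_scale[OF a] frac_ideal_scale[OF a]] \<nu> \<mu> by simp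
  then obtain h where h: "h \<noteq> 0" "scale_ideal (1 / \<mu>) a = scale_ideal (h * (1 / \<nu>)) a"
    "\<forall>i\<in>{1..n+1}. p i h = 0"
    using ideal_sim_scale_iff[OF a, of "1 / \<mu>" "1 / \<nu>"] \<mu> \<nu> by auto
  define u where "u = h * \<mu> / \<nu>"
  have "u \<noteq> 0" using h \<mu> \<nu> by (simp add: u_def)
  have "scale_ideal u a = scale_ideal \<mu> (scale_ideal (h * (1 / \<nu>)) a)"
    unfolding scale_ideal_scale by (simp add: u_def mult_ac)
  also have "\<dots> = a" unfolding h(2)[symmetric] scale_ideal_scale using \<mu> by (simp add: scale_ideal_one)
  finally have "u \<in> unit_group" by (rule unit_if_scale_ideal_eq[OF a \<open>u \<noteq> 0\<close>])
  moreover have "Psi n p \<mu> = Psi n p u \<otimes>\<^bsub>vec_group \<K> n\<^esub> Psi n p \<nu>"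
    using h \<mu> \<nu> by (auto simp: u_def Psi_def mult_vec_group val_mult val_divide intro!: restrict_ext)
  ultimately show "c = vec_class \<K> n p (Psi n p \<mu>)"
    using vec_class_eq_iff[OF Psi_in_carrier[OF \<mu>(1)] Psi_in_carrier[OF \<nu>(1)]] \<nu>(2) by blast
qed (use \<mu> in blast)

section \<open>The map on representations\<close>

lemma Phi_eq:
  assumes "a \<in> frac_ideals (int_ring \<K>)" "\<mu> \<noteq> 0" "scale_ideal (1 / \<mu>) a \<in> Red \<K> n p a"
    "t \<in> carrier (vec_group \<K> n)"
  shows "Phi \<K> n p a (sim_class \<K> (scale_ideal (1 / \<mu>) a), t)
    = vec_class \<K> n p (Psi n p \<mu> \<otimes>\<^bsub>vec_group \<K> n\<^esub> t)"
  using assms by (simp add: Phi_def dist_map_eq vec_class_mult Psi_in_carrier)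

lemma Rep_f_iff:
  "(C, t) \<in> Rep_f \<K> n p a \<longleftrightarrow> t \<in> carrier (vec_group \<K> n) \<and>
    (\<exists>\<mu>. \<mu> \<noteq> 0 \<and> C = sim_class \<K> (scale_ideal (1 / \<mu>) a) \<and> scale_ideal (1 / \<mu>) a \<in> Red \<K> n p a \<and>
      smallest a (\<lambda>i. t i - p i \<mu>) \<mu>)"
proof -
  have "(C, t) \<in> Rep_f \<K> n p a \<longleftrightarrow> t \<in> carrier (vec_group \<K> n) \<and>
    (\<exists>\<mu>. \<mu> \<noteq> 0 \<and> C = sim_class \<K> (scale_ideal (1 / \<mu>) a) \<and> scale_ideal (1 / \<mu>) a \<in> Red \<K> n p a \<and>
      1 \<in> box \<K> n p (scale_ideal (1 / \<mu>) a) (t(n+1 := 0)) - {0} \<and>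
      (\<forall>h \<in> box \<K> n p (scale_ideal (1 / \<mu>) a) (t(n+1 := 0)) - {0}. elem_le \<K> n p 1 h))"
    unfolding Rep_f_def by (auto simp: Red_def)
  then show ?thesis using representation_iff_smallest by blast
qed

lemma inj_on_Phi:
  assumes a: "a \<in> frac_ideals (int_ring \<K>)"
  shows "inj_on (Phi \<K> n p a) (Rep_f \<K> n p a)"
proof (rule inj_onI, clarify)
  fix C t C' t' assume 1: "(C, t) \<in> Rep_f \<K> n p a" and 2: "(C', t') \<in> Rep_f \<K> n p a"
    and eq: "Phi \<K> n p a (C, t) = Phi \<K> n p a (C', t')"
  obtain \<mu> where \<mu>: "t \<in> carrier (vec_group \<K> n)" "\<mu> \<noteq> 0" "C = sim_class \<K> (scale_ideal (1 / \<mu>) a)"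
    "scale_ideal (1 / \<mu>) a \<in> Red \<K> n p a" "smallest a (\<lambda>i. t i - p i \<mu>) \<mu>"
    using 1 unfolding Rep_f_iff by blast
  obtain \<nu> where \<nu>: "t' \<in> carrier (vec_group \<K> n)" "\<nu> \<noteq> 0" "C' = sim_class \<K> (scale_ideal (1 / \<nu>) a)"
    "scale_ideal (1 / \<nu>) a \<in> Red \<K> n p a" "smallest a (\<lambda>i. t' i - p i \<nu>) \<nu>"
    using 2 unfolding Rep_f_iff by blast
  have "vec_class \<K> n p (Psi n p \<mu> \<otimes>\<^bsub>vec_group \<K> n\<^esub> t) = vec_class \<K> n p (Psi n p \<nu> \<otimes>\<^bsub>vec_group \<K> n\<^esub> t')"
    using eq \<mu> \<nu> by (simp add: Phi_eq[OF a])
  then obtain u where u: "u \<in> unit_group"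
    "Psi n p \<mu> \<otimes>\<^bsub>vec_group \<K> n\<^esub> t = Psi n p u \<otimes>\<^bsub>vec_group \<K> n\<^esub> (Psi n p \<nu> \<otimes>\<^bsub>vec_group \<K> n\<^esub> t')"
    using vec_class_eq_iff[OF V.m_closed[OF Psi_in_carrier[OF \<mu>(2)] \<mu>(1)]
        V.m_closed[OF Psi_in_carrier[OF \<nu>(2)] \<nu>(1)]] by blast
  have "u \<noteq> 0" using u by (simp add: unit_group_def)
  \<comment> \<open>The lattice vector is absorbed into the second generator:
    \<open>u * \<nu>\<close> scales \<open>a\<close> to the same ideal as \<open>\<nu>\<close>, and
    now both elements are smallest for the same bounds.\<close>
  define \<nu>' where "\<nu>' = u * \<nu>"
  have \<nu>': "\<nu>' \<noteq> 0" using \<open>u \<noteq> 0\<close> \<nu> by (simp add: \<nu>'_def)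
  have "scale_ideal (1 / \<nu>) a = scale_ideal (1 / \<nu>') (scale_ideal u a)"
    unfolding scale_ideal_scale using \<open>u \<noteq> 0\<close> by (simp add: \<nu>'_def)
  then have same: "scale_ideal (1 / \<nu>) a = scale_ideal (1 / \<nu>') a"
    using scale_ideal_unit[OF a u(1)] by simp
  have *: "smallest a (\<lambda>i. t' i - p i \<nu>') \<nu>'"
    using representation_iff_smallest[OF \<nu>(2), of a t'] representation_iff_smallest[OF \<nu>', of a t'] \<nu>(5)
    unfolding same by blast
  have shift: "t' i - p i \<nu>' = t i - p i \<mu>" if "i \<in> {1..n}" for i
    using fun_cong[OF u(2), of i] that \<open>u \<noteq> 0\<close> \<nu>(2)
    by (simp add: mult_vec_group Psi_def \<nu>'_def val_mult)
  have "smallest a (\<lambda>i. t i - p i \<mu>) \<nu>'"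
    using smallest_cong[of "\<lambda>i. t' i - p i \<nu>'", OF shift] * by simp
  from smallest_unique[OF \<mu>(5) this] have val: "\<And>i. i \<in> {1..n+1} \<Longrightarrow> p i \<mu> = p i \<nu>'" .
  have "t = t'"
  proof (rule PiE_ext)
    show "t \<in> PiE {1..n} (\<lambda>_. val_group \<K>)" "t' \<in> PiE {1..n} (\<lambda>_. val_group \<K>)"
      using \<mu>(1) \<nu>(1) by (simp_all only: carrier_vec_group)
    show "t i = t' i" if "i \<in> {1..n}" for i using shift[OF that] val[of i] that by simp
  qed
  moreover have "(scale_ideal (1 / \<mu>) a, scale_ideal (1 / \<nu>') a) \<in> ideal_sim \<K>"
    using \<mu>(2) \<nu>' val ideal_sim_scale_iff[OF a, of "1 / \<mu>" "1 / \<nu>'"]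
    by (auto simp: val_divide intro!: exI[of _ "\<nu>' / \<mu>"])
  then have "C = C'"
    unfolding \<mu>(3) \<nu>(3) same using \<mu>(2) \<nu>' by (subst sim_class_eq_iff) (auto intro!: frac_ideal_scale[OF a])
  ultimately show "C = C' \<and> t = t'" by simp
qed

lemma surj_Phi:
  assumes a: "a \<in> frac_ideals (int_ring \<K>)"
  shows "Phi \<K> n p a ` Rep_f \<K> n p a = carrier (vec_quot \<K> n p)"
proof
  show "Phi \<K> n p a ` Rep_f \<K> n p a \<subseteq> carrier (vec_quot \<K> n p)"
  proof clarify
    fix C t assume "(C, t) \<in> Rep_f \<K> n p a"
    then obtain \<mu> where "t \<in> carrier (vec_group \<K> n)" "\<mu> \<noteq> 0" "C = sim_class \<K> (scale_ideal (1 / \<mu>) a)"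
      "scale_ideal (1 / \<mu>) a \<in> Red \<K> n p a"
      unfolding Rep_f_iff by blast
    then show "Phi \<K> n p a (C, t) \<in> carrier (vec_quot \<K> n p)"
      using Psi_in_carrier by (auto simp: Phi_eq[OF a] carrier_vec_quot)
  qed
  show "carrier (vec_quot \<K> n p) \<subseteq> Phi \<K> n p a ` Rep_f \<K> n p a"
  proof
    fix c assume "c \<in> carrier (vec_quot \<K> n p)"
    then obtain s where s: "s \<in> carrier (vec_group \<K> n)" "c = vec_class \<K> n p s"
      by (auto simp: carrier_vec_quot)
    obtain \<mu> where \<mu>: "smallest a s \<mu>" using smallest_exists[OF a] by blast
    then have "\<mu> \<noteq> 0" by (simp add: smallest_def)
    \<comment> \<open>This is \<open>s\<close> minus the tuple of \<open>\<mu>\<close>, so the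
      bounds attached to the representation are \<open>s\<close> again.\<close>
    define t where "t = (\<lambda>i\<in>{1..n}. s i + p i \<mu>)"
    have "s i + p i \<mu> \<in> val_group \<K>" if "i \<in> {1..n}" for i
    proof (rule val_group_closed(2))
      show "s i \<in> val_group \<K>" using s(1) that by (simp add: carrier_vec_group PiE_iff)
      show "p i \<mu> \<in> val_group \<K>" using that \<open>\<mu> \<noteq> 0\<close> by (intro val_in_group) auto
    qed
    then have t: "t \<in> carrier (vec_group \<K> n)" by (simp add: t_def carrier_vec_group PiE_iff)
    have "smallest a (\<lambda>i. t i - p i \<mu>) \<mu>"
      using \<mu> by (subst smallest_cong[where t = s]) (auto simp: t_def)
    then have "(sim_class \<K> (scale_ideal (1 / \<mu>) a), t) \<in> Rep_f \<K> n p a"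
      using t \<open>\<mu> \<noteq> 0\<close> reduced_if_smallest[OF \<mu>] by (auto simp: Rep_f_iff)
    moreover have "Psi n p \<mu> \<otimes>\<^bsub>vec_group \<K> n\<^esub> t = s"
    proof (rule PiE_ext)
      show "Psi n p \<mu> \<otimes>\<^bsub>vec_group \<K> n\<^esub> t \<in> PiE {1..n} (\<lambda>_. val_group \<K>)"
        using V.m_closed[OF Psi_in_carrier[OF \<open>\<mu> \<noteq> 0\<close>] t] by (simp only: carrier_vec_group)
      show "s \<in> PiE {1..n} (\<lambda>_. val_group \<K>)" using s(1) by (simp only: carrier_vec_group)
    qed (simp add: mult_vec_group Psi_def t_def)
    then have "c = Phi \<K> n p a (sim_class \<K> (scale_ideal (1 / \<mu>) a), t)"
      using s(2) t \<open>\<mu> \<noteq> 0\<close> reduced_if_smallest[OF \<mu>] by (simp add: Phi_eq[OF a])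
    ultimately show "c \<in> Phi \<K> n p a ` Rep_f \<K> n p a" by blast
  qed
qed

text \<open>All nonzero elements of the box at \<open>0\<close> of a reduced ideal have the absolute
  values of \<open>1\<close>, so none of them is smaller.\<close>

lemma zero_in_Rep_f:
  assumes "C \<in> Red \<K> n p a // ideal_sim \<K>"
  shows "(C, \<lambda>i\<in>{1..n}. 0) \<in> Rep_f \<K> n p a"
proof -
  obtain b where b: "b \<in> Red \<K> n p a" "C = sim_class \<K> b" using assms by (auto elim: quotientE)
  \<comment> \<open>The restricted tuple is \<open>undefined\<close> beyond \<open>n\<close>; the
    update at \<open>n + 1\<close> supplies the one further entry that the box reads.\<close>
  have box: "box \<K> n p b ((\<lambda>i\<in>{1..n}. 0)(n+1 := 0)) = box \<K> n p b (\<lambda>_. 0)"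
    unfolding box_def by (intro Collect_cong conj_cong ball_cong) auto
  have red: "1 \<in> b" "\<And>h. h \<in> box \<K> n p b (\<lambda>_. 0) \<Longrightarrow> h \<noteq> 0 \<Longrightarrow> \<forall>i\<in>{1..n+1}. p i h = 0"
    using b(1) all_absval_eq_1_iff unfolding Red_def reduced_def by blast+
  have "1 \<in> box \<K> n p b ((\<lambda>i\<in>{1..n}. 0)(n+1 := 0)) - {0}"
    unfolding box using red(1) by (simp add: in_box_iff val_one)
  moreover have "\<forall>h\<in>box \<K> n p b ((\<lambda>i\<in>{1..n}. 0)(n+1 := 0)) - {0}. elem_le \<K> n p 1 h"
    unfolding box
  proof
    fix h assume "h \<in> box \<K> n p b (\<lambda>_. 0) - {0}"
    then show "elem_le \<K> n p 1 h" using red(2)[of h] by (intro elem_le_pointwise) (auto simp: val_one)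
  qed
  moreover have "(\<lambda>i\<in>{1..n}. 0) \<in> carrier (vec_group \<K> n)"
    using V.one_closed by (simp add: one_vec_group)
  ultimately show ?thesis unfolding Rep_f_def using b by blast
qed

end

theorem theorem6p8:
  fixes \<K> :: "'a :: field setting" and n :: nat and p :: "nat \<Rightarrow> 'a \<Rightarrow> real" and a :: "'a set"
  assumes "valid_setting \<K>"
    and "bij_betw p {1..n+1} (places \<K>)"
    and "a \<in> frac_ideals (int_ring \<K>)"
  shows "bij_betw (Phi \<K> n p a) (Rep_f \<K> n p a) (carrier (vec_quot \<K> n p)) \<and>
    (\<forall>C \<in> Red \<K> n p a // ideal_sim \<K>. (C, \<lambda>i\<in>{1..n}. 0) \<in> Rep_f \<K> n p a)"
proof -
  interpret place_system \<K> n p by (rule place_system_if_valid[OF assms(1,2)])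
  show ?thesis
    unfolding bij_betw_def using inj_on_Phi[OF assms(3)] surj_Phi[OF assms(3)] zero_in_Rep_f by blast
qed

end
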